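(* There exists a subgroup $V\leq \mathbb{Z}_2^{\oplus\mathbf{F}_2}$, invariant under left translation by $\mathbf{F}_2$, such that the finitely generated group $\Gamma=(\mathbb{Z}_2^{\oplus\mathbf{F}_2}/V)\rtimes\mathbf{F}_2$ admits a group ring element $Q\in\mathbb{Q}\Gamma$ with rational coefficients whose kernel has irrational (and even transcendental) von Neumann dimension $\dim_{L\Gamma}\ker Q$.
   Context: $\mathbf{F}_2$ is the free group on two generators, $\mathbb{Z}_2$ is the cyclic group of order $2$, and $\mathbb{Z}_2^{\oplus \mathbf{F}_2}$ is the direct sum of copies of $\mathbb{Z}_2$ indexed by $\mathbf{F}_2$. The left translation action of $\mathbf{F}_2$ is $\alpha^g\big((u_h)_{h\in\mathbf{F}_2}\big)=(u_{g^{-1}h})_{h\in\mathbf{F}_2}$; for an invariant subgroup $V$ it descends to an action by automorphisms on $U=\mathbb{Z}_2^{\oplus\mathbf{F}_2}/V$. The semidirect product $U\rtimes\mathbf{F}_2$ is the set $U\times\mathbf{F}_2$ with multiplication $(u,g)\cdot(w,h)=(\alpha^{h^{-1}}(u)+w,\,gh)$. For a countable discrete group $\Gamma$, $\mathbb{Q}\Gamma$ is its rational group ring, $\lambda$ is the left regular representation on $\ell^2(\Gamma)$, and $L\Gamma$ is the group von Neumann algebra (weak operator closure of $\lambda(\mathbb{C}\Gamma)$ in $\mathcal{B}(\ell^2(\Gamma))$). Elements of $\mathbb{Q}\Gamma$ are identified with their images under $\lambda$, so $\ker Q$ means the kernel of the bounded operator $\lambda(Q)$ on $\ell^2(\Gamma)$.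 $\dim_{L\Gamma}\ker Q$ is the canonical trace $\langle p\,\delta_e,\delta_e\rangle$ of the orthogonal projection $p\in L\Gamma$ onto $\ker Q$. *)

theory Defs
  imports "HOL-Analysis.Analysis" "HOL-Algebra.Product_Groups" "HOL-Algebra.Elementary_Groups"
begin

section \<open>Free groups\<close>

text \<open>The free group on the type \<open>'a\<close>, realised on reduced words. The letter \<open>(a, True)\<close> is the
  generator \<open>a\<close> and \<open>(a, False)\<close> is its inverse. Multiplication is concatenation followed by
  free reduction, performed by pushing the letters of the left factor one at a time.\<close>

definition letter_inv :: "'a \<times> bool \<Rightarrow> 'a \<times> bool" where
  "letter_inv x = (fst x, \<not> snd x)"

definition reduced :: "('a \<times> bool) list \<Rightarrow> bool" where
  "reduced w \<longleftrightarrow> successively (\<lambda>x y. y \<noteq> letter_inv x) w"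

definition push :: "'a \<times> bool \<Rightarrow> ('a \<times> bool) list \<Rightarrow> ('a \<times> bool) list" where
  "push x w = (case w of [] \<Rightarrow> [x] | y # ys \<Rightarrow> if y = letter_inv x then ys else x # w)"

definition free_group :: "('a \<times> bool) list monoid" where
  "free_group = \<lparr>carrier = {w. reduced w}, monoid.mult = foldr push, one = []\<rparr>"

abbreviation F2 :: "(bool \<times> bool) list monoid" where
  "F2 \<equiv> free_group"

lemma letter_inv_letter_inv [simp]: "letter_inv (letter_inv x) = x"
  by (simp add: letter_inv_def)

lemma reduced_push: "reduced w \<Longrightarrow> reduced (push x w)"
  by (auto simp: push_def reduced_def successively_Cons split: list.splits)

lemma reduced_foldr_push: "reduced w \<Longrightarrow> reduced (foldr push v w)"
  by (induction v) (auto intro: reduced_push)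

lemma push_push_inv:
  assumes "reduced w"
  shows "push x (push (letter_inv x) w) = w"
  using assms by (cases w) (auto simp: push_def reduced_def successively_Cons split: list.splits)

lemma foldr_push_push:
  assumes "reduced w"
  shows "foldr push (push x v) w = push x (foldr push v w)"
proof (cases v)
  case (Cons y ys)
  show ?thesis
  proof (cases "y = letter_inv x")
    case True
    then show ?thesis
      using Cons push_push_inv[OF reduced_foldr_push[OF assms], of x ys]
      by (simp add: push_def)
  next
    case False
    then have "push x v = x # v"
      using Cons by (simp add: push_def)
    then show ?thesis by simp
  qed
qed (simp add: push_def)

lemma foldr_push_assoc:
  "reduced w \<Longrightarrow> foldr push (foldr push u v) w = foldr push u (foldr push v w)"
  by (induction u) (auto simp: foldr_push_push)

lemma foldr_push_reduced: "reduced w \<Longrightarrow> foldr push w [] = w"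
proof (induction w)
  case (Cons x w)
  then show ?case
    by (cases w) (auto simp: reduced_def push_def)
qed simp

lemma foldr_push_inverse: "foldr push (rev (map letter_inv w)) w = []"
  by (induction w) (auto simp: push_def)

lemma reduced_inverse:
  assumes "reduced w"
  shows "reduced (rev (map letter_inv w))"
proof -
  have "successively (\<lambda>x y. x \<noteq> letter_inv y) (map letter_inv w)"
    unfolding successively_map
    by (rule successively_mono[OF assms[unfolded reduced_def]]) (metis letter_inv_letter_inv)
  then show ?thesis
    by (simp add: reduced_def)
qed

lemma group_free_group: "group free_group"
proof (rule groupI)
  fix x :: "('a \<times> bool) list" assume "x \<in> carrier free_group"
  then have "reduced x" by (simp add: free_group_def)
  then show "\<exists>y\<in>carrier free_group. y \<otimes>\<^bsub>free_group\<^esub> x = \<one>\<^bsub>free_group\<^esub>"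
    by (intro bexI[of _ "rev (map letter_inv x)"])
       (simp_all add: free_group_def foldr_push_inverse reduced_inverse)
qed (auto simp: free_group_def reduced_foldr_push foldr_push_assoc, simp add: reduced_def)


section \<open>Semidirect products\<close>

definition semidirect ::
  "('a, 'c) monoid_scheme \<Rightarrow> ('b, 'd) monoid_scheme \<Rightarrow> ('b \<Rightarrow> 'a \<Rightarrow> 'a) \<Rightarrow> ('a \<times> 'b) monoid" where
  "semidirect U F act =
     \<lparr>carrier = carrier U \<times> carrier F,
      monoid.mult = (\<lambda>(u, g) (w, h). (act (inv\<^bsub>F\<^esub> h) u \<otimes>\<^bsub>U\<^esub> w, g \<otimes>\<^bsub>F\<^esub> h)),
      one = (\<one>\<^bsub>U\<^esub>, \<one>\<^bsub>F\<^esub>)\<rparr>"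

lemma group_semidirect:
  assumes "group U" "group F"
    and hom: "\<And>g. g \<in> carrier F \<Longrightarrow> act g \<in> hom U U"
    and act_one: "\<And>u. u \<in> carrier U \<Longrightarrow> act \<one>\<^bsub>F\<^esub> u = u"
    and act_mult: "\<And>g h u. \<lbrakk>g \<in> carrier F; h \<in> carrier F; u \<in> carrier U\<rbrakk>
                     \<Longrightarrow> act (g \<otimes>\<^bsub>F\<^esub> h) u = act g (act h u)"
  shows "group (semidirect U F act)"
proof -
  interpret U: group U by fact
  interpret F: group F by fact
  have cl: "act g u \<in> carrier U" if "g \<in> carrier F" "u \<in> carrier U" for g u
    using hom[OF that(1)] that(2) by (auto simp: hom_def)
  have ml: "act g (u \<otimes>\<^bsub>U\<^esub> w) = act g u \<otimes>\<^bsub>U\<^esub> act g w"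
    if "g \<in> carrier F" "u \<in> carrier U" "w \<in> carrier U" for g u w
    using hom[OF that(1)] that(2,3) by (auto simp: hom_def)
  have one: "act g \<one>\<^bsub>U\<^esub> = \<one>\<^bsub>U\<^esub>" if "g \<in> carrier F" for g
    using hom_one[OF hom[OF that] \<open>group U\<close> \<open>group U\<close>] .
  show ?thesis
  proof (rule groupI)
    fix x assume "x \<in> carrier (semidirect U F act)"
    then obtain u g where x: "x = (u, g)" "u \<in> carrier U" "g \<in> carrier F"
      by (auto simp: semidirect_def)
    show "\<exists>y\<in>carrier (semidirect U F act). y \<otimes>\<^bsub>semidirect U F act\<^esub> x = \<one>\<^bsub>semidirect U F act\<^esub>"
    proof (rule bexI)
      show "(act g (inv\<^bsub>U\<^esub> u), inv\<^bsub>F\<^esub> g) \<otimes>\<^bsub>semidirect U F act\<^esub> x = \<one>\<^bsub>semidirect U F act\<^esub>"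
        using x by (simp add: semidirect_def act_one flip: act_mult)
      show "(act g (inv\<^bsub>U\<^esub> u), inv\<^bsub>F\<^esub> g) \<in> carrier (semidirect U F act)"
        using x by (simp add: semidirect_def cl)
    qed
  qed (auto simp: semidirect_def cl ml one act_mult U.m_assoc F.m_assoc F.inv_mult_group)
qed


section \<open>Quotients of the direct sum of copies of the group of order two\<close>

abbreviation Z2_sum :: "('a, 'b) monoid_scheme \<Rightarrow> ('a \<Rightarrow> int) monoid" where
  "Z2_sum F \<equiv> sum_group (carrier F) (\<lambda>_. integer_mod_group 2)"

text \<open>Elements of \<^const>\<open>sum_group\<close> are extensional functions, hence the restriction.\<close>

definition translate :: "('a, 'b) monoid_scheme \<Rightarrow> 'a \<Rightarrow> ('a \<Rightarrow> 'c) \<Rightarrow> 'a \<Rightarrow> 'c" where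
  "translate F g u = (\<lambda>h\<in>carrier F. u (inv\<^bsub>F\<^esub> g \<otimes>\<^bsub>F\<^esub> h))"

definition translation_invariant :: "('a, 'b) monoid_scheme \<Rightarrow> ('a \<Rightarrow> 'c) set \<Rightarrow> bool" where
  "translation_invariant F V \<longleftrightarrow> (\<forall>g\<in>carrier F. \<forall>v\<in>V. translate F g v \<in> V)"

text \<open>An element of the quotient is a coset, on which the induced action is the image map.\<close>

definition Z2_sum_quotient_semidirect ::
  "('a, 'b) monoid_scheme \<Rightarrow> ('a \<Rightarrow> int) set \<Rightarrow> (('a \<Rightarrow> int) set \<times> 'a) monoid" where
  "Z2_sum_quotient_semidirect F V = semidirect (Z2_sum F Mod V) F (\<lambda>g C. translate F g ` C)"

lemma translate_closed:
  assumes "group F" "g \<in> carrier F" "u \<in> carrier (Z2_sum F)"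
  shows "translate F g u \<in> carrier (Z2_sum F)"
proof -
  interpret F: group F by fact
  have u: "u \<in> carrier F \<rightarrow>\<^sub>E carrier (integer_mod_group 2)"
    and fin: "finite {i \<in> carrier F. u i \<noteq> 0}"
    using assms(3) by (auto simp: carrier_sum_group)
  have "{i \<in> carrier F. translate F g u i \<noteq> 0} \<subseteq> (\<lambda>i. g \<otimes>\<^bsub>F\<^esub> i) ` {i \<in> carrier F. u i \<noteq> 0}"
  proof
    fix i assume i: "i \<in> {i \<in> carrier F. translate F g u i \<noteq> 0}"
    then have "inv\<^bsub>F\<^esub> g \<otimes>\<^bsub>F\<^esub> i \<in> {i \<in> carrier F. u i \<noteq> 0}"
      using assms(2) by (auto simp: translate_def split: if_splits)
    moreover have "i = g \<otimes>\<^bsub>F\<^esub> (inv\<^bsub>F\<^esub> g \<otimes>\<^bsub>F\<^esub> i)"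
      using i assms(2) by (simp add: F.m_assoc[symmetric])
    ultimately show "i \<in> (\<lambda>i. g \<otimes>\<^bsub>F\<^esub> i) ` {i \<in> carrier F. u i \<noteq> 0}"
      by blast
  qed
  then have "finite {i \<in> carrier F. translate F g u i \<noteq> 0}"
    using fin finite_subset by blast
  then show ?thesis
    using u assms(2) by (auto simp: carrier_sum_group translate_def PiE_iff)
qed

lemma translate_mult:
  assumes "group F" "g \<in> carrier F"
  shows "translate F g (u \<otimes>\<^bsub>Z2_sum F\<^esub> w) = translate F g u \<otimes>\<^bsub>Z2_sum F\<^esub> translate F g w"
proof -
  interpret F: group F by fact
  show ?thesis using assms(2) by (auto simp: translate_def fun_eq_iff)
qed

lemma translate_one:
  assumes "group F" "u \<in> carrier (Z2_sum F)"
  shows "translate F \<one>\<^bsub>F\<^esub> u = u"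
proof -
  interpret F: group F by fact
  show ?thesis
    using assms(2) by (auto simp: translate_def carrier_sum_group fun_eq_iff PiE_iff extensional_def)
qed

lemma translate_translate:
  assumes "group F" "g \<in> carrier F" "h \<in> carrier F"
  shows "translate F (g \<otimes>\<^bsub>F\<^esub> h) u = translate F g (translate F h u)"
proof -
  interpret F: group F by fact
  show ?thesis
    using assms(2,3) by (auto simp: translate_def fun_eq_iff F.inv_mult_group F.m_assoc)
qed

lemma translate_image_invariant:
  assumes "group F" "subgroup V (Z2_sum F)" "translation_invariant F V" "g \<in> carrier F"
  shows "translate F g ` V = V"
proof
  interpret F: group F by fact
  show "translate F g ` V \<subseteq> V"
    using assms by (auto simp: translation_invariant_def)
  show "V \<subseteq> translate F g ` V"
  proof
    fix v assume v: "v \<in> V"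
    have "translate F (inv\<^bsub>F\<^esub> g) v \<in> V"
      using v assms(3,4) by (simp add: translation_invariant_def)
    moreover have "translate F g (translate F (inv\<^bsub>F\<^esub> g) v) = v"
      using translate_translate[OF assms(1,4), of "inv\<^bsub>F\<^esub> g" v] assms(4)
        translate_one[OF assms(1)] subgroup.mem_carrier[OF assms(2) v] by simp
    ultimately show "v \<in> translate F g ` V" by force
  qed
qed

lemma group_Z2_sum_quotient_semidirect:
  assumes "group F" "subgroup V (Z2_sum F)" "translation_invariant F V"
  shows "group (Z2_sum_quotient_semidirect F V)"
proof -
  let ?A = "Z2_sum F"
  interpret F: group F by fact
  interpret A: comm_group ?A
    by (rule group.group_comm_groupI) (auto simp: add.commute fun_eq_iff)
  have V: "V \<lhd> ?A"
    using assms(2) A.subgroup_imp_normal by blast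
  have mult: "translate F g ` (C <#>\<^bsub>?A\<^esub> D) = translate F g ` C <#>\<^bsub>?A\<^esub> translate F g ` D"
    if "g \<in> carrier F" for g C D
    unfolding set_mult_def
    by (auto simp: image_UN translate_mult[OF assms(1) that] simp del: mult_sum_group)
  have coset: "translate F g ` (V #>\<^bsub>?A\<^esub> a) = V #>\<^bsub>?A\<^esub> translate F g a"
    if "g \<in> carrier F" for g a
  proof -
    have "V #>\<^bsub>?A\<^esub> a = V <#>\<^bsub>?A\<^esub> {a}" for a
      by (simp add: r_coset_eq_set_mult)
    then show ?thesis
      using mult[OF that, of V "{a}"] translate_image_invariant[OF assms that] by simp
  qed
  have sub: "C \<subseteq> carrier ?A" if "C \<in> carrier (?A Mod V)" for C
    using that A.r_coset_subset_G[OF subgroup.subset[OF assms(2)]]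
    by (auto simp: carrier_FactGroup)
  show ?thesis
    unfolding Z2_sum_quotient_semidirect_def
  proof (rule group_semidirect)
    show "group (?A Mod V)"
      using V by (rule normal.factorgroup_is_group)
    show "(`) (translate F g) \<in> hom (?A Mod V) (?A Mod V)" if "g \<in> carrier F" for g
      using that
      by (auto simp: hom_def carrier_FactGroup coset mult translate_closed assms(1) simp del: mult_sum_group)
    show "translate F \<one>\<^bsub>F\<^esub> ` C = C" if "C \<in> carrier (?A Mod V)" for C
      using translate_one[OF assms(1)] sub[OF that] by (force simp: image_iff)
    show "translate F (g \<otimes>\<^bsub>F\<^esub> h) ` C = translate F g ` translate F h ` C"
      if "g \<in> carrier F" "h \<in> carrier F" for g h C
      by (simp add: image_image translate_translate[OF assms(1) that])
  qed fact
qed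

definition finitely_generated :: "('a, 'b) monoid_scheme \<Rightarrow> bool" where
  "finitely_generated G \<longleftrightarrow> (\<exists>S. finite S \<and> S \<subseteq> carrier G \<and> generate G S = carrier G)"


section \<open>Square-summable functions and von Neumann dimension\<close>

text \<open>Functions on a group \<open>G\<close> are represented by functions on the underlying type that vanish
  outside the carrier.\<close>

definition ell2 :: "('a, 'b) monoid_scheme \<Rightarrow> ('a \<Rightarrow> complex) set" where
  "ell2 G = {f. (\<forall>x. x \<notin> carrier G \<longrightarrow> f x = 0) \<and> (\<lambda>x. (cmod (f x))\<^sup>2) summable_on carrier G}"

definition ell2_inner ::
  "('a, 'b) monoid_scheme \<Rightarrow> ('a \<Rightarrow> complex) \<Rightarrow> ('a \<Rightarrow> complex) \<Rightarrow> complex" where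
  "ell2_inner G f h = (\<Sum>\<^sub>\<infinity>x\<in>carrier G. f x * cnj (h x))"

definition ell2_delta :: "'a \<Rightarrow> 'a \<Rightarrow> complex" where
  "ell2_delta g x = (if x = g then 1 else 0)"

definition rat_group_ring :: "('a, 'b) monoid_scheme \<Rightarrow> ('a \<Rightarrow> rat) set" where
  "rat_group_ring G = {Q. finite {g. Q g \<noteq> 0} \<and> {g. Q g \<noteq> 0} \<subseteq> carrier G}"

definition left_regular ::
  "('a, 'b) monoid_scheme \<Rightarrow> 'a \<Rightarrow> ('a \<Rightarrow> complex) \<Rightarrow> 'a \<Rightarrow> complex" where
  "left_regular G g f x = (if x \<in> carrier G then f (inv\<^bsub>G\<^esub> g \<otimes>\<^bsub>G\<^esub> x) else 0)"

definition left_regular_ring ::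
  "('a, 'b) monoid_scheme \<Rightarrow> ('a \<Rightarrow> rat) \<Rightarrow> ('a \<Rightarrow> complex) \<Rightarrow> 'a \<Rightarrow> complex" where
  "left_regular_ring G Q f x = (\<Sum>g | Q g \<noteq> 0. of_rat (Q g) * left_regular G g f x)"

definition ell2_kernel :: "('a, 'b) monoid_scheme \<Rightarrow> ('a \<Rightarrow> rat) \<Rightarrow> ('a \<Rightarrow> complex) set" where
  "ell2_kernel G Q = {f \<in> ell2 G. left_regular_ring G Q f = (\<lambda>_. 0)}"

text \<open>For a closed subspace \<open>K\<close> of \<^term>\<open>ell2 G\<close> and \<^term>\<open>f \<in> ell2 G\<close>, the point described here
  exists and is unique by the Hilbert projection theorem.\<close>

definition ell2_proj ::
  "('a, 'b) monoid_scheme \<Rightarrow> ('a \<Rightarrow> complex) set \<Rightarrow> ('a \<Rightarrow> complex) \<Rightarrow> 'a \<Rightarrow> complex" where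
  "ell2_proj G K f = (THE p. p \<in> K \<and> (\<forall>k\<in>K. ell2_inner G (\<lambda>x. f x - p x) k = 0))"

definition vn_trace ::
  "('a, 'b) monoid_scheme \<Rightarrow> (('a \<Rightarrow> complex) \<Rightarrow> 'a \<Rightarrow> complex) \<Rightarrow> complex" where
  "vn_trace G T = ell2_inner G (T (ell2_delta \<one>\<^bsub>G\<^esub>)) (ell2_delta \<one>\<^bsub>G\<^esub>)"

text \<open>The dimension is complex-valued only because the inner product is: the trace of an orthogonal
  projection \<open>p\<close> is the squared norm of \<open>p \<delta>\<^sub>e\<close>.\<close>

definition vn_dim :: "('a, 'b) monoid_scheme \<Rightarrow> ('a \<Rightarrow> complex) set \<Rightarrow> complex" where
  "vn_dim G K = vn_trace G (ell2_proj G K)"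

end

theory Submission
  imports Defs "HOL-Library.Function_Algebras" "HOL-Real_Asymp.Real_Asymp"
begin

text \<open>
  Let \<open>F\<^sub>2\<close> act on a set \<open>X\<close> with base point \<open>x\<^sub>0\<close>, and let \<open>V\<close> consist of the \<open>u\<close> for which
  every fibre of \<open>g \<mapsto> g x\<^sub>0\<close> contains an even number of points of the support of \<open>u\<close>. Then \<open>\<Gamma>\<close> is a
  lamplighter group whose lamps sit on the orbit of \<open>x\<^sub>0\<close>. By finite Fourier analysis, an event \<open>P\<close>
  about finitely many bits of a configuration \<open>\<omega> \<subseteq> X\<close> becomes an idempotent \<open>op P\<close> of \<open>\<rat>\<Gamma>\<close>, whose
  trace is the probability of \<open>P\<close> under fair coin tosses, and conjugation by \<open>F\<^sub>2\<close> translates events.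

  The element \<open>Q\<close> is chosen such that, informally, a function in its kernel is constant on every
  cluster of the random set \<open>{g. g x\<^sub>0 \<in> \<omega>}\<close> in the Cayley graph of \<open>F\<^sub>2\<close> and vanishes unless every
  point of the cluster looks as in a translate of an L-shape \<open>{a\<^sup>i | i \<le> m} \<union> {b\<^sup>j | j \<le> n}\<close>. Infinite
  clusters have probability zero, so the dimension of the kernel is the sum over \<open>m\<close> and \<open>n\<close> of
  \<open>2\<^sup>-\<^sup>N\<close>, where \<open>N\<close> is the number of points of \<open>X\<close> that have to be inspected in order to recognise
  the L-shape with arms of length \<open>m\<close> and \<open>n\<close>.

  For a set \<open>I\<close> of natural numbers there is an action in which the only coincidences among the
  inspected points, apart from the trivial ones, are \<open>a\<^sup>i b x\<^sub>0 = b\<^sup>i a x\<^sub>0\<close> for \<open>i - 1 \<in> I\<close>. The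
  dimension is then strictly increasing in \<open>I\<close>. Along the chain of sets \<open>{n. q\<^sub>n < r}\<close>, where \<open>q\<close>
  enumerates the rationals and \<open>r\<close> is real, it takes uncountably many values, one of which is
  therefore transcendental.
\<close>

section \<open>Square-summable functions\<close>

text \<open>An element of finite support cannot test directly for an L-shape of unbounded size.
  \<open>Q\<close> is therefore a sum of three positive operators: the event that the base does not
  look locally like a point of an L-shape, and one graph Laplacian per generator along the edges
  with both ends lit. A kernel function is killed by each summand, so the local test propagates
  along the cluster. The role of constancy is to make a cluster with m + n + 1 vertices contribute
  one dimension: each vertex occurs with probability 2^-N, and averaging divides by the number of
  vertices. An L-shape is used because its boundary contains the points a^i b x_0 along one arm and
  b^i a x_0 along the other. Since the group is free, any two permutations of X define an action, so
  for each i > 0 these two points may be identified or kept apart at will. Each identification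
  lowers N for the shapes that test both points. No dimension is ever evaluated: the series for
  different I are only compared term by term.\<close>

lemma sum_fun_apply: "(\<Sum>i\<in>A. F i) x = (\<Sum>i\<in>A. F i x :: 'b::comm_monoid_add)"
  by (induction A rule: infinite_finite_induct) auto

definition scale_fun :: "complex \<Rightarrow> ('a \<Rightarrow> complex) \<Rightarrow> 'a \<Rightarrow> complex" where
  "scale_fun c f = (\<lambda>x. c * f x)"

lemma scale_fun_apply [simp]: "scale_fun c f x = c * f x"
  by (simp add: scale_fun_def)

definition ell2_norm :: "('a, 'b) monoid_scheme \<Rightarrow> ('a \<Rightarrow> complex) \<Rightarrow> real" where
  "ell2_norm G f = sqrt (\<Sum>\<^sub>\<infinity>x\<in>carrier G. (cmod (f x))\<^sup>2)"

context
  fixes G :: "('a, 'b) monoid_scheme"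
begin

lemma ell2_outside: "f \<in> ell2 G \<Longrightarrow> x \<notin> carrier G \<Longrightarrow> f x = 0"
  by (simp add: ell2_def)

lemma L2_set_le_ell2_norm:
  assumes "f \<in> ell2 G" "finite F" "F \<subseteq> carrier G"
  shows "L2_set (\<lambda>x. cmod (f x)) F \<le> ell2_norm G f"
  unfolding L2_set_def ell2_norm_def
  using assms by (intro real_sqrt_le_mono finite_sum_le_infsum) (auto simp: ell2_def)

text \<open>Uniform bounds on finite subsets give membership and the norm bound at once, so
  inequalities for \<open>L2_set\<close> transfer to \<open>ell2_norm\<close>.\<close>

lemma ell2_bounded:
  assumes "\<And>x. x \<notin> carrier G \<Longrightarrow> f x = 0"
    and "\<And>F. finite F \<Longrightarrow> F \<subseteq> carrier G \<Longrightarrow> L2_set (\<lambda>x. cmod (f x)) F \<le> B"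
  shows "f \<in> ell2 G" "ell2_norm G f \<le> B"
proof -
  have B: "0 \<le> B" using assms(2)[of "{}"] by simp
  have le: "(\<Sum>x\<in>F. (cmod (f x))\<^sup>2) \<le> B\<^sup>2" if "finite F" "F \<subseteq> carrier G" for F
    using assms(2)[OF that] B unfolding L2_set_def
    by (metis real_sqrt_le_iff real_sqrt_abs abs_of_nonneg)
  have sm: "(\<lambda>x. (cmod (f x))\<^sup>2) summable_on carrier G"
    by (rule nonneg_bdd_above_summable_on) (auto intro!: bdd_aboveI[of _ "B\<^sup>2"] le)
  then show "f \<in> ell2 G" using assms(1) by (simp add: ell2_def)
  have "(\<Sum>\<^sub>\<infinity>x\<in>carrier G. (cmod (f x))\<^sup>2) \<le> B\<^sup>2"
    by (rule infsum_le_finite_sums[OF sm]) (auto intro: le)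
  then show "ell2_norm G f \<le> B"
    unfolding ell2_norm_def using B by (metis real_sqrt_le_iff real_sqrt_abs abs_of_nonneg)
qed

lemma ell2_norm_nonneg: "0 \<le> ell2_norm G f"
  by (simp add: ell2_norm_def infsum_nonneg)

lemma
  assumes "f \<in> ell2 G" "h \<in> ell2 G"
  shows ell2_add: "f + h \<in> ell2 G"
    and ell2_norm_triangle: "ell2_norm G (f + h) \<le> ell2_norm G f + ell2_norm G h"
proof -
  have "L2_set (\<lambda>x. cmod ((f + h) x)) F \<le> ell2_norm G f + ell2_norm G h"
    if "finite F" "F \<subseteq> carrier G" for F
  proof -
    have "L2_set (\<lambda>x. cmod ((f + h) x)) F \<le> L2_set (\<lambda>x. cmod (f x) + cmod (h x)) F"
      by (rule L2_set_mono) (auto simp: norm_triangle_ineq)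
    also have "\<dots> \<le> L2_set (\<lambda>x. cmod (f x)) F + L2_set (\<lambda>x. cmod (h x)) F"
      by (rule L2_set_triangle_ineq)
    also have "\<dots> \<le> ell2_norm G f + ell2_norm G h"
      using assms that by (intro add_mono L2_set_le_ell2_norm)
    finally show ?thesis .
  qed
  from ell2_bounded[of "f + h", OF _ this]
  show "f + h \<in> ell2 G" "ell2_norm G (f + h) \<le> ell2_norm G f + ell2_norm G h"
    using assms ell2_outside by (metis add_0 plus_fun_apply)+
qed

lemma
  assumes "f \<in> ell2 G"
  shows ell2_scale: "scale_fun c f \<in> ell2 G"
    and ell2_norm_scale: "ell2_norm G (scale_fun c f) \<le> cmod c * ell2_norm G f"
proof -
  have "L2_set (\<lambda>x. cmod (scale_fun c f x)) F \<le> cmod c * ell2_norm G f"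
    if "finite F" "F \<subseteq> carrier G" for F
    using L2_set_le_ell2_norm[OF assms that]
    by (simp add: norm_mult mult_left_mono flip: L2_set_right_distrib)
  from ell2_bounded[of "scale_fun c f", OF _ this]
  show "scale_fun c f \<in> ell2 G" "ell2_norm G (scale_fun c f) \<le> cmod c * ell2_norm G f"
    using assms ell2_outside by (metis mult_zero_right scale_fun_apply)+
qed

lemma ell2_diff: "f \<in> ell2 G \<Longrightarrow> h \<in> ell2 G \<Longrightarrow> f - h \<in> ell2 G"
  using ell2_add[OF _ ell2_scale[of h "-1"], of f]
  by (simp add: fun_eq_iff fun_diff_def plus_fun_def scale_fun_def)

lemma ell2_zero: "0 \<in> ell2 G" "ell2_norm G 0 = 0"
  by (simp_all add: ell2_def ell2_norm_def)

lemma ell2_sum: "(\<And>i. i \<in> I \<Longrightarrow> F i \<in> ell2 G) \<Longrightarrow> (\<Sum>i\<in>I. F i) \<in> ell2 G"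
  by (induction I rule: infinite_finite_induct) (auto simp: ell2_zero intro: ell2_add)

lemma ell2_norm_sum:
  "(\<And>i. i \<in> I \<Longrightarrow> F i \<in> ell2 G) \<Longrightarrow> ell2_norm G (\<Sum>i\<in>I. F i) \<le> (\<Sum>i\<in>I. ell2_norm G (F i))"
proof (induction I rule: infinite_finite_induct)
  case (insert i I)
  then have "ell2_norm G (\<Sum>i\<in>insert i I. F i) \<le> ell2_norm G (F i) + ell2_norm G (\<Sum>i\<in>I. F i)"
    using ell2_norm_triangle[of "F i" "\<Sum>i\<in>I. F i"] ell2_sum[of I F] by simp
  moreover have "ell2_norm G (\<Sum>i\<in>I. F i) \<le> (\<Sum>i\<in>I. ell2_norm G (F i))"
    by (rule insert.IH) (use insert.prems in auto)
  ultimately show ?case using sum.insert[OF insert.hyps, of "\<lambda>i. ell2_norm G (F i)"] by linarith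
qed (simp_all add: ell2_zero)

lemma ell2_finite_support:
  assumes "finite A" "A \<subseteq> carrier G" "\<And>x. x \<notin> A \<Longrightarrow> f x = 0"
  shows "f \<in> ell2 G"
proof -
  have "(\<lambda>x. (cmod (f x))\<^sup>2) summable_on carrier G \<longleftrightarrow> (\<lambda>x. (cmod (f x))\<^sup>2) summable_on A"
    by (rule summable_on_cong_neutral) (use assms in auto)
  then show ?thesis using assms by (auto simp: ell2_def)
qed

lemma
  assumes "f \<in> ell2 G" "h \<in> ell2 G"
  shows ell2_inner_abs_summable: "(\<lambda>x. norm (f x * cnj (h x))) summable_on carrier G"
    and ell2_Cauchy_Schwarz: "cmod (ell2_inner G f h) \<le> ell2_norm G f * ell2_norm G h"
proof -
  have le: "(\<Sum>x\<in>F. norm (f x * cnj (h x))) \<le> ell2_norm G f * ell2_norm G h"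
    if "finite F" "F \<subseteq> carrier G" for F
  proof -
    have "(\<Sum>x\<in>F. norm (f x * cnj (h x))) = (\<Sum>x\<in>F. \<bar>cmod (f x)\<bar> * \<bar>cmod (h x)\<bar>)"
      by (simp add: norm_mult)
    also have "\<dots> \<le> L2_set (\<lambda>x. cmod (f x)) F * L2_set (\<lambda>x. cmod (h x)) F"
      by (rule L2_set_mult_ineq)
    also have "\<dots> \<le> ell2_norm G f * ell2_norm G h"
      using assms that by (intro mult_mono L2_set_le_ell2_norm) (auto simp: ell2_norm_nonneg)
    finally show ?thesis .
  qed
  show s: "(\<lambda>x. norm (f x * cnj (h x))) summable_on carrier G"
    by (rule nonneg_bdd_above_summable_on)
       (auto intro!: bdd_aboveI[of _ "ell2_norm G f * ell2_norm G h"] le)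
  have "cmod (ell2_inner G f h) \<le> (\<Sum>\<^sub>\<infinity>x\<in>carrier G. norm (f x * cnj (h x)))"
    unfolding ell2_inner_def by (rule norm_infsum_bound[OF s])
  also have "\<dots> \<le> ell2_norm G f * ell2_norm G h"
    by (rule infsum_le_finite_sums[OF s]) (auto intro: le)
  finally show "cmod (ell2_inner G f h) \<le> ell2_norm G f * ell2_norm G h" .
qed

lemma ell2_inner_summable:
  "f \<in> ell2 G \<Longrightarrow> h \<in> ell2 G \<Longrightarrow> (\<lambda>x. f x * cnj (h x)) summable_on carrier G"
  by (rule abs_summable_summable[OF ell2_inner_abs_summable])

lemma ell2_inner_add_left:
  "f \<in> ell2 G \<Longrightarrow> f' \<in> ell2 G \<Longrightarrow> h \<in> ell2 G \<Longrightarrow>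
    ell2_inner G (f + f') h = ell2_inner G f h + ell2_inner G f' h"
  unfolding ell2_inner_def
  by (subst infsum_add[symmetric]) (auto simp: ell2_inner_summable distrib_right)

lemma ell2_inner_cnj: "ell2_inner G h f = cnj (ell2_inner G f h)"
  unfolding ell2_inner_def by (simp add: infsum_cnj[symmetric] mult.commute)

lemma ell2_inner_scale_left: "ell2_inner G (scale_fun c f) h = c * ell2_inner G f h"
  unfolding ell2_inner_def by (simp add: mult.assoc infsum_cmult_right')

lemma ell2_inner_diff_left:
  assumes "f \<in> ell2 G" "f' \<in> ell2 G" "h \<in> ell2 G"
  shows "ell2_inner G (f - f') h = ell2_inner G f h - ell2_inner G f' h"
proof -
  have "f - f' = f + scale_fun (-1) f'" by (auto simp: fun_eq_iff)
  then show ?thesis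
    using ell2_inner_add_left[OF assms(1) ell2_scale[OF assms(2), of "-1"] assms(3)]
    by (simp only: ell2_inner_scale_left) simp
qed

lemma ell2_inner_zero_left: "ell2_inner G 0 h = 0"
  by (simp add: ell2_inner_def)

lemma ell2_inner_sum_left:
  "(\<And>i. i \<in> I \<Longrightarrow> F i \<in> ell2 G) \<Longrightarrow> h \<in> ell2 G \<Longrightarrow>
    ell2_inner G (\<Sum>i\<in>I. F i) h = (\<Sum>i\<in>I. ell2_inner G (F i) h)"
  by (induction I rule: infinite_finite_induct)
     (auto simp: ell2_inner_zero_left ell2_inner_add_left ell2_sum)

lemma ell2_inner_self:
  assumes f: "f \<in> ell2 G"
  shows "ell2_inner G f f = complex_of_real ((ell2_norm G f)\<^sup>2)"
proof -
  have "ell2_inner G f f = (\<Sum>\<^sub>\<infinity>x\<in>carrier G. complex_of_real ((cmod (f x))\<^sup>2))"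
    unfolding ell2_inner_def by (simp only: complex_norm_square)
  also have "\<dots> = complex_of_real (\<Sum>\<^sub>\<infinity>x\<in>carrier G. (cmod (f x))\<^sup>2)"
    using f by (intro infsumI has_sum_of_real) (simp_all add: ell2_def)
  also have "(\<Sum>\<^sub>\<infinity>x\<in>carrier G. (cmod (f x))\<^sup>2) = (ell2_norm G f)\<^sup>2"
    by (simp add: ell2_norm_def infsum_nonneg)
  finally show ?thesis .
qed

lemma norm_le_ell2_norm: "f \<in> ell2 G \<Longrightarrow> cmod (f x) \<le> ell2_norm G f"
  using L2_set_le_ell2_norm[of f "{x}"] ell2_outside[of f x] ell2_norm_nonneg[of f]
  by (cases "x \<in> carrier G") auto

lemma ell2_norm_eq_0: "f \<in> ell2 G \<Longrightarrow> ell2_norm G f = 0 \<Longrightarrow> f = 0"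
  using norm_le_ell2_norm[of f] by (auto simp: fun_eq_iff)

lemma ell2_inner_delta:
  assumes "g \<in> carrier G"
  shows "ell2_inner G f (ell2_delta g) = f g"
proof -
  have "ell2_inner G f (ell2_delta g) = (\<Sum>\<^sub>\<infinity>x\<in>{g}. f x * cnj (ell2_delta g x))"
    unfolding ell2_inner_def by (rule infsum_cong_neutral) (use assms in \<open>auto simp: ell2_delta_def\<close>)
  then show ?thesis by (simp add: ell2_delta_def)
qed

lemma ell2_delta: "g \<in> carrier G \<Longrightarrow> ell2_delta g \<in> ell2 G"
  by (rule ell2_finite_support[of "{g}"]) (auto simp: ell2_delta_def)

text \<open>Evaluation at a point is bounded by the norm, which gives a pointwise limit; the Cauchy
  estimate then passes to the limit on each finite set. The pointwise convergence is part of the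
  conclusion because the operators below are finite sums of translations and so preserve it.\<close>

lemma ell2_complete:
  assumes ell2: "\<And>n. q n \<in> ell2 G"
    and Cauchy: "\<And>e. e > 0 \<Longrightarrow> \<exists>N. \<forall>m\<ge>N. \<forall>n\<ge>N. ell2_norm G (q m - q n) < e"
  obtains p where "p \<in> ell2 G" "(\<lambda>n. ell2_norm G (p - q n)) \<longlonglongrightarrow> 0" "\<And>x. (\<lambda>n. q n x) \<longlonglongrightarrow> p x"
proof -
  have "Cauchy (\<lambda>n. q n x)" for x
    unfolding Cauchy_def dist_norm
    by (metis Cauchy norm_le_ell2_norm[OF ell2_diff[OF ell2 ell2], simplified] le_less_trans)
  then have "\<exists>l. (\<lambda>n. q n x) \<longlonglongrightarrow> l" for x
    by (simp add: Cauchy_convergent_iff convergent_def)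
  then obtain p where p: "\<And>x. (\<lambda>n. q n x) \<longlonglongrightarrow> p x" by metis
  have out: "p x = 0" if "x \<notin> carrier G" for x
  proof -
    have "(\<lambda>n. q n x) = (\<lambda>n. 0)" using ell2_outside[OF ell2 that] by simp
    then show ?thesis using p[of x] LIMSEQ_const_iff by metis
  qed
  have close: "\<exists>N. \<forall>m\<ge>N. p - q m \<in> ell2 G \<and> ell2_norm G (p - q m) \<le> e" if "e > 0" for e
  proof -
    obtain N where N: "\<And>m n. m \<ge> N \<Longrightarrow> n \<ge> N \<Longrightarrow> ell2_norm G (q m - q n) < e"
      using Cauchy[OF \<open>e > 0\<close>] by blast
    have "L2_set (\<lambda>x. cmod ((p - q m) x)) F \<le> e"
      if m: "m \<ge> N" and F: "finite F" "F \<subseteq> carrier G" for m F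
    proof (rule LIMSEQ_le_const2)
      show "(\<lambda>n. L2_set (\<lambda>x. cmod ((q n - q m) x)) F) \<longlonglongrightarrow> L2_set (\<lambda>x. cmod ((p - q m) x)) F"
        unfolding L2_set_def by (auto intro!: tendsto_intros p)
      show "\<exists>N'. \<forall>n\<ge>N'. L2_set (\<lambda>x. cmod ((q n - q m) x)) F \<le> e"
        using L2_set_le_ell2_norm[OF ell2_diff[OF ell2 ell2] F] N[OF _ m]
        by (meson less_imp_le order_trans)
    qed
    from ell2_bounded[OF _ this] have "p - q m \<in> ell2 G \<and> ell2_norm G (p - q m) \<le> e" if "m \<ge> N" for m
      using out ell2_outside[OF ell2] that by (simp add: fun_diff_def)
    then show ?thesis by blast
  qed
  have "p \<in> ell2 G"
  proof -
    obtain N where "p - q N \<in> ell2 G" using close[of 1] by auto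
    from ell2_add[OF this ell2[of N]] show ?thesis by simp
  qed
  moreover have "(\<lambda>n. ell2_norm G (p - q n)) \<longlonglongrightarrow> 0"
  proof (rule LIMSEQ_I)
    fix e :: real assume "e > 0"
    then obtain N where "\<forall>m\<ge>N. ell2_norm G (p - q m) \<le> e / 2" using close[of "e/2"] by auto
    then show "\<exists>N. \<forall>n\<ge>N. norm (ell2_norm G (p - q n) - 0) < e"
      using \<open>e > 0\<close> by (intro exI[of _ N]) (auto simp: ell2_norm_nonneg intro: le_less_trans)
  qed
  ultimately show ?thesis using that p by blast
qed

text \<open>Two candidates differ by an element of \<open>K\<close> that is orthogonal to itself.
  Exhibiting a point of \<open>K\<close> with orthogonal remainder thus determines the definite
  description in \<open>ell2_proj\<close>.\<close>

lemma ell2_proj_eqI: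
  assumes K: "K \<subseteq> ell2 G" "\<And>f h. f \<in> K \<Longrightarrow> h \<in> K \<Longrightarrow> f - h \<in> K"
    and "f \<in> ell2 G" "p \<in> K" and orth: "\<And>k. k \<in> K \<Longrightarrow> ell2_inner G (f - p) k = 0"
  shows "ell2_proj G K f = p"
  unfolding ell2_proj_def
proof (rule the_equality)
  show "p \<in> K \<and> (\<forall>k\<in>K. ell2_inner G (\<lambda>x. f x - p x) k = 0)"
    using assms by (auto simp: fun_diff_def)
  fix q assume q: "q \<in> K \<and> (\<forall>k\<in>K. ell2_inner G (\<lambda>x. f x - q x) k = 0)"
  have "ell2_inner G ((f - p) - (f - q)) (q - p) = 0"
    using assms q by (subst ell2_inner_diff_left) (auto simp: fun_diff_def intro!: ell2_diff[unfolded fun_diff_def])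
  moreover have "q - p \<in> ell2 G"
    using assms q by (auto intro: ell2_diff)
  ultimately have "ell2_norm G (q - p) = 0"
    by (simp add: ell2_inner_self)
  then show "q = p"
    using ell2_norm_eq_0[of "q - p"] assms q by auto
qed

end

section \<open>Left translations as unitary operators\<close>

context group
begin

lemma left_regular_left_regular:
  assumes "g \<in> carrier G" "h \<in> carrier G"
  shows "left_regular G g (left_regular G h f) = left_regular G (g \<otimes> h) f"
  using assms by (auto simp: left_regular_def fun_eq_iff inv_mult_group m_assoc)

lemma left_regular_one: "(\<And>x. x \<notin> carrier G \<Longrightarrow> f x = 0) \<Longrightarrow> left_regular G \<one> f = f"
  by (auto simp: left_regular_def fun_eq_iff)

lemma left_regular_add: "left_regular G g (f + h) = left_regular G g f + left_regular G g h"
  by (auto simp: left_regular_def fun_eq_iff)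

lemma left_regular_diff: "left_regular G g (f - h) = left_regular G g f - left_regular G g h"
  by (auto simp: left_regular_def fun_eq_iff)

lemma left_regular_scale: "left_regular G g (scale_fun c f) = scale_fun c (left_regular G g f)"
  by (auto simp: left_regular_def fun_eq_iff)

lemma left_regular_sum: "left_regular G g (\<Sum>i\<in>I. F i) = (\<Sum>i\<in>I. left_regular G g (F i))"
  by (auto simp: left_regular_def fun_eq_iff sum_fun_apply)

lemma left_regular_delta:
  assumes "g \<in> carrier G" "h \<in> carrier G"
  shows "left_regular G g (ell2_delta h) = ell2_delta (g \<otimes> h)"
  using assms by (auto simp: left_regular_def ell2_delta_def fun_eq_iff inv_solve_left')

lemma bij_betw_mult_left: "g \<in> carrier G \<Longrightarrow> bij_betw (\<lambda>x. g \<otimes> x) (carrier G) (carrier G)"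
  by (rule bij_betw_byWitness[where f' = "\<lambda>x. inv g \<otimes> x"]) (auto simp flip: m_assoc)

lemma
  assumes g: "g \<in> carrier G" and f: "f \<in> ell2 G"
  shows ell2_left_regular: "left_regular G g f \<in> ell2 G"
    and ell2_norm_left_regular: "ell2_norm G (left_regular G g f) = ell2_norm G f"
proof -
  have bij: "bij_betw (\<lambda>x. inv g \<otimes> x) (carrier G) (carrier G)"
    using g by (intro bij_betw_mult_left) simp
  have "(\<lambda>x. (cmod (f (inv g \<otimes> x)))\<^sup>2) summable_on carrier G"
    using summable_on_reindex_bij_betw[OF bij, of "\<lambda>x. (cmod (f x))\<^sup>2"] f by (simp add: ell2_def)
  then show "left_regular G g f \<in> ell2 G"
    by (auto simp: ell2_def left_regular_def cong: summable_on_cong)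
  show "ell2_norm G (left_regular G g f) = ell2_norm G f"
    using infsum_reindex_bij_betw[OF bij, of "\<lambda>x. (cmod (f x))\<^sup>2"]
    by (simp add: ell2_norm_def left_regular_def cong: infsum_cong)
qed

lemma ell2_inner_left_regular:
  assumes g: "g \<in> carrier G"
  shows "ell2_inner G (left_regular G g f) h = ell2_inner G f (left_regular G (inv g) h)"
proof -
  have "ell2_inner G (left_regular G g f) h =
      (\<Sum>\<^sub>\<infinity>x\<in>carrier G. left_regular G g f (g \<otimes> x) * cnj (h (g \<otimes> x)))"
    unfolding ell2_inner_def by (rule infsum_reindex_bij_betw[OF bij_betw_mult_left[OF g], symmetric])
  also have "\<dots> = ell2_inner G f (left_regular G (inv g) h)"
    unfolding ell2_inner_def
    by (rule infsum_cong) (use g in \<open>auto simp: left_regular_def m_assoc[symmetric]\<close>)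
  finally show ?thesis .
qed

end

section \<open>Events on the lamps as operators\<close>

lemma sum_Pow_insert:
  fixes F :: "'a set \<Rightarrow> 'b::comm_monoid_add"
  assumes "finite T" "x \<notin> T"
  shows "(\<Sum>A\<in>Pow (insert x T). F A) = (\<Sum>A\<in>Pow T. F A + F (insert x A))"
proof -
  have "inj_on (insert x) (Pow T)"
    using assms(2) by (intro inj_onI) (metis PowD insert_ident subsetD)
  then show ?thesis
    using assms unfolding Pow_insert
    by (subst sum.union_disjoint) (auto simp: sum.reindex sum.distrib)
qed

text \<open>For fixed \<open>C\<close> the sign is a character of the group of finite sets under
  symmetric difference.\<close>

lemma card_sym_diff_Int:
  assumes "finite A" "finite B"
  shows "(-1::complex) ^ card (sym_diff A B \<inter> C) = (-1) ^ card (A \<inter> C) * (-1) ^ card (B \<inter> C)"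
proof -
  let ?A = "A \<inter> C" and ?B = "B \<inter> C"
  have "card ?A = card (?A - ?B) + card (?A \<inter> ?B)" "card ?B = card (?B - ?A) + card (?A \<inter> ?B)"
    using assms by (metis card_Diff_subset_Int card_mono finite_Int inf_le1 le_add_diff_inverse2 inf_commute)+
  moreover have "card (sym_diff A B \<inter> C) = card (?A - ?B) + card (?B - ?A)"
    using assms by (subst card_Un_disjoint[symmetric]) (auto intro: arg_cong[where f = card])
  ultimately show ?thesis
    by (simp add: power_add[symmetric] minus_one_power_iff)
qed

text \<open>Toggling \<open>x\<close> pairs off the subsets of \<open>T\<close> with opposite
  signs.\<close>

lemma sum_Pow_sign_eq_0:
  assumes "finite T" "x \<in> C" "x \<in> T"
  shows "(\<Sum>A\<in>Pow T. (-1::complex) ^ card (A \<inter> C)) = 0"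
proof -
  have "(-1::complex) ^ card (insert x A \<inter> C) = - ((-1) ^ card (A \<inter> C))" if "A \<subseteq> T - {x}" for A
  proof -
    have "insert x A \<inter> C = insert x (A \<inter> C)" "finite (A \<inter> C)" "x \<notin> A \<inter> C"
      using assms that finite_subset by (auto dest: finite_subset)
    then show ?thesis by simp
  qed
  then have "(\<Sum>A\<in>Pow (insert x (T - {x})). (-1::complex) ^ card (A \<inter> C)) = 0"
    using assms(1) by (subst sum_Pow_insert) (auto intro!: sum.neutral)
  then show ?thesis using assms(3) by (simp add: insert_absorb)
qed

text \<open>Orthogonality of the characters of the group of subsets of \<open>T\<close>.\<close>

lemma sum_Pow_sign_mult:
  assumes "finite T" "B \<subseteq> T" "C \<subseteq> T"
  shows "(\<Sum>A\<in>Pow T. (-1::complex) ^ card (A \<inter> B) * (-1) ^ card (A \<inter> C)) = of_bool (B = C) * 2 ^ card T"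
proof -
  have "(-1::complex) ^ card (A \<inter> B) * (-1) ^ card (A \<inter> C) = (-1) ^ card (A \<inter> sym_diff B C)" for A
    using card_sym_diff_Int[of B C A] assms finite_subset by (metis inf_commute)
  then have *: "(\<Sum>A\<in>Pow T. (-1::complex) ^ card (A \<inter> B) * (-1) ^ card (A \<inter> C)) =
      (\<Sum>A\<in>Pow T. (-1) ^ card (A \<inter> sym_diff B C))"
    by simp
  show ?thesis
  proof (cases "B = C")
    case True
    then show ?thesis unfolding * using assms by (simp add: card_Pow)
  next
    case False
    then obtain x where "x \<in> sym_diff B C" by blast
    then show ?thesis
      unfolding * using False assms by (subst sum_Pow_sign_eq_0[of T x]) auto
  qed
qed

definition depends_on :: "'x set \<Rightarrow> ('x set \<Rightarrow> bool) \<Rightarrow> bool" where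
  "depends_on T P \<longleftrightarrow> (\<forall>\<omega>. P \<omega> = P (\<omega> \<inter> T))"

lemma depends_onD: "depends_on T P \<Longrightarrow> P (\<omega> \<inter> T) = P \<omega>"
  unfolding depends_on_def by blast

lemma depends_on_mono: "depends_on T P \<Longrightarrow> T \<subseteq> T' \<Longrightarrow> depends_on T' P"
  unfolding depends_on_def by (metis inf.absorb_iff2 inf_assoc)

definition cylinder_prob :: "'x set \<Rightarrow> ('x set \<Rightarrow> bool) \<Rightarrow> real" where
  "cylinder_prob T P = card {B. B \<subseteq> T \<and> P B} / 2 ^ card T"

text \<open>\<open>s\<close> embeds the finite subsets of \<open>Y\<close>, a group under symmetric
  difference, into \<open>G\<close>. This hides the quotient of the direct sum: everything analytic
  uses only these laws.\<close>

locale lamps = group G for G :: "('g, 'm) monoid_scheme" (structure) +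
  fixes s :: "'x set \<Rightarrow> 'g" and Y :: "'x set"
  assumes s_closed: "\<And>A. finite A \<Longrightarrow> A \<subseteq> Y \<Longrightarrow> s A \<in> carrier G"
    and s_empty: "s {} = \<one>"
    and s_mult: "\<And>A B. finite A \<Longrightarrow> A \<subseteq> Y \<Longrightarrow> finite B \<Longrightarrow> B \<subseteq> Y \<Longrightarrow> s A \<otimes> s B = s (sym_diff A B)"
    and s_eq_one: "\<And>A. finite A \<Longrightarrow> A \<subseteq> Y \<Longrightarrow> s A = \<one> \<Longrightarrow> A = {}"
begin

abbreviation L :: "'g \<Rightarrow> ('g \<Rightarrow> complex) \<Rightarrow> 'g \<Rightarrow> complex" where
  "L \<equiv> left_regular G"

lemma s_inv: "finite A \<Longrightarrow> A \<subseteq> Y \<Longrightarrow> inv (s A) = s A"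
  using s_mult[of A A] by (intro inv_equality) (auto simp: s_empty s_closed)

text \<open>\<open>prj T B\<close> projects onto the functions on which the lamp at \<open>x \<in> T\<close> acts as \<open>-1\<close> if
  \<open>x \<in> B\<close> and trivially otherwise.\<close>

definition prj :: "'x set \<Rightarrow> 'x set \<Rightarrow> ('g \<Rightarrow> complex) \<Rightarrow> 'g \<Rightarrow> complex" where
  "prj T B f = scale_fun (1 / 2 ^ card T) (\<Sum>A\<in>Pow T. scale_fun ((-1) ^ card (A \<inter> B)) (L (s A) f))"

lemma prj_apply: "prj T B f x = (\<Sum>A\<in>Pow T. (-1) ^ card (A \<inter> B) * L (s A) f x) / 2 ^ card T"
  by (simp add: prj_def sum_fun_apply)

lemma L_scale: "L g (scale_fun c f) = scale_fun c (L g f)"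
  by (rule left_regular_scale)

text \<open>Reindexing the Fourier sum by \<open>sym_diff D\<close> pulls out the character value of
  \<open>D\<close>.\<close>

lemma L_s_prj:
  assumes T: "finite T" "T \<subseteq> Y" and D: "D \<subseteq> T"
  shows "L (s D) (prj T B f) = scale_fun ((-1) ^ card (D \<inter> B)) (prj T B f)"
proof
  fix x
  have fin: "finite A" "A \<subseteq> Y" if "A \<subseteq> T" for A
    using that T finite_subset by auto
  have "L (s D) (prj T B f) x =
      (\<Sum>A\<in>Pow T. (-1) ^ card (A \<inter> B) * L (s (sym_diff D A)) f x) / 2 ^ card T"
    unfolding prj_def L_scale left_regular_sum
    using D fin by (simp add: sum_fun_apply left_regular_left_regular s_closed s_mult)
  also have "(\<Sum>A\<in>Pow T. (-1) ^ card (A \<inter> B) * L (s (sym_diff D A)) f x) =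
      (\<Sum>A\<in>Pow T. (-1) ^ card (sym_diff D A \<inter> B) * L (s A) f x)"
    by (rule sum.reindex_bij_witness[where i = "sym_diff D" and j = "sym_diff D"])
       (use D in \<open>auto intro!: arg_cong[where f = "\<lambda>A. L (s A) f x"] arg_cong[where f = "\<lambda>A. (-1) ^ card (A \<inter> B)"]\<close>)
  also have "\<dots> = (\<Sum>A\<in>Pow T. (-1) ^ card (D \<inter> B) * ((-1) ^ card (A \<inter> B) * L (s A) f x))"
    using D fin by (intro sum.cong) (auto simp: card_sym_diff_Int)
  finally have "L (s D) (prj T B f) x =
      (\<Sum>A\<in>Pow T. (-1) ^ card (D \<inter> B) * ((-1) ^ card (A \<inter> B) * L (s A) f x)) / 2 ^ card T" .
  then show "L (s D) (prj T B f) x = scale_fun ((-1) ^ card (D \<inter> B)) (prj T B f) x"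
    by (simp only: scale_fun_apply prj_apply sum_distrib_left times_divide_eq_right)
qed

lemma prj_prj:
  assumes "finite T" "T \<subseteq> Y" "B \<subseteq> T" "C \<subseteq> T"
  shows "prj T B (prj T C f) = scale_fun (of_bool (B = C)) (prj T C f)"
proof
  fix x
  have "prj T B (prj T C f) x =
      (\<Sum>A\<in>Pow T. ((-1) ^ card (A \<inter> B) * (-1) ^ card (A \<inter> C)) * prj T C f x) / 2 ^ card T"
    unfolding prj_apply[of T B] using assms by (auto simp: L_s_prj mult.assoc intro!: sum.cong)
  then show "prj T B (prj T C f) x = scale_fun (of_bool (B = C)) (prj T C f) x"
    using assms by (simp flip: sum_distrib_right add: sum_Pow_sign_mult)
qed

definition op_on :: "'x set \<Rightarrow> ('x set \<Rightarrow> bool) \<Rightarrow> ('g \<Rightarrow> complex) \<Rightarrow> 'g \<Rightarrow> complex" where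
  "op_on T P f = (\<Sum>B | B \<subseteq> T \<and> P B. prj T B f)"

lemma op_on_alt: "finite T \<Longrightarrow> op_on T P f = (\<Sum>B\<in>Pow T. scale_fun (of_bool (P B)) (prj T B f))"
  unfolding op_on_def
  by (intro sum.mono_neutral_cong_left) (auto simp: fun_eq_iff)

text \<open>Refining by one more bit splits \<open>prj T B\<close> into the projections for
  \<open>B\<close> and \<open>insert x B\<close>; in their sum the terms that move the lamp at
  \<open>x\<close> cancel. This is what makes \<open>op\<close> independent of the set of inspected
  points.\<close>

lemma op_on_insert:
  assumes "finite T" "x \<notin> T" "depends_on T P"
  shows "op_on (insert x T) P f = op_on T P f"
proof -
  have 1: "P (insert x B) = P B" if "B \<subseteq> T" for B
  proof -
    have "insert x B \<inter> T = B \<inter> T" using that assms(2) by blast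
    then show ?thesis using depends_onD[OF assms(3)] by metis
  qed
  have 2: "prj (insert x T) B f + prj (insert x T) (insert x B) f = prj T B f" if B: "B \<subseteq> T" for B
  proof
    fix y
    have a: "insert x A \<inter> B = A \<inter> B" "A \<inter> insert x B = A \<inter> B" "insert x A \<inter> insert x B = insert x (A \<inter> B)"
      "finite (A \<inter> B)" "x \<notin> A \<inter> B" if "A \<subseteq> T" for A
      using that B assms(1,2) finite_subset[OF that assms(1)] by auto
    have "(\<Sum>A\<in>Pow (insert x T). (-1) ^ card (A \<inter> B) * L (s A) f y) +
          (\<Sum>A\<in>Pow (insert x T). (-1) ^ card (A \<inter> insert x B) * L (s A) f y) =
        2 * (\<Sum>A\<in>Pow T. (-1) ^ card (A \<inter> B) * L (s A) f y)"
      using assms a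
      by (auto simp: sum_Pow_insert sum_distrib_left simp flip: sum.distrib intro!: sum.cong)
    then show "(prj (insert x T) B f + prj (insert x T) (insert x B) f) y = prj T B f y"
      using assms by (simp add: prj_apply flip: add_divide_distrib)
  qed
  show ?thesis
    using assms 1 2 by (simp add: op_on_alt sum_Pow_insert fun_eq_iff sum_fun_apply flip: distrib_left)
qed

lemma op_on_superset:
  assumes "finite T'" "T \<subseteq> T'" "depends_on T P"
  shows "op_on T' P f = op_on T P f"
proof -
  have "op_on (T \<union> D) P f = op_on T P f" if "finite D" "D \<inter> T = {}" for D
    using that
  proof (induction D)
    case (insert x D)
    have "op_on (insert x (T \<union> D)) P f = op_on (T \<union> D) P f"
      using insert assms finite_subset by (intro op_on_insert) (auto intro: depends_on_mono)
    with insert show ?case by auto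
  qed simp
  from this[of "T' - T"] show ?thesis
    using assms by (simp add: Un_absorb1 Diff_disjoint Int_commute)
qed

definition finitary :: "('x set \<Rightarrow> bool) \<Rightarrow> bool" where
  "finitary P \<longleftrightarrow> (\<exists>T. finite T \<and> T \<subseteq> Y \<and> depends_on T P)"

text \<open>The set of inspected points is chosen, so that an event is a bare predicate;
  \<open>op_eq_op_on\<close> allows any other admissible set to be substituted.\<close>

definition op :: "('x set \<Rightarrow> bool) \<Rightarrow> ('g \<Rightarrow> complex) \<Rightarrow> 'g \<Rightarrow> complex" where
  "op P = op_on (SOME T. finite T \<and> T \<subseteq> Y \<and> depends_on T P) P"

lemma op_eq_op_on:
  assumes "finite T" "T \<subseteq> Y" "depends_on T P"
  shows "op P f = op_on T P f"
proof -
  let ?S = "SOME T. finite T \<and> T \<subseteq> Y \<and> depends_on T P"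
  have S: "finite ?S \<and> ?S \<subseteq> Y \<and> depends_on ?S P"
    by (rule someI[where x = T]) (use assms in auto)
  have "op_on ?S P f = op_on (?S \<union> T) P f" "op_on T P f = op_on (?S \<union> T) P f"
    using S assms by (auto intro!: op_on_superset[symmetric])
  then show ?thesis by (simp add: op_def)
qed

lemma finitaryE2:
  assumes "finitary P" "finitary Q"
  obtains T where "finite T" "T \<subseteq> Y" "depends_on T P" "depends_on T Q"
proof -
  from assms obtain S T where "finite T" "T \<subseteq> Y" "depends_on T P" "finite S" "S \<subseteq> Y" "depends_on S Q"
    unfolding finitary_def by blast
  then show ?thesis
    by (intro that[of "S \<union> T"]) (auto intro: depends_on_mono)
qed

lemma finitary_const: "finitary (\<lambda>_. c)"
  unfolding finitary_def depends_on_def by (intro exI[of _ "{}"]) auto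

lemma finitary_mem: "x \<in> Y \<Longrightarrow> finitary (\<lambda>\<omega>. x \<in> \<omega>)"
  unfolding finitary_def depends_on_def by (intro exI[of _ "{x}"]) auto

lemma finitary_not: "finitary P \<Longrightarrow> finitary (\<lambda>\<omega>. \<not> P \<omega>)"
  unfolding finitary_def depends_on_def by blast

lemma finitary_conj:
  assumes "finitary P" "finitary Q" shows "finitary (\<lambda>\<omega>. P \<omega> \<and> Q \<omega>)"
proof -
  obtain T where T: "finite T" "T \<subseteq> Y" "depends_on T P" "depends_on T Q"
    using finitaryE2[OF assms] .
  have "depends_on T (\<lambda>\<omega>. P \<omega> \<and> Q \<omega>)"
    unfolding depends_on_def by (simp add: depends_onD[OF T(3)] depends_onD[OF T(4)])
  with T show ?thesis unfolding finitary_def by blast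
qed

lemma finitary_disj: "finitary P \<Longrightarrow> finitary Q \<Longrightarrow> finitary (\<lambda>\<omega>. P \<omega> \<or> Q \<omega>)"
  unfolding de_Morgan_conj[symmetric, of "\<not> P _" "\<not> Q _", unfolded not_not]
  by (intro finitary_not finitary_conj)

lemma finitary_imp: "finitary P \<Longrightarrow> finitary Q \<Longrightarrow> finitary (\<lambda>\<omega>. P \<omega> \<longrightarrow> Q \<omega>)"
  unfolding imp_conv_disj by (intro finitary_disj finitary_not)

lemma finitary_ball:
  "finite I \<Longrightarrow> (\<And>i. i \<in> I \<Longrightarrow> finitary (P i)) \<Longrightarrow> finitary (\<lambda>\<omega>. \<forall>i\<in>I. P i \<omega>)"
  by (induction I rule: finite_induct) (simp_all add: finitary_const finitary_conj)

lemma finitary_bex: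
  "finite I \<Longrightarrow> (\<And>i. i \<in> I \<Longrightarrow> finitary (P i)) \<Longrightarrow> finitary (\<lambda>\<omega>. \<exists>i\<in>I. P i \<omega>)"
  by (induction I rule: finite_induct) (simp_all add: finitary_const finitary_disj)

lemmas finitary_intros = finitary_const finitary_mem finitary_not finitary_conj finitary_disj finitary_imp finitary_ball finitary_bex

lemma L_outside: "x \<notin> carrier G \<Longrightarrow> L g f x = 0"
  by (simp add: left_regular_def)

lemma prj_outside: "x \<notin> carrier G \<Longrightarrow> prj T B f x = 0"
  by (simp add: prj_apply L_outside)

lemma op_outside: "x \<notin> carrier G \<Longrightarrow> op P f x = 0"
  by (simp add: op_def op_on_def prj_outside sum_fun_apply)

lemma prj_add: "prj T B (f + h) = prj T B f + prj T B h"
  by (simp add: fun_eq_iff prj_apply left_regular_add distrib_left sum.distrib add_divide_distrib)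

lemma prj_scale: "prj T B (scale_fun c f) = scale_fun c (prj T B f)"
  by (simp add: fun_eq_iff prj_apply left_regular_scale sum_distrib_left mult_ac)

lemma prj_zero: "prj T B 0 = 0"
proof
  have "L g 0 = 0" for g by (rule ext) (simp add: left_regular_def)
  then show "prj T B 0 x = 0 x" for x by (simp add: prj_apply)
qed

lemma op_add: "op P (f + h) = op P f + op P h"
  by (simp add: op_def op_on_def prj_add sum.distrib)

lemma op_scale: "op P (scale_fun c f) = scale_fun c (op P f)"
  by (simp add: op_def op_on_def prj_scale fun_eq_iff sum_fun_apply sum_distrib_left)

lemma op_zero [simp]: "op P 0 = 0"
  by (rule ext) (simp add: op_def op_on_def prj_zero sum_fun_apply)

lemma op_diff: "op P (f - h) = op P f - op P h"
  using op_add[of P "f - h" h] by simp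

lemma op_sum: "op P (\<Sum>i\<in>I. F i) = (\<Sum>i\<in>I. op P (F i))"
proof (induction I rule: infinite_finite_induct)
  case (insert i I)
  show ?case
    unfolding sum.insert[OF insert.hyps] op_add insert.IH ..
next
  case (infinite I)
  show ?case unfolding sum.infinite[OF infinite.hyps] op_zero ..
next
  case empty
  show ?case unfolding sum.empty op_zero ..
qed

lemma op_True: "(\<And>x. x \<notin> carrier G \<Longrightarrow> f x = 0) \<Longrightarrow> op (\<lambda>_. True) f = f"
  by (subst op_eq_op_on[of "{}"])
     (simp_all add: depends_on_def op_on_def fun_eq_iff prj_apply s_empty left_regular_one)

lemma op_False: "op (\<lambda>_. False) f = 0"
  by (simp add: op_def op_on_def)

lemma op_op:
  assumes "finitary P" "finitary Q"
  shows "op P (op Q f) = op (\<lambda>\<omega>. P \<omega> \<and> Q \<omega>) f"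
proof -
  obtain T where T: "finite T" "T \<subseteq> Y" "depends_on T P" "depends_on T Q"
    using finitaryE2[OF assms] .
  have D: "depends_on T (\<lambda>\<omega>. P \<omega> \<and> Q \<omega>)"
    unfolding depends_on_def by (simp add: depends_onD[OF T(3)] depends_onD[OF T(4)])
  have prj_sum: "prj T B (\<Sum>i\<in>I. F i) = (\<Sum>i\<in>I. prj T B (F i))"
    for B and I :: "'x set set" and F :: "'x set \<Rightarrow> 'g \<Rightarrow> complex"
  proof (induction I rule: infinite_finite_induct)
    case (insert i I)
    show ?case
      unfolding sum.insert[OF insert.hyps] prj_add insert.IH ..
  next
    case (infinite I)
    show ?case unfolding sum.infinite[OF infinite.hyps] prj_zero ..
  next
    case empty
    show ?case unfolding sum.empty prj_zero ..
  qed
  have "op P (op Q f) = (\<Sum>B | B \<subseteq> T \<and> P B. \<Sum>C | C \<subseteq> T \<and> Q C. scale_fun (of_bool (B = C)) (prj T C f))"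
    using T by (simp add: op_eq_op_on op_on_def prj_sum prj_prj)
  also have "\<dots> = (\<Sum>B | B \<subseteq> T \<and> P B. if Q B then prj T B f else 0)"
  proof (rule sum.cong[OF refl])
    fix B assume B: "B \<in> {B. B \<subseteq> T \<and> P B}"
    have "(\<Sum>C | C \<subseteq> T \<and> Q C. scale_fun (of_bool (B = C)) (prj T C f)) =
        (\<Sum>C | C \<subseteq> T \<and> Q C. if B = C then prj T C f else 0)"
      by (intro sum.cong) (auto simp: fun_eq_iff)
    then show "(\<Sum>C | C \<subseteq> T \<and> Q C. scale_fun (of_bool (B = C)) (prj T C f)) =
        (if Q B then prj T B f else 0)"
      using B T(1) by (simp add: sum.delta)
  qed
  also have "\<dots> = (\<Sum>B | B \<subseteq> T \<and> P B \<and> Q B. prj T B f)"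
    using T(1) by (simp add: sum.If_cases Int_def conj_assoc)
  also have "\<dots> = op (\<lambda>\<omega>. P \<omega> \<and> Q \<omega>) f"
    using T D by (simp add: op_eq_op_on op_on_def)
  finally show ?thesis .
qed

lemma op_disjoint:
  assumes "finitary P" "finitary Q" "\<And>\<omega>. \<not> (P \<omega> \<and> Q \<omega>)"
  shows "op (\<lambda>\<omega>. P \<omega> \<or> Q \<omega>) f = op P f + op Q f"
proof -
  obtain T where T: "finite T" "T \<subseteq> Y" "depends_on T P" "depends_on T Q"
    using finitaryE2[OF assms(1,2)] .
  have D: "depends_on T (\<lambda>\<omega>. P \<omega> \<or> Q \<omega>)"
    unfolding depends_on_def by (simp add: depends_onD[OF T(3)] depends_onD[OF T(4)])
  have "{B. B \<subseteq> T \<and> (P B \<or> Q B)} = {B. B \<subseteq> T \<and> P B} \<union> {B. B \<subseteq> T \<and> Q B}" by auto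
  moreover have "{B. B \<subseteq> T \<and> P B} \<inter> {B. B \<subseteq> T \<and> Q B} = {}" using assms(3) by auto
  ultimately show ?thesis
    using T D by (simp add: op_eq_op_on op_on_def sum.union_disjoint)
qed

lemma op_disjoint_family:
  assumes "finite I" "\<And>i. i \<in> I \<Longrightarrow> finitary (P i)"
    and "\<And>i j \<omega>. i \<in> I \<Longrightarrow> j \<in> I \<Longrightarrow> P i \<omega> \<Longrightarrow> P j \<omega> \<Longrightarrow> i = j"
  shows "op (\<lambda>\<omega>. \<exists>i\<in>I. P i \<omega>) f = (\<Sum>i\<in>I. op (P i) f)"
  using assms
proof (induction I rule: finite_induct)
  case (insert j I)
  have "op (\<lambda>\<omega>. P j \<omega> \<or> (\<exists>i\<in>I. P i \<omega>)) f = op (P j) f + op (\<lambda>\<omega>. \<exists>i\<in>I. P i \<omega>) f"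
  proof (rule op_disjoint)
    show "finitary (P j)" "finitary (\<lambda>\<omega>. \<exists>i\<in>I. P i \<omega>)"
      using insert.hyps(1) insert.prems(1) by (auto intro!: finitary_bex[of I P])
    show "\<not> (P j \<omega> \<and> (\<exists>i\<in>I. P i \<omega>))" for \<omega>
      using insert.hyps insert.prems(2) by blast
  qed
  moreover have "op (\<lambda>\<omega>. \<exists>i\<in>I. P i \<omega>) f = (\<Sum>i\<in>I. op (P i) f)"
    by (rule insert.IH) (use insert.prems in auto)
  ultimately show ?case using sum.insert[OF insert.hyps, of "\<lambda>i. op (P i) f"] by (simp only: bex_simps)
qed (simp add: op_False)

lemma op_add_op_not:
  assumes "finitary P" "\<And>x. x \<notin> carrier G \<Longrightarrow> f x = 0"
  shows "op P f + op (\<lambda>\<omega>. \<not> P \<omega>) f = f"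
proof -
  have "op P f + op (\<lambda>\<omega>. \<not> P \<omega>) f = op (\<lambda>\<omega>. P \<omega> \<or> \<not> P \<omega>) f"
    by (rule op_disjoint[symmetric]) (use assms(1) in \<open>auto intro: finitary_not\<close>)
  also have "\<dots> = f" using op_True[OF assms(2)] by (simp only: excluded_middle de_Morgan_disj simp_thms)
  finally show ?thesis .
qed

lemma op_mono:
  assumes "finitary P" "finitary Q" "\<And>\<omega>. P \<omega> \<Longrightarrow> Q \<omega>"
  shows "op P (op Q f) = op P f"
proof -
  have "(\<lambda>\<omega>. P \<omega> \<and> Q \<omega>) = P" using assms(3) by blast
  then show ?thesis using op_op[OF assms(1,2)] by simp
qed

text \<open>Conjugation by \<open>g\<close> moves the lamp at \<open>x\<close> to
  \<open>p x\<close>. The inverse \<open>q\<close> is an explicit parameter since the events below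
  mention it, as \<alpha>i, \<beta>i or \<open>neg z\<close>.\<close>

definition implements :: "'g \<Rightarrow> ('x \<Rightarrow> 'x) \<Rightarrow> ('x \<Rightarrow> 'x) \<Rightarrow> bool" where
  "implements g p q \<longleftrightarrow> g \<in> carrier G \<and> (\<forall>x. p (q x) = x) \<and> (\<forall>x. q (p x) = x) \<and>
     p ` Y \<subseteq> Y \<and> q ` Y \<subseteq> Y \<and> (\<forall>A. finite A \<longrightarrow> A \<subseteq> Y \<longrightarrow> g \<otimes> s A = s (p ` A) \<otimes> g)"

lemma implementsI:
  assumes "g \<in> carrier G" "\<And>x. p (q x) = x" "\<And>x. q (p x) = x"
    and "\<And>x. x \<in> Y \<Longrightarrow> p x \<in> Y" "\<And>x. x \<in> Y \<Longrightarrow> q x \<in> Y"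
    and "\<And>A. finite A \<Longrightarrow> A \<subseteq> Y \<Longrightarrow> g \<otimes> s A = s (p ` A) \<otimes> g"
  shows "implements g p q"
  unfolding implements_def
proof (rule conjI)
  show "g \<in> carrier G" by (rule assms(1))
  have a: "\<forall>x. p (q x) = x" using assms(2) by (rule allI)
  have b: "\<forall>x. q (p x) = x" using assms(3) by (rule allI)
  have c: "p ` Y \<subseteq> Y" using assms(4) by (rule image_subsetI)
  have d: "q ` Y \<subseteq> Y" using assms(5) by (rule image_subsetI)
  have e: "\<forall>A. finite A \<longrightarrow> A \<subseteq> Y \<longrightarrow> g \<otimes> s A = s (p ` A) \<otimes> g"
    by (intro allI impI) (rule assms(6))
  show "(\<forall>x. p (q x) = x) \<and> (\<forall>x. q (p x) = x) \<and> p ` Y \<subseteq> Y \<and> q ` Y \<subseteq> Y \<and>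
      (\<forall>A. finite A \<longrightarrow> A \<subseteq> Y \<longrightarrow> g \<otimes> s A = s (p ` A) \<otimes> g)"
    by (rule conjI[OF a conjI[OF b conjI[OF c conjI[OF d e]]]])
qed

lemma implementsD:
  assumes "implements g p q"
  shows "g \<in> carrier G" "p (q x) = x" "q (p x) = x" "x \<in> Y \<Longrightarrow> p x \<in> Y" "x \<in> Y \<Longrightarrow> q x \<in> Y"
    and "finite A \<Longrightarrow> A \<subseteq> Y \<Longrightarrow> g \<otimes> s A = s (p ` A) \<otimes> g"
proof -
  note D = assms[unfolded implements_def]
  note D2 = D[THEN conjunct2] D[THEN conjunct2, THEN conjunct2]
    D[THEN conjunct2, THEN conjunct2, THEN conjunct2]
    D[THEN conjunct2, THEN conjunct2, THEN conjunct2, THEN conjunct2]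
  show "g \<in> carrier G" by (rule conjunct1[OF D])
  show "p (q x) = x" by (rule conjunct1[OF D2(1), rule_format])
  show "q (p x) = x" by (rule conjunct1[OF D2(2), rule_format])
  show "x \<in> Y \<Longrightarrow> p x \<in> Y" by (rule conjunct1[OF D2(3), THEN subsetD, OF imageI])
  show "x \<in> Y \<Longrightarrow> q x \<in> Y" by (rule conjunct1[OF D2(4), THEN subsetD, OF imageI])
  show "finite A \<Longrightarrow> A \<subseteq> Y \<Longrightarrow> g \<otimes> s A = s (p ` A) \<otimes> g"
    by (rule conjunct2[OF D2(4), rule_format])
qed

lemma implements_one: "implements \<one> (\<lambda>x. x) (\<lambda>x. x)"
  by (rule implementsI) (simp_all add: s_closed)

lemma implements_inv:
  assumes "implements g p q"
  shows "implements (inv g) q p"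
proof (rule implementsI)
  note D = implementsD[OF assms]
  fix A assume A: "finite A" "A \<subseteq> Y"
  have pq: "p ` q ` A = A" by (simp add: image_image D)
  have qA: "finite (q ` A)" "q ` A \<subseteq> Y" using A D(1-5) by auto
  have c: "s (q ` A) \<in> carrier G" "s A \<in> carrier G" "g \<in> carrier G"
    using A qA D(1) by (auto simp: s_closed)
  have g: "s A \<otimes> g = g \<otimes> s (q ` A)"
    using D(6)[OF qA] unfolding pq by simp
  have "inv g \<otimes> s A = inv g \<otimes> (s A \<otimes> g) \<otimes> inv g"
    using c by (simp add: m_assoc)
  also have "\<dots> = (inv g \<otimes> g) \<otimes> s (q ` A) \<otimes> inv g"
    unfolding g using c by (simp only: m_assoc inv_closed m_closed)
  finally show "inv g \<otimes> s A = s (q ` A) \<otimes> inv g" using c by simp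
qed (use implementsD(1-5)[OF assms] in auto)

lemma implements_mult:
  assumes "implements g p q" "implements g' p' q'"
  shows "implements (g \<otimes> g') (p \<circ> p') (q' \<circ> q)"
proof (rule implementsI)
  note D = implementsD[OF assms(1)] implementsD[OF assms(2)]
  fix A assume A: "finite A" "A \<subseteq> Y"
  have A': "finite (p' ` A)" "p' ` A \<subseteq> Y" "p ` p' ` A \<subseteq> Y" using A D(4,10) by auto
  note e = D(6)[OF A'(1,2)] D(12)[OF A]
  have c: "s A \<in> carrier G" "s (p' ` A) \<in> carrier G" "s (p ` p' ` A) \<in> carrier G"
      "g \<in> carrier G" "g' \<in> carrier G"
    using A A' D(1,7) by (simp_all add: s_closed)
  have "(g \<otimes> g') \<otimes> s A = g \<otimes> (g' \<otimes> s A)"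
    by (rule m_assoc) (use c in auto)
  also have "\<dots> = g \<otimes> s (p' ` A) \<otimes> g'"
    unfolding e(2) by (rule m_assoc[symmetric]) (use c in auto)
  also have "\<dots> = s (p ` p' ` A) \<otimes> (g \<otimes> g')"
    unfolding e(1) by (rule m_assoc) (use c in auto)
  finally show "(g \<otimes> g') \<otimes> s A = s ((p \<circ> p') ` A) \<otimes> (g \<otimes> g')"
    by (simp only: image_comp)
qed (use implementsD(1-5)[OF assms(1)] implementsD(1-5)[OF assms(2)] in auto)

lemma implements_pow:
  assumes "implements g p q"
  shows "implements (g [^] (n::nat)) (p ^^ n) (q ^^ n)"
proof (induction n)
  case 0
  show ?case using implements_one by (simp add: id_def)
next
  case (Suc n)
  have "p ^^ n \<circ> p = p ^^ Suc n" by (rule funpow_Suc_right[symmetric])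
  moreover have "q \<circ> q ^^ n = q ^^ Suc n" by simp
  ultimately show ?case
    using implements_mult[OF Suc assms] by (simp only: nat_pow_Suc)
qed

lemma finitary_vimage:
  assumes "finitary P" "implements g p q"
  shows "finitary (\<lambda>\<omega>. P (p -` \<omega>))"
proof -
  obtain T where T: "finite T" "T \<subseteq> Y" "depends_on T P"
    using assms(1) by (auto simp: finitary_def)
  have "p -` (\<omega> \<inter> p ` T) \<inter> T = p -` \<omega> \<inter> T" for \<omega> by auto
  then have "depends_on (p ` T) (\<lambda>\<omega>. P (p -` \<omega>))"
    unfolding depends_on_def using depends_onD[OF T(3)] by metis
  then show ?thesis
    unfolding finitary_def using T implementsD(4)[OF assms(2)] by (intro exI[of _ "p ` T"]) auto
qed

text \<open>Conjugation by \<open>g\<close> carries \<open>prj T B\<close> to the projection for the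
  images of \<open>T\<close> and \<open>B\<close> under \<open>p\<close>. The image of
  \<open>B\<close> must satisfy the new event exactly if \<open>B\<close> satisfies
  \<open>P\<close>, which is why the preimage under \<open>p\<close> appears.\<close>

lemma L_op:
  assumes "finitary P" "implements g p q"
  shows "L g (op P f) = op (\<lambda>\<omega>. P (p -` \<omega>)) (L g f)"
proof -
  obtain T where T: "finite T" "T \<subseteq> Y" "depends_on T P"
    using assms(1) by (auto simp: finitary_def)
  have g: "g \<in> carrier G" and pq: "\<And>x. p (q x) = x" "\<And>x. q (p x) = x" and pT: "p ` T \<subseteq> Y"
    using implementsD(1-5)[OF assms(2)] T by auto
  have inj: "inj p" using pq(2) by (metis injI)
  have v: "p -` p ` B = B" for B using inj by (simp add: inj_vimage_image_eq)
  have w: "p ` p -` B = B" for B using pq(1) by (metis surj_def surj_image_vimage_eq)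
  have injP: "inj_on ((`) p) A" for A by (rule inj_on_inverseI[where g = "(-`) p"]) (rule v)
  have "p -` (\<omega> \<inter> p ` T) \<inter> T = p -` \<omega> \<inter> T" for \<omega> by auto
  then have D: "depends_on (p ` T) (\<lambda>\<omega>. P (p -` \<omega>))"
    unfolding depends_on_def using depends_onD[OF T(3)] by metis
  have c: "L g (L (s A) f) = L (s (p ` A)) (L g f)" if A: "A \<subseteq> T" for A
  proof -
    have "finite A" "A \<subseteq> Y" "p ` A \<subseteq> Y" using A T pT finite_subset by auto
    moreover from this have "g \<otimes> s A = s (p ` A) \<otimes> g" by (intro implementsD(6)[OF assms(2)])
    ultimately show ?thesis using g by (simp add: left_regular_left_regular s_closed)
  qed
  have ck: "card (p ` C) = card C" for C
    using inj by (simp add: card_image inj_on_subset[OF inj])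
  have prj: "L g (prj T B f) = prj (p ` T) (p ` B) (L g f)" if "B \<subseteq> T" for B
  proof
    fix x
    have "(\<Sum>A\<in>Pow (p ` T). (-1) ^ card (A \<inter> p ` B) * L (s A) (L g f) x) =
        (\<Sum>A\<in>Pow T. (-1) ^ card (p ` A \<inter> p ` B) * L (s (p ` A)) (L g f) x)"
      unfolding image_Pow_surj[OF refl, symmetric, of p T] by (simp add: sum.reindex[OF injP])
    also have "\<dots> = (\<Sum>A\<in>Pow T. (-1) ^ card (A \<inter> B) * L g (L (s A) f) x)"
      using ck by (intro sum.cong) (auto simp: c simp flip: image_Int[OF inj])
    finally show "L g (prj T B f) x = prj (p ` T) (p ` B) (L g f) x"
      unfolding prj_def L_scale left_regular_sum by (simp add: sum_fun_apply ck)
  qed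
  have "L g (op P f) = (\<Sum>B | B \<subseteq> T \<and> P B. prj (p ` T) (p ` B) (L g f))"
    using T by (simp add: op_eq_op_on op_on_def left_regular_sum prj)
  also have "\<dots> = (\<Sum>B | B \<subseteq> p ` T \<and> P (p -` B). prj (p ` T) B (L g f))"
  proof -
    have "{B. B \<subseteq> p ` T \<and> P (p -` B)} = (`) p ` {B. B \<subseteq> T \<and> P B}"
    proof (intro equalityI subsetI)
      fix B assume "B \<in> {B. B \<subseteq> p ` T \<and> P (p -` B)}"
      moreover from this have "p -` B \<subseteq> T" using v[of T] by blast
      ultimately show "B \<in> (`) p ` {B. B \<subseteq> T \<and> P B}"
        by (intro image_eqI[of _ _ "p -` B"]) (simp only: w, simp)
    qed (auto simp: v)
    then show ?thesis by (simp add: sum.reindex[OF injP])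
  qed
  also have "\<dots> = op (\<lambda>\<omega>. P (p -` \<omega>)) (L g f)"
    using T D pT by (subst op_eq_op_on[of "p ` T"]) (auto simp: op_on_def)
  finally show ?thesis .
qed

lemma ell2_prj: "finite T \<Longrightarrow> T \<subseteq> Y \<Longrightarrow> f \<in> ell2 G \<Longrightarrow> prj T B f \<in> ell2 G"
  unfolding prj_def
  by (intro ell2_scale ell2_sum ell2_left_regular s_closed) (auto dest: finite_subset)

lemma ell2_op: "finitary P \<Longrightarrow> f \<in> ell2 G \<Longrightarrow> op P f \<in> ell2 G"
  by (auto simp: finitary_def op_eq_op_on op_on_def intro!: ell2_sum ell2_prj)

text \<open>Each \<open>s A\<close> is an involution, so \<open>L (s A)\<close> is self-adjoint, and
  the Fourier coefficients are real.\<close>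

lemma op_selfadjoint:
  assumes "finitary P" "f \<in> ell2 G" "h \<in> ell2 G"
  shows "ell2_inner G (op P f) h = ell2_inner G f (op P h)"
proof -
  obtain T where T: "finite T" "T \<subseteq> Y" "depends_on T P"
    using assms(1) by (auto simp: finitary_def)
  have fin: "finite A" "A \<subseteq> Y" if "A \<subseteq> T" for A
    using that T finite_subset by auto
  have expand: "ell2_inner G (prj T B u) v =
      (\<Sum>A\<in>Pow T. (-1) ^ card (A \<inter> B) * ell2_inner G (L (s A) u) v) / 2 ^ card T"
    if "u \<in> ell2 G" "v \<in> ell2 G" for u v B
    unfolding prj_def ell2_inner_scale_left
    using that fin by (subst ell2_inner_sum_left)
      (auto simp: ell2_inner_scale_left intro!: ell2_scale ell2_left_regular s_closed)
  have prj: "ell2_inner G (prj T B f) h = ell2_inner G f (prj T B h)" for B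
  proof -
    have "ell2_inner G f (prj T B h) = cnj (ell2_inner G (prj T B h) f)"
      by (rule ell2_inner_cnj)
    also have "\<dots> = (\<Sum>A\<in>Pow T. (-1) ^ card (A \<inter> B) * ell2_inner G f (L (s A) h)) / 2 ^ card T"
      using assms by (simp add: expand ell2_inner_cnj[of G f])
    also have "\<dots> = ell2_inner G (prj T B f) h"
      using assms fin by (simp add: expand ell2_inner_left_regular s_inv s_closed)
    finally show ?thesis by simp
  qed
  have sum: "ell2_inner G (op P u) v = (\<Sum>B | B \<subseteq> T \<and> P B. ell2_inner G (prj T B u) v)"
    if "u \<in> ell2 G" "v \<in> ell2 G" for u v
    using T that by (simp add: op_eq_op_on op_on_def ell2_inner_sum_left ell2_prj)
  have "ell2_inner G f (op P h) = cnj (ell2_inner G (op P h) f)"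
    by (rule ell2_inner_cnj)
  also have "\<dots> = (\<Sum>B | B \<subseteq> T \<and> P B. ell2_inner G f (prj T B h))"
    using assms by (simp add: sum ell2_inner_cnj[of G f])
  finally show ?thesis using assms by (simp add: sum prj)
qed

end

section \<open>Walks along two arms\<close>

locale walk =
  fixes \<alpha> \<alpha>i \<beta> \<beta>i :: "'x \<Rightarrow> 'x" and base :: 'x
  assumes \<alpha>_inv: "\<alpha> (\<alpha>i x) = x" "\<alpha>i (\<alpha> x) = x"
    and \<beta>_inv: "\<beta> (\<beta>i x) = x" "\<beta>i (\<beta> x) = x"
begin

lemma walk_swap: "walk \<beta> \<beta>i \<alpha> \<alpha>i"
  by unfold_locales (rule \<alpha>_inv \<beta>_inv)+

definition corner :: "'x set \<Rightarrow> bool" where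
  "corner \<omega> \<longleftrightarrow> base \<in> \<omega> \<and> \<alpha>i base \<notin> \<omega> \<and> \<beta>i base \<notin> \<omega>"

text \<open>The forward neighbour \<open>\<alpha> base\<close> is left free, so that the tip of an
  arm has the same local type as its inner points. Likewise \<open>corner\<close> leaves both
  forward neighbours free, which admits arms of length zero.\<close>

definition on_arm :: "'x set \<Rightarrow> bool" where
  "on_arm \<omega> \<longleftrightarrow> base \<in> \<omega> \<and> \<alpha>i base \<in> \<omega> \<and> \<beta> base \<notin> \<omega> \<and> \<beta>i base \<notin> \<omega>"

definition on_arm' :: "'x set \<Rightarrow> bool" where
  "on_arm' \<omega> \<longleftrightarrow> base \<in> \<omega> \<and> \<beta>i base \<in> \<omega> \<and> \<alpha> base \<notin> \<omega> \<and> \<alpha>i base \<notin> \<omega>"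

definition good :: "'x set \<Rightarrow> bool" where
  "good \<omega> \<longleftrightarrow> corner \<omega> \<or> on_arm \<omega> \<or> on_arm' \<omega>"

definition shape :: "nat \<Rightarrow> nat \<Rightarrow> 'x set \<Rightarrow> bool" where
  "shape m n \<omega> \<longleftrightarrow> corner \<omega> \<and>
     (\<forall>i\<in>{1..m}. on_arm ((\<alpha> ^^ i) -` \<omega>)) \<and> (\<alpha> ^^ Suc m) base \<notin> \<omega> \<and>
     (\<forall>j\<in>{1..n}. on_arm' ((\<beta> ^^ j) -` \<omega>)) \<and> (\<beta> ^^ Suc n) base \<notin> \<omega>"

text \<open>Every point reached from the base in at most \<open>r\<close> steps through lit points
  is good. The preimage of \<omega> under \<open>p\<close> is the configuration seen from the
  neighbour in direction \<open>p\<close>; iterating preimages appends letters on the right, as in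
  the Cayley graph.\<close>

primrec explored :: "nat \<Rightarrow> 'x set \<Rightarrow> bool" where
  "explored 0 \<omega> = good \<omega>"
| "explored (Suc r) \<omega> = (explored r \<omega> \<and>
     (\<forall>p\<in>{\<alpha>, \<alpha>i, \<beta>, \<beta>i}. base \<in> \<omega> \<and> p base \<in> \<omega> \<longrightarrow> explored r (p -` \<omega>)))"

text \<open>The vertices of an L-shape are numbered by integers, the corner being \<open>0\<close> and the arm along
  \<open>\<beta>\<close> negative; \<open>shape m n (neg z -` \<omega>)\<close> says that \<open>base\<close> is vertex \<open>z\<close>.\<close>

definition pos :: "int \<Rightarrow> 'x \<Rightarrow> 'x" where
  "pos z = (if 0 \<le> z then \<alpha> ^^ nat z else \<beta> ^^ nat (-z))"

definition neg :: "int \<Rightarrow> 'x \<Rightarrow> 'x" where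
  "neg z = (if 0 \<le> z then \<alpha>i ^^ nat z else \<beta>i ^^ nat (-z))"

text \<open>If the base is vertex \<open>z\<close> of an L-shape, then \<open>neg z\<close> leads to
  the corner; the event asks for a run of M + 1 lit points from there. It is unlikely, and outside
  it a bounded exploration sees the whole cluster.\<close>

definition far :: "nat \<Rightarrow> 'x set \<Rightarrow> bool" where
  "far M \<omega> \<longleftrightarrow> (\<exists>z\<in>{- int M..int M}.
     (\<forall>k\<in>{..M}. neg z ((\<alpha> ^^ k) base) \<in> \<omega>) \<or> (\<forall>k\<in>{..M}. neg z ((\<beta> ^^ k) base) \<in> \<omega>))"

text \<open>The locale is symmetric in the two permutations. These equations turn the swapped
  instance of a statement about the \<alpha>-arm into one about the \<beta>-arm.\<close>

lemma swap_simps: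
  shows "walk.corner \<beta>i \<alpha>i base = corner"
    and "walk.on_arm \<beta>i \<alpha> \<alpha>i base = on_arm'" "walk.on_arm' \<beta> \<beta>i \<alpha>i base = on_arm"
    and "walk.good \<beta> \<beta>i \<alpha> \<alpha>i base = good"
    and "walk.shape \<beta> \<beta>i \<alpha> \<alpha>i base n m = shape m n"
    and "walk.explored \<beta> \<beta>i \<alpha> \<alpha>i base r = explored r"
    and "z \<noteq> 0 \<Longrightarrow> walk.neg \<beta>i \<alpha>i z = neg (- z)"
proof -
  note W = walk.corner_def[OF walk_swap] walk.on_arm_def[OF walk_swap] walk.on_arm'_def[OF walk_swap]
    walk.good_def[OF walk_swap] walk.shape_def[OF walk_swap] walk.neg_def[OF walk_swap]
  note V = corner_def on_arm_def on_arm'_def good_def shape_def neg_def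
  show c: "walk.corner \<beta>i \<alpha>i base = corner"
    by (rule ext) (unfold W V, blast)
  show a: "walk.on_arm \<beta>i \<alpha> \<alpha>i base = on_arm'" "walk.on_arm' \<beta> \<beta>i \<alpha>i base = on_arm"
    by (rule ext, simp only: W V)+
  show g: "walk.good \<beta> \<beta>i \<alpha> \<alpha>i base = good"
    by (rule ext) (unfold walk.good_def[OF walk_swap] c a good_def, blast)
  show "walk.shape \<beta> \<beta>i \<alpha> \<alpha>i base n m = shape m n"
    by (rule ext) (unfold walk.shape_def[OF walk_swap] c a shape_def, blast)
  show "walk.explored \<beta> \<beta>i \<alpha> \<alpha>i base r = explored r"
  proof (induction r)
    case 0
    show ?case by (rule ext) (simp add: walk.explored.simps[OF walk_swap] g)
  next
    case (Suc r)
    show ?case by (rule ext) (auto simp: walk.explored.simps[OF walk_swap] Suc)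
  qed
  show "z \<noteq> 0 \<Longrightarrow> walk.neg \<beta>i \<alpha>i z = neg (- z)"
    by (simp add: W V)
qed

lemma pow_inv [simp]:
  "(\<alpha> ^^ n) ((\<alpha>i ^^ n) x) = x" "(\<alpha>i ^^ n) ((\<alpha> ^^ n) x) = x"
  "(\<beta> ^^ n) ((\<beta>i ^^ n) x) = x" "(\<beta>i ^^ n) ((\<beta> ^^ n) x) = x"
proof -
  have *: "(p ^^ n) ((q ^^ n) x) = x" if "\<And>x. p (q x) = x" for p q :: "'x \<Rightarrow> 'x" and x
  proof (induction n arbitrary: x)
    case (Suc n)
    have "(p ^^ Suc n) ((q ^^ Suc n) x) = (p ^^ n) (p (q ((q ^^ n) x)))"
      by (simp add: funpow_swap1)
    then show ?case by (simp add: that Suc.IH)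
  qed simp
  show "(\<alpha> ^^ n) ((\<alpha>i ^^ n) x) = x" "(\<alpha>i ^^ n) ((\<alpha> ^^ n) x) = x"
    "(\<beta> ^^ n) ((\<beta>i ^^ n) x) = x" "(\<beta>i ^^ n) ((\<beta> ^^ n) x) = x"
    by (rule *, rule \<alpha>_inv \<beta>_inv)+
qed

lemma pos_neg [simp]: "pos z (neg z x) = x" "neg z (pos z x) = x"
  by (simp_all add: pos_def neg_def)

lemma pow_inv_add:
  "(\<alpha>i ^^ i) ((\<alpha> ^^ (i + j)) x) = (\<alpha> ^^ j) x"
  "(\<alpha>i ^^ (i + j)) ((\<alpha> ^^ j) x) = (\<alpha>i ^^ i) x"
  by (simp_all add: funpow_add)

lemma pow_vimage_vimage:
  "(\<alpha> ^^ i) -` (\<alpha>i ^^ i) -` \<omega> = \<omega>"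
  "(\<alpha> ^^ (i + j)) -` (\<alpha>i ^^ i) -` \<omega> = (\<alpha> ^^ j) -` \<omega>"
  "(\<alpha> ^^ j) -` (\<alpha>i ^^ (i + j)) -` \<omega> = (\<alpha>i ^^ i) -` \<omega>"
  by (simp_all add: vimage_def pow_inv_add)

lemma pow_Suc_vimage: "(p ^^ Suc n) -` \<omega> = p -` (p ^^ n) -` \<omega>" for p :: "'x \<Rightarrow> 'x"
  by (simp add: vimage_def funpow_swap1)

lemma shapeD:
  assumes "shape m n \<omega>"
  shows "corner \<omega>" "\<And>i. 1 \<le> i \<Longrightarrow> i \<le> m \<Longrightarrow> on_arm ((\<alpha> ^^ i) -` \<omega>)" "(\<alpha> ^^ Suc m) base \<notin> \<omega>"
    "\<And>j. 1 \<le> j \<Longrightarrow> j \<le> n \<Longrightarrow> on_arm' ((\<beta> ^^ j) -` \<omega>)" "(\<beta> ^^ Suc n) base \<notin> \<omega>"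
  using assms unfolding shape_def by (blast intro: atLeastAtMost_iff[THEN iffD2])+

lemma shape_mem_arm:
  assumes "shape m n \<omega>" "i \<le> m"
  shows "(\<alpha> ^^ i) base \<in> \<omega>"
  using shapeD(1)[OF assms(1)] shapeD(2)[OF assms(1), of i] assms(2)
  by (cases "i = 0") (auto simp: corner_def on_arm_def)

lemma shape_pos:
  assumes "shape m n (neg z -` \<omega>)" "0 < z" "z \<le> int m"
  shows "on_arm \<omega>"
  using shapeD(2)[OF assms(1), of "nat z"] assms(2,3) by (simp add: neg_def pow_vimage_vimage)

lemma shape_zero: "shape m n (neg 0 -` \<omega>) \<Longrightarrow> corner \<omega>"
  using shapeD(1) by (simp add: neg_def)

lemma shape_neg:
  assumes "shape m n (neg z -` \<omega>)" "z < 0" "- int n \<le> z"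
  shows "on_arm' \<omega>"
  using walk.shape_pos[OF walk_swap, where z = "-z" and m = n and n = m and \<omega> = \<omega> and base = base] assms
  by (simp add: swap_simps)

lemma shape_good: "shape m n (neg z -` \<omega>) \<Longrightarrow> - int n \<le> z \<Longrightarrow> z \<le> int m \<Longrightarrow> good \<omega>"
  using shape_pos shape_zero shape_neg unfolding good_def by (metis not_less_iff_gr_or_eq)

lemma shape_next:
  assumes S: "shape m n (neg z -` \<omega>)" and z: "- int n \<le> z" "z \<le> int m"
  shows "\<alpha> base \<in> \<omega> \<longleftrightarrow> 0 \<le> z \<and> z < int m"
proof (cases "0 \<le> z")
  case True
  define i where "i = nat z"
  have i: "neg z = \<alpha>i ^^ i" "i \<le> m" "z = int i" using True z by (auto simp: neg_def i_def)
  have e: "(\<alpha>i ^^ i) ((\<alpha> ^^ Suc i) base) = \<alpha> base"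
    using pow_inv_add(1)[of i 1 base] by simp
  show ?thesis
  proof (cases "i < m")
    case True
    then have "(\<alpha> ^^ Suc i) base \<in> neg z -` \<omega>" by (intro shape_mem_arm[OF S]) simp
    then show ?thesis using True e i by simp
  next
    case False
    then have "(\<alpha> ^^ Suc i) base \<notin> neg z -` \<omega>" using shapeD(3)[OF S] i by simp
    then show ?thesis using False e i by simp
  qed
next
  case False
  then show ?thesis using shape_neg[OF S] z by (auto simp: on_arm'_def)
qed

lemma shape_prev:
  assumes "shape m n (neg z -` \<omega>)" "- int n \<le> z" "z \<le> 0"
  shows "\<alpha>i base \<notin> \<omega>"
  using shape_neg[OF assms(1)] shape_zero[of m n \<omega>] assms
  by (cases "z = 0") (auto simp: on_arm'_def corner_def)

text \<open>Otherwise the corner of the first L-shape would be a non-corner point on the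
  \<alpha>-arm of the second.\<close>

lemma shape_unique_z_aux:
  assumes S: "shape m n (neg z -` \<omega>)" "shape m' n' (neg z' -` \<omega>)"
    and z: "0 < z" "z < z'" "z' \<le> int m'"
  shows False
proof -
  define d where "d = nat (z' - z)"
  have "nat z' = nat z + d" using z by (simp add: d_def)
  then have "neg z' -` \<omega> = neg (int d) -` (neg z -` \<omega>)"
    using z by (simp add: neg_def funpow_add vimage_comp)
  then have "on_arm (neg z -` \<omega>)"
    using S(2) z by (intro shape_pos[of m' n' "int d"]) (auto simp: d_def)
  then show False using shapeD(1)[OF S(1)] by (auto simp: on_arm_def corner_def)
qed

lemma shape_unique_arm:
  assumes "shape m n \<omega>" "shape m' n' \<omega>"
  shows "m = m'"
proof -
  have "\<not> m < m'" if "shape m n \<omega>" "shape m' n' \<omega>" for m n m' n'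
    using shapeD(3)[OF that(1)] shape_mem_arm[OF that(2), of "Suc m"] by auto
  then show ?thesis using assms by (meson not_less_iff_gr_or_eq)
qed

text \<open>The local type of the base determines the sign of \<open>z\<close>, the distance to the
  corner determines \<open>z\<close>, and the ends of the runs determine the arms. The events for
  different \<open>m\<close>, \<open>n\<close>, \<open>z\<close> are thus disjoint, and their
  operators add up.\<close>

lemma shape_unique:
  assumes S: "shape m n (neg z -` \<omega>)" "shape m' n' (neg z' -` \<omega>)"
    and z: "- int n \<le> z" "z \<le> int m" and z': "- int n' \<le> z'" "z' \<le> int m'"
  shows "m = m' \<and> n = n' \<and> z = z'"
proof -
  have types: "(0 < z \<longrightarrow> on_arm \<omega>) \<and> (z = 0 \<longrightarrow> corner \<omega>) \<and> (z < 0 \<longrightarrow> on_arm' \<omega>)"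
    if "shape m n (neg z -` \<omega>)" "- int n \<le> z" "z \<le> int m" for m n z
    using shape_pos[OF that(1)] shape_zero[of m n \<omega>] shape_neg[OF that(1)] that by auto
  have dis: "\<not> (on_arm \<omega> \<and> corner \<omega>)" "\<not> (on_arm \<omega> \<and> on_arm' \<omega>)" "\<not> (on_arm' \<omega> \<and> corner \<omega>)"
    by (auto simp: on_arm_def on_arm'_def corner_def)
  have signs: "(0 < z \<longleftrightarrow> 0 < z') \<and> (z < 0 \<longleftrightarrow> z' < 0)"
    using types[OF S(1) z] types[OF S(2) z'] dis by (metis linorder_less_linear)
  have eq: "z = z'"
  proof (cases "0 < z")
    case True
    then show ?thesis
      using shape_unique_z_aux[OF S] shape_unique_z_aux[OF S(2,1)] signs z z'
      by (meson linorder_less_linear)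
  next
    case False
    show ?thesis
    proof (cases "z = 0")
      case True
      then show ?thesis using signs by simp
    next
      case False
      then have neg: "z < 0" "z' < 0" using \<open>\<not> 0 < z\<close> signs by auto
      have S': "walk.shape \<beta> \<beta>i \<alpha> \<alpha>i base n m (walk.neg \<beta>i \<alpha>i (- z) -` \<omega>)"
        "walk.shape \<beta> \<beta>i \<alpha> \<alpha>i base n' m' (walk.neg \<beta>i \<alpha>i (- z') -` \<omega>)"
        using S neg by (simp_all add: swap_simps)
      show ?thesis
        using walk.shape_unique_z_aux[OF walk_swap S'] walk.shape_unique_z_aux[OF walk_swap S'(2,1)] neg z z'
        by (meson linorder_less_linear neg_less_iff_less neg_0_less_iff_less minus_le_iff)
    qed
  qed
  then have S2: "shape m' n' (neg z -` \<omega>)" using S(2) by simp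
  have "m = m'" by (rule shape_unique_arm[OF S(1) S2])
  moreover have "n = n'"
    using walk.shape_unique_arm[OF walk_swap, where base = base and m = n and n = m and m' = n' and n' = m'] S(1) S2
    by (simp add: swap_simps)
  ultimately show ?thesis using eq by simp
qed

lemma explored_good: "explored r \<omega> \<Longrightarrow> good \<omega>"
  by (induction r) auto

lemma explored_step:
  "explored (Suc r) \<omega> \<Longrightarrow> p \<in> {\<alpha>, \<alpha>i, \<beta>, \<beta>i} \<Longrightarrow> base \<in> \<omega> \<Longrightarrow> p base \<in> \<omega> \<Longrightarrow> explored r (p -` \<omega>)"
  by auto

lemma explored_pow:
  assumes p: "p \<in> {\<alpha>, \<alpha>i, \<beta>, \<beta>i}"
    and "explored r \<omega>" "j \<le> r" "\<And>k. k \<le> j \<Longrightarrow> (p ^^ k) base \<in> \<omega>"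
  shows "explored (r - j) ((p ^^ j) -` \<omega>)"
  using assms(3,4)
proof (induction j)
  case 0
  then show ?case using assms(2) by simp
next
  case (Suc j)
  have IH: "explored (r - j) ((p ^^ j) -` \<omega>)"
    using Suc by simp
  have r: "r - j = Suc (r - Suc j)" using Suc.prems(1) by simp
  have "base \<in> (p ^^ j) -` \<omega>" "p base \<in> (p ^^ j) -` \<omega>"
    using Suc.prems(2)[of j] Suc.prems(2)[of "Suc j"] by (simp_all add: funpow_swap1)
  from explored_step[OF IH[unfolded r] p this] show ?case
    unfolding pow_Suc_vimage .
qed

text \<open>The point is good and its predecessor is lit, which excludes the other two local
  types.\<close>

lemma explored_on_arm:
  assumes "explored r \<omega>" "j \<le> r" "\<And>k. k \<le> j \<Longrightarrow> (\<alpha> ^^ k) base \<in> \<omega>" "1 \<le> j"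
  shows "on_arm ((\<alpha> ^^ j) -` \<omega>)"
proof -
  have "explored (r - j) ((\<alpha> ^^ j) -` \<omega>)"
    by (rule explored_pow) (use assms in auto)
  then have g: "good ((\<alpha> ^^ j) -` \<omega>)" by (rule explored_good)
  obtain i where j: "j = Suc i" using assms(4) by (cases j) auto
  have "(\<alpha> ^^ j) (\<alpha>i base) = (\<alpha> ^^ i) base"
    by (simp add: j funpow_swap1 \<alpha>_inv)
  then have "\<alpha>i base \<in> (\<alpha> ^^ j) -` \<omega>" using assms(3)[of i] j by simp
  with g show ?thesis by (auto simp: good_def corner_def on_arm'_def)
qed

lemma arm_length:
  assumes "explored r \<omega>" "M \<le> r" "base \<in> \<omega>" "\<not> (\<forall>k\<in>{..M}. (\<alpha> ^^ k) base \<in> \<omega>)"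
  obtains m where "m < M" "\<And>k. k \<le> m \<Longrightarrow> (\<alpha> ^^ k) base \<in> \<omega>" "(\<alpha> ^^ Suc m) base \<notin> \<omega>"
    "\<And>i. 1 \<le> i \<Longrightarrow> i \<le> m \<Longrightarrow> on_arm ((\<alpha> ^^ i) -` \<omega>)"
proof -
  define k where "k = (LEAST k. (\<alpha> ^^ k) base \<notin> \<omega>)"
  obtain k' where k': "k' \<le> M" "(\<alpha> ^^ k') base \<notin> \<omega>" using assms(4) by auto
  have k: "(\<alpha> ^^ k) base \<notin> \<omega>" "k \<le> k'" "\<And>i. i < k \<Longrightarrow> (\<alpha> ^^ i) base \<in> \<omega>"
    using LeastI[of "\<lambda>k. (\<alpha> ^^ k) base \<notin> \<omega>", OF k'(2)] Least_le[of "\<lambda>k. (\<alpha> ^^ k) base \<notin> \<omega>", OF k'(2)]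
      not_less_Least[of _ "\<lambda>k. (\<alpha> ^^ k) base \<notin> \<omega>"] unfolding k_def by blast+
  have "k \<noteq> 0" using k(1) assms(3) by (intro notI) simp
  then obtain m where m: "k = Suc m" by (cases k) auto
  show ?thesis
  proof (rule that[of m])
    show "on_arm ((\<alpha> ^^ i) -` \<omega>)" if "1 \<le> i" "i \<le> m" for i
      by (rule explored_on_arm[OF assms(1)]) (use that k k' m assms(2) in auto)
  qed (use k k' m in auto)
qed

lemma corner_shape:
  assumes "explored r \<omega>" "M \<le> r" "corner \<omega>"
    and "\<not> (\<forall>k\<in>{..M}. (\<alpha> ^^ k) base \<in> \<omega>)" "\<not> (\<forall>k\<in>{..M}. (\<beta> ^^ k) base \<in> \<omega>)"
  obtains m n where "m < M" "n < M" "shape m n \<omega>"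
proof -
  have base: "base \<in> \<omega>" using assms(3) by (simp add: corner_def)
  obtain m where m: "m < M" "(\<alpha> ^^ Suc m) base \<notin> \<omega>"
    "\<And>i. 1 \<le> i \<Longrightarrow> i \<le> m \<Longrightarrow> on_arm ((\<alpha> ^^ i) -` \<omega>)"
    using arm_length[OF assms(1,2) base assms(4)] by metis
  have "walk.explored \<beta> \<beta>i \<alpha> \<alpha>i base r \<omega>" using assms(1) by (simp only: swap_simps)
  from walk.arm_length[OF walk_swap this assms(2) base assms(5)]
  obtain n where n: "n < M" "(\<beta> ^^ Suc n) base \<notin> \<omega>"
    "\<And>i. 1 \<le> i \<Longrightarrow> i \<le> n \<Longrightarrow> on_arm' ((\<beta> ^^ i) -` \<omega>)"
    unfolding swap_simps by metis
  have "shape m n \<omega>"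
    unfolding shape_def using assms(3) m n by (auto simp del: funpow.simps)
  then show ?thesis using that m n by blast
qed

lemma arm_back:
  assumes "explored r \<omega>" "M \<le> r" "on_arm \<omega>" "\<not> (\<forall>k\<in>{..M}. (\<alpha>i ^^ k) base \<in> \<omega>)"
  obtains z where "1 \<le> z" "z < M" "corner ((\<alpha>i ^^ z) -` \<omega>)" "explored (r - z) ((\<alpha>i ^^ z) -` \<omega>)"
    "\<And>k. k \<le> z \<Longrightarrow> (\<alpha>i ^^ k) base \<in> \<omega>"
proof -
  define k where "k = (LEAST k. (\<alpha>i ^^ k) base \<notin> \<omega>)"
  obtain k' where k': "k' \<le> M" "(\<alpha>i ^^ k') base \<notin> \<omega>" using assms(4) by auto
  have k: "(\<alpha>i ^^ k) base \<notin> \<omega>" "k \<le> k'" "\<And>i. i < k \<Longrightarrow> (\<alpha>i ^^ i) base \<in> \<omega>"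
    using LeastI[of "\<lambda>k. (\<alpha>i ^^ k) base \<notin> \<omega>", OF k'(2)] Least_le[of "\<lambda>k. (\<alpha>i ^^ k) base \<notin> \<omega>", OF k'(2)]
      not_less_Least[of _ "\<lambda>k. (\<alpha>i ^^ k) base \<notin> \<omega>"] unfolding k_def by blast+
  have k01: "k \<noteq> 0" "k \<noteq> 1"
    by (rule notI, use k(1) assms(3) in \<open>simp add: on_arm_def\<close>)+
  \<comment> \<open>\<open>k\<close> is the first unlit index going backwards. The base and
    \<open>\<alpha>i base\<close> are lit, so \<open>k\<close> is at least 2, and the last lit point
    has index \<open>k - 1 = Suc z\<close>.\<close>
  define z where "z = k - 2"
  have z: "k = Suc (Suc z)" using k01 by (simp add: z_def)
  have e: "explored (r - Suc z) ((\<alpha>i ^^ Suc z) -` \<omega>)"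
  proof (rule explored_pow)
    show "Suc z \<le> r" using k(2) k'(1) z assms(2) by simp
    show "(\<alpha>i ^^ i) base \<in> \<omega>" if "i \<le> Suc z" for i
      by (rule k(3)) (use that z in simp)
  qed (use assms(1) in simp_all)
  have "(\<alpha>i ^^ Suc z) (\<alpha> base) = (\<alpha>i ^^ z) base"
    by (simp add: funpow_swap1 \<alpha>_inv)
  then have "\<alpha> base \<in> (\<alpha>i ^^ Suc z) -` \<omega>" using k(3)[of z] z by simp
  moreover have "\<alpha>i base \<notin> (\<alpha>i ^^ Suc z) -` \<omega>" using k(1) z by (simp add: funpow_swap1)
  \<comment> \<open>At the last lit point the backward \<alpha>-neighbour is dark, excluding
    \<open>on_arm\<close>, and the forward one is lit, excluding \<open>on_arm'\<close>.\<close>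
  ultimately have "corner ((\<alpha>i ^^ Suc z) -` \<omega>)"
    using explored_good[OF e] by (auto simp: good_def on_arm_def on_arm'_def simp del: funpow.simps)
  then show ?thesis
    using e k k' z by (intro that[of "Suc z"]) auto
qed

lemma cover_on_arm:
  assumes "explored (2 * M) \<omega>" "on_arm \<omega>" "\<not> far M \<omega>"
  obtains m n z where "m < M" "n < M" "0 < z" "z \<le> int m" "shape m n (neg z -` \<omega>)"
proof -
  have "\<not> (\<forall>k\<in>{..M}. (\<alpha>i ^^ k) base \<in> \<omega>)"
  proof
    assume *: "\<forall>k\<in>{..M}. (\<alpha>i ^^ k) base \<in> \<omega>"
    \<comment> \<open>A backward run from the base is a forward run from the vertex \<open>M\<close>
      steps behind it.\<close>
    have "neg (int M) ((\<alpha> ^^ k) base) \<in> \<omega>" if "k \<in> {..M}" for k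
    proof -
      have "neg (int M) ((\<alpha> ^^ k) base) = (\<alpha>i ^^ (M - k)) base"
        using pow_inv_add(2)[of "M - k" k base] that by (simp add: neg_def)
      then show ?thesis using * by simp
    qed
    then show False using assms(3) unfolding far_def by fastforce
  qed
  from arm_back[OF assms(1) _ assms(2) this, simplified]
  obtain i where i: "1 \<le> i" "i < M" "corner ((\<alpha>i ^^ i) -` \<omega>)" "explored (2 * M - i) ((\<alpha>i ^^ i) -` \<omega>)"
    "\<And>k. k \<le> i \<Longrightarrow> (\<alpha>i ^^ k) base \<in> \<omega>"
    by auto
  have neg: "neg (int i) = \<alpha>i ^^ i" by (simp add: neg_def)
  have far: "\<not> (\<forall>k\<in>{..M}. (\<alpha> ^^ k) base \<in> (\<alpha>i ^^ i) -` \<omega>)" "\<not> (\<forall>k\<in>{..M}. (\<beta> ^^ k) base \<in> (\<alpha>i ^^ i) -` \<omega>)"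
    using assms(3) i(2) unfolding far_def neg[symmetric] by (auto dest!: bspec[of _ _ "int i"])
  \<comment> \<open>The reason for exploring to depth \<open>2 * M\<close>: reaching the corner
    takes fewer than \<open>M\<close> steps, and at least \<open>M\<close> remain to follow both
    arms.\<close>
  have "M \<le> 2 * M - i" using i(2) by simp
  from corner_shape[OF i(4) this i(3) far]
  obtain m n where mn: "m < M" "n < M" "shape m n ((\<alpha>i ^^ i) -` \<omega>)" .
  \<comment> \<open>The points between the corner and the base are lit, so the arm found from the
    corner extends at least to the base.\<close>
  have "\<not> m < i"
  proof
    assume "m < i"
    then have "(\<alpha>i ^^ i) ((\<alpha> ^^ Suc m) base) = (\<alpha>i ^^ (i - Suc m)) base"
      using pow_inv_add(2)[of "i - Suc m" "Suc m" base] by simp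
    then show False using i(5)[of "i - Suc m"] shapeD(3)[OF mn(3)] by simp
  qed
  then show ?thesis
    using mn i that[of m n "int i"] by (simp add: neg)
qed

lemma far_swap: "walk.far \<beta> \<beta>i \<alpha> \<alpha>i base M \<omega> \<Longrightarrow> far M \<omega>"
proof -
  assume "walk.far \<beta> \<beta>i \<alpha> \<alpha>i base M \<omega>"
  then obtain z where z: "z \<in> {- int M..int M}"
    "(\<forall>k\<in>{..M}. walk.neg \<beta>i \<alpha>i z ((\<beta> ^^ k) base) \<in> \<omega>) \<or> (\<forall>k\<in>{..M}. walk.neg \<beta>i \<alpha>i z ((\<alpha> ^^ k) base) \<in> \<omega>)"
    unfolding walk.far_def[OF walk_swap] by blast
  have "walk.neg \<beta>i \<alpha>i z = neg (- z)"
    by (cases "z = 0") (simp_all add: swap_simps walk.neg_def[OF walk_swap] neg_def)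
  with z show ?thesis unfolding far_def by (intro bexI[of _ "- z"]) auto
qed

lemma cover:
  assumes "explored (2 * M) \<omega>" "\<not> far M \<omega>"
  obtains m n z where "m < M" "n < M" "- int n \<le> z" "z \<le> int m" "shape m n (neg z -` \<omega>)"
proof -
  consider "corner \<omega>" | "on_arm \<omega>" | "on_arm' \<omega>"
    using explored_good[OF assms(1)] unfolding good_def by blast
  then show ?thesis
  proof cases
    case 1
    have "\<not> (\<forall>k\<in>{..M}. (\<alpha> ^^ k) base \<in> \<omega>)" "\<not> (\<forall>k\<in>{..M}. (\<beta> ^^ k) base \<in> \<omega>)"
      using assms(2) unfolding far_def by (auto simp: neg_def dest!: bspec[of _ _ 0])
    from corner_shape[OF assms(1) _ 1 this] obtain m n where "m < M" "n < M" "shape m n \<omega>"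
      by auto
    then show ?thesis using that[of m n 0] by (simp add: neg_def)
  next
    case 2
    obtain m n z where "m < M" "n < M" "0 < z" "z \<le> int m" "shape m n (neg z -` \<omega>)"
      using cover_on_arm[OF assms(1) 2 assms(2)] .
    then show ?thesis by (intro that[of m n z]) auto
  next
    case 3
    have *: "walk.explored \<beta> \<beta>i \<alpha> \<alpha>i base (2 * M) \<omega>" "walk.on_arm \<beta>i \<alpha> \<alpha>i base \<omega>"
      "\<not> walk.far \<beta> \<beta>i \<alpha> \<alpha>i base M \<omega>"
      using assms 3 far_swap by (auto simp: swap_simps)
    obtain n m z where mn: "n < M" "m < M" "0 < z" "z \<le> int n"
      "walk.shape \<beta> \<beta>i \<alpha> \<alpha>i base n m (walk.neg \<beta>i \<alpha>i z -` \<omega>)"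
      using walk.cover_on_arm[OF walk_swap *] .
    then have "shape m n (neg (- z) -` \<omega>)" by (simp add: swap_simps)
    then show ?thesis using mn by (intro that[of m n "- z"]) auto
  qed
qed

end

section \<open>Probabilities of cylinder events\<close>

lemma cylinder_prob_mono:
  "finite T \<Longrightarrow> (\<And>\<omega>. P \<omega> \<Longrightarrow> Q \<omega>) \<Longrightarrow> cylinder_prob T P \<le> cylinder_prob T Q"
  unfolding cylinder_prob_def by (intro divide_right_mono) (auto intro!: card_mono)

lemma cylinder_prob_disj:
  assumes "finite T"
  shows "cylinder_prob T (\<lambda>\<omega>. P \<omega> \<or> Q \<omega>) \<le> cylinder_prob T P + cylinder_prob T Q"
proof -
  have "{B. B \<subseteq> T \<and> (P B \<or> Q B)} = {B. B \<subseteq> T \<and> P B} \<union> {B. B \<subseteq> T \<and> Q B}" by blast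
  then have "card {B. B \<subseteq> T \<and> (P B \<or> Q B)} \<le> card {B. B \<subseteq> T \<and> P B} + card {B. B \<subseteq> T \<and> Q B}"
    by (metis card_Un_le)
  then show ?thesis
    by (simp add: cylinder_prob_def divide_right_mono flip: add_divide_distrib of_nat_add)
qed

lemma cylinder_prob_bex:
  assumes "finite T" "finite I"
  shows "cylinder_prob T (\<lambda>\<omega>. \<exists>i\<in>I. P i \<omega>) \<le> (\<Sum>i\<in>I. cylinder_prob T (P i))"
  using assms(2)
proof (induction I)
  case (insert i I)
  have "cylinder_prob T (\<lambda>\<omega>. P i \<omega> \<or> (\<exists>i\<in>I. P i \<omega>)) \<le>
      cylinder_prob T (P i) + cylinder_prob T (\<lambda>\<omega>. \<exists>i\<in>I. P i \<omega>)"
    by (rule cylinder_prob_disj[OF assms(1)])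
  then show ?case using insert by simp
qed (simp add: cylinder_prob_def)

lemma cylinder_prob_pattern:
  assumes "finite T" "S \<inter> Z = {}" "S \<union> Z \<subseteq> T"
  shows "cylinder_prob T (\<lambda>\<omega>. S \<subseteq> \<omega> \<and> Z \<inter> \<omega> = {}) = (1/2) ^ card (S \<union> Z)"
proof -
  have fin: "finite S" "finite Z" using assms finite_subset by auto
  have "{B. B \<subseteq> T \<and> S \<subseteq> B \<and> Z \<inter> B = {}} = (\<lambda>C. S \<union> C) ` Pow (T - (S \<union> Z))"
  proof (intro equalityI subsetI)
    fix B assume "B \<in> {B. B \<subseteq> T \<and> S \<subseteq> B \<and> Z \<inter> B = {}}"
    then show "B \<in> (\<lambda>C. S \<union> C) ` Pow (T - (S \<union> Z))"
      by (intro image_eqI[of _ _ "B - S"]) auto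
  qed (use assms in auto)
  moreover have "inj_on (\<lambda>C. S \<union> C) (Pow (T - (S \<union> Z)))"
    by (intro inj_onI) blast
  ultimately have "card {B. B \<subseteq> T \<and> S \<subseteq> B \<and> Z \<inter> B = {}} = 2 ^ card (T - (S \<union> Z))"
    using assms by (simp add: card_image card_Pow)
  moreover have "card T = card (T - (S \<union> Z)) + card (S \<union> Z)"
    using assms fin by (metis card_Diff_subset card_mono finite_Un le_add_diff_inverse2)
  ultimately show ?thesis
    by (simp add: cylinder_prob_def power_add power_one_over)
qed

section \<open>L-shapes as finite patterns of lit and unlit points\<close>

context walk
begin

definition edge :: "('x \<Rightarrow> 'x) \<Rightarrow> 'x set \<Rightarrow> bool" where
  "edge p \<omega> \<longleftrightarrow> base \<in> \<omega> \<and> p base \<in> \<omega>"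

definition ones :: "nat \<Rightarrow> nat \<Rightarrow> 'x set" where
  "ones m n = (\<lambda>i. (\<alpha> ^^ i) base) ` {..m} \<union> (\<lambda>j. (\<beta> ^^ j) base) ` {..n}"

definition zeros :: "nat \<Rightarrow> nat \<Rightarrow> 'x set" where
  "zeros m n = {\<alpha>i base, \<beta>i base, (\<alpha> ^^ Suc m) base, (\<beta> ^^ Suc n) base} \<union>
     (\<lambda>i. (\<alpha> ^^ i) (\<beta> base)) ` {1..m} \<union> (\<lambda>i. (\<alpha> ^^ i) (\<beta>i base)) ` {1..m} \<union>
     (\<lambda>j. (\<beta> ^^ j) (\<alpha> base)) ` {1..n} \<union> (\<lambda>j. (\<beta> ^^ j) (\<alpha>i base)) ` {1..n}"

lemma pow_pred: "1 \<le> i \<Longrightarrow> (\<alpha> ^^ i) (\<alpha>i x) = (\<alpha> ^^ (i - 1)) x"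
  "1 \<le> i \<Longrightarrow> (\<beta> ^^ i) (\<beta>i x) = (\<beta> ^^ (i - 1)) x"
  by (cases i; simp add: funpow_swap1 \<alpha>_inv \<beta>_inv)+

lemma on_arm_pow_iff:
  "1 \<le> i \<Longrightarrow> on_arm ((\<alpha> ^^ i) -` \<omega>) \<longleftrightarrow> (\<alpha> ^^ i) base \<in> \<omega> \<and> (\<alpha> ^^ (i - 1)) base \<in> \<omega> \<and>
     (\<alpha> ^^ i) (\<beta> base) \<notin> \<omega> \<and> (\<alpha> ^^ i) (\<beta>i base) \<notin> \<omega>"
  "1 \<le> j \<Longrightarrow> on_arm' ((\<beta> ^^ j) -` \<omega>) \<longleftrightarrow> (\<beta> ^^ j) base \<in> \<omega> \<and> (\<beta> ^^ (j - 1)) base \<in> \<omega> \<and>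
     (\<beta> ^^ j) (\<alpha> base) \<notin> \<omega> \<and> (\<beta> ^^ j) (\<alpha>i base) \<notin> \<omega>"
  by (simp_all add: on_arm_def on_arm'_def pow_pred)

text \<open>As a pattern with prescribed bits, the event has probability 2^-N with N the number of
  distinct points, provided no point must be both lit and unlit.\<close>

lemma shape_iff_pattern: "shape m n \<omega> \<longleftrightarrow> ones m n \<subseteq> \<omega> \<and> zeros m n \<inter> \<omega> = {}"
proof
  assume S: "shape m n \<omega>"
  have "(\<alpha> ^^ i) base \<in> \<omega>" if "i \<le> m" for i by (rule shape_mem_arm[OF S that])
  moreover have "(\<beta> ^^ j) base \<in> \<omega>" if "j \<le> n" for j
    by (rule walk.shape_mem_arm[OF walk_swap _ that]) (use S in \<open>simp add: swap_simps\<close>)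
  ultimately have "ones m n \<subseteq> \<omega>" unfolding ones_def by blast
  moreover have "zeros m n \<inter> \<omega> = {}"
  proof -
    have "x \<notin> \<omega>" if "x \<in> zeros m n" for x
      using that shapeD[OF S] on_arm_pow_iff
      unfolding zeros_def corner_def by (auto simp del: funpow.simps)
    then show ?thesis by blast
  qed
  ultimately show "ones m n \<subseteq> \<omega> \<and> zeros m n \<inter> \<omega> = {}" ..
next
  assume P: "ones m n \<subseteq> \<omega> \<and> zeros m n \<inter> \<omega> = {}"
  have o: "(\<alpha> ^^ i) base \<in> \<omega>" if "i \<le> m" for i
    using P that unfolding ones_def by blast
  have o': "(\<beta> ^^ j) base \<in> \<omega>" if "j \<le> n" for j
    using P that unfolding ones_def by blast
  have z: "x \<notin> \<omega>" if "x \<in> zeros m n" for x using P that by blast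
  have "corner \<omega>"
    unfolding corner_def using o[of 0] z[of "\<alpha>i base"] z[of "\<beta>i base"] by (simp add: zeros_def)
  moreover have "on_arm ((\<alpha> ^^ i) -` \<omega>)" if i: "i \<in> {1..m}" for i
    using i o[of i] o[of "i - 1"] z[of "(\<alpha> ^^ i) (\<beta> base)"] z[of "(\<alpha> ^^ i) (\<beta>i base)"]
    by (subst on_arm_pow_iff) (auto simp: zeros_def)
  moreover have "on_arm' ((\<beta> ^^ j) -` \<omega>)" if j: "j \<in> {1..n}" for j
    using j o'[of j] o'[of "j - 1"] z[of "(\<beta> ^^ j) (\<alpha> base)"] z[of "(\<beta> ^^ j) (\<alpha>i base)"]
    by (subst on_arm_pow_iff) (auto simp: zeros_def)
  moreover have "(\<alpha> ^^ Suc m) base \<notin> \<omega>" "(\<beta> ^^ Suc n) base \<notin> \<omega>"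
    by (rule z, simp add: zeros_def)+
  ultimately show "shape m n \<omega>" unfolding shape_def by blast
qed

end

section \<open>Operators that come from the rational group ring\<close>

context group
begin

text \<open>Agreement is required only on functions vanishing outside the carrier, where
  \<open>left_regular G \<one>\<close> is the identity.\<close>

definition ring_op :: "(('a \<Rightarrow> complex) \<Rightarrow> 'a \<Rightarrow> complex) \<Rightarrow> bool" where
  "ring_op T \<longleftrightarrow> (\<exists>Q\<in>rat_group_ring G. \<forall>f. (\<forall>x. x \<notin> carrier G \<longrightarrow> f x = 0) \<longrightarrow> left_regular_ring G Q f = T f)"

lemma left_regular_ring_superset:
  assumes "finite S" "{g. Q g \<noteq> 0} \<subseteq> S"
  shows "left_regular_ring G Q f x = (\<Sum>g\<in>S. of_rat (Q g) * left_regular G g f x)"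
  unfolding left_regular_ring_def by (rule sum.mono_neutral_left) (use assms in auto)

lemma ring_op_left_regular:
  assumes "h \<in> carrier G"
  shows "ring_op (left_regular G h)"
proof -
  define Q where "Q g = (if g = h then 1 else 0 :: rat)" for g
  have "Q \<in> rat_group_ring G" using assms by (auto simp: rat_group_ring_def Q_def)
  moreover have "left_regular_ring G Q f = left_regular G h f" for f
    by (rule ext, subst left_regular_ring_superset[of "{h}"]) (auto simp: Q_def)
  ultimately show ?thesis unfolding ring_op_def by blast
qed

lemma ring_op_add:
  assumes "ring_op T" "ring_op S"
  shows "ring_op (\<lambda>f. T f + S f)"
proof -
  obtain Q R where Q: "Q \<in> rat_group_ring G" "\<And>f. (\<forall>x. x \<notin> carrier G \<longrightarrow> f x = 0) \<Longrightarrow> left_regular_ring G Q f = T f"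
    and R: "R \<in> rat_group_ring G" "\<And>f. (\<forall>x. x \<notin> carrier G \<longrightarrow> f x = 0) \<Longrightarrow> left_regular_ring G R f = S f"
    using assms unfolding ring_op_def by blast
  let ?S = "{g. Q g \<noteq> 0} \<union> {g. R g \<noteq> 0}"
  have fin: "finite ?S" using Q(1) R(1) by (simp add: rat_group_ring_def)
  have sub: "{g. Q g + R g \<noteq> 0} \<subseteq> ?S" by auto
  have "(\<lambda>g. Q g + R g) \<in> rat_group_ring G"
    using Q(1) R(1) finite_subset[OF sub fin] sub by (auto simp: rat_group_ring_def)
  moreover have "left_regular_ring G (\<lambda>g. Q g + R g) f = T f + S f" if "\<forall>x. x \<notin> carrier G \<longrightarrow> f x = 0" for f
  proof
    fix x
    have "left_regular_ring G (\<lambda>g. Q g + R g) f x = left_regular_ring G Q f x + left_regular_ring G R f x"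
      using fin sub
      by (subst (1 2 3) left_regular_ring_superset[of ?S]) (auto simp: of_rat_add distrib_right sum.distrib)
    then show "left_regular_ring G (\<lambda>g. Q g + R g) f x = (T f + S f) x"
      using Q(2) R(2) that by simp
  qed
  ultimately show ?thesis unfolding ring_op_def by blast
qed

lemma ring_op_scale:
  assumes "ring_op T"
  shows "ring_op (\<lambda>f. scale_fun (of_rat q) (T f))"
proof -
  obtain Q where Q: "Q \<in> rat_group_ring G" "\<And>f. (\<forall>x. x \<notin> carrier G \<longrightarrow> f x = 0) \<Longrightarrow> left_regular_ring G Q f = T f"
    using assms unfolding ring_op_def by blast
  let ?S = "{g. Q g \<noteq> 0}"
  have fin: "finite ?S" using Q(1) by (simp add: rat_group_ring_def)
  have sub: "{g. q * Q g \<noteq> 0} \<subseteq> ?S" by auto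
  have "(\<lambda>g. q * Q g) \<in> rat_group_ring G"
    using Q(1) finite_subset[OF sub fin] sub by (auto simp: rat_group_ring_def)
  moreover have "left_regular_ring G (\<lambda>g. q * Q g) f = scale_fun (of_rat q) (T f)"
    if "\<forall>x. x \<notin> carrier G \<longrightarrow> f x = 0" for f
  proof
    fix x
    have "left_regular_ring G (\<lambda>g. q * Q g) f x = of_rat q * left_regular_ring G Q f x"
      using fin sub
      by (subst (1 2) left_regular_ring_superset[of ?S]) (auto simp: of_rat_mult sum_distrib_left mult.assoc)
    then show "left_regular_ring G (\<lambda>g. q * Q g) f x = scale_fun (of_rat q) (T f) x"
      using Q(2) that by simp
  qed
  ultimately show ?thesis unfolding ring_op_def by blast
qed

lemma ring_op_zero: "ring_op (\<lambda>f. 0)"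
proof -
  have "(\<lambda>_. 0) \<in> rat_group_ring G" by (simp add: rat_group_ring_def)
  moreover have "left_regular_ring G (\<lambda>_. 0) f = 0" for f
    by (rule ext) (simp add: left_regular_ring_def)
  ultimately show ?thesis unfolding ring_op_def by blast
qed

lemma ring_op_sum:
  assumes "finite I" "\<And>i. i \<in> I \<Longrightarrow> ring_op (T i)"
  shows "ring_op (\<lambda>f. \<Sum>i\<in>I. T i f)"
  using assms
proof (induction I)
  case empty
  then show ?case using ring_op_zero by (simp only: sum.empty)
next
  case (insert i I)
  have "ring_op (\<lambda>f. T i f + (\<Sum>i\<in>I. T i f))"
    by (rule ring_op_add) (use insert in auto)
  then show ?case by (simp only: sum.insert[OF insert.hyps])
qed

lemma ring_op_cong:
  assumes "ring_op T" "\<And>f. (\<forall>x. x \<notin> carrier G \<longrightarrow> f x = 0) \<Longrightarrow> T f = S f"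
  shows "ring_op S"
  using assms unfolding ring_op_def by metis

end

section \<open>Rationality, null events and traces\<close>

context lamps
begin

text \<open>The Fourier coefficients are signs divided by powers of two, hence rational.\<close>

lemma ring_op_op:
  assumes "finitary P" "g \<in> carrier G" "h \<in> carrier G"
  shows "ring_op (\<lambda>f. L h (op P (L g f)))"
proof -
  obtain T where T: "finite T" "T \<subseteq> Y" "depends_on T P"
    using assms(1) by (auto simp: finitary_def)
  have sA: "s A \<in> carrier G" if "A \<in> Pow T" for A
    using that T finite_subset by (intro s_closed) auto
  have *: "ring_op (\<lambda>f. \<Sum>B | B \<subseteq> T \<and> P B. scale_fun (of_rat (1 / 2 ^ card T))
      (\<Sum>A\<in>Pow T. scale_fun (of_rat ((-1) ^ card (A \<inter> B))) (L (h \<otimes> s A \<otimes> g) f)))"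
    using T(1) assms(2,3) sA
    by (intro ring_op_sum ring_op_scale ring_op_left_regular m_closed) auto
  show ?thesis
  proof (rule ring_op_cong[OF *])
    fix f :: "'g \<Rightarrow> complex"
    have "L h (op P (L g f)) = (\<Sum>B | B \<subseteq> T \<and> P B. scale_fun (1 / 2 ^ card T)
      (\<Sum>A\<in>Pow T. scale_fun ((-1) ^ card (A \<inter> B)) (L (h \<otimes> s A \<otimes> g) f)))"
      unfolding op_eq_op_on[OF T] op_on_def prj_def left_regular_sum L_scale
    proof (intro sum.cong refl arg_cong[where f = "scale_fun _"])
      fix A assume "A \<in> Pow T"
      then show "L h (L (s A) (L g f)) = L (h \<otimes> s A \<otimes> g) f"
        using sA assms(2,3) by (simp add: left_regular_left_regular m_assoc)
    qed
    then show "(\<Sum>B | B \<subseteq> T \<and> P B. scale_fun (of_rat (1 / 2 ^ card T))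
      (\<Sum>A\<in>Pow T. scale_fun (of_rat ((-1) ^ card (A \<inter> B))) (L (h \<otimes> s A \<otimes> g) f))) = L h (op P (L g f))"
      by (simp add: of_rat_divide of_rat_power of_rat_minus)
  qed
qed

lemma op_null_mono:
  assumes "finitary P" "finitary Q" "op Q f = 0" "\<And>\<omega>. P \<omega> \<Longrightarrow> Q \<omega>"
  shows "op P f = 0"
  using op_mono[OF assms(1,2,4), of f] assms(3) by simp

lemma op_null_disj:
  assumes "finitary P" "finitary Q" "op P f = 0" "op Q f = 0"
  shows "op (\<lambda>\<omega>. P \<omega> \<or> Q \<omega>) f = 0"
proof -
  have l: "finitary (\<lambda>\<omega>. Q \<omega> \<and> \<not> P \<omega>)" by (intro finitary_intros assms)
  have e: "(\<lambda>\<omega>. P \<omega> \<or> Q \<omega>) = (\<lambda>\<omega>. P \<omega> \<or> (Q \<omega> \<and> \<not> P \<omega>))" by blast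
  have "op (\<lambda>\<omega>. P \<omega> \<or> Q \<omega>) f = op P f + op (\<lambda>\<omega>. Q \<omega> \<and> \<not> P \<omega>) f"
    unfolding e by (rule op_disjoint[OF assms(1) l]) blast
  also have "op (\<lambda>\<omega>. Q \<omega> \<and> \<not> P \<omega>) f = 0"
    by (rule op_null_mono[OF l assms(2,4)]) blast
  finally show ?thesis unfolding assms(3) by (simp only: add_0)
qed

lemma tendsto_L: "(\<And>x. (\<lambda>n. q n x) \<longlonglongrightarrow> p x) \<Longrightarrow> (\<lambda>n. L g (q n) x) \<longlonglongrightarrow> L g p x"
  by (simp add: left_regular_def)

lemma tendsto_op: "(\<And>x. (\<lambda>n. q n x) \<longlonglongrightarrow> p x) \<Longrightarrow> (\<lambda>n. op P (q n) x) \<longlonglongrightarrow> op P p x"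
  unfolding op_def op_on_def sum_fun_apply prj_apply by (intro tendsto_intros tendsto_L) auto

text \<open>At \<open>h\<close> the translates by nonempty \<open>A\<close> vanish, so only the
  trivial Fourier coefficient contributes. It is the proportion of patterns on \<open>T\<close>
  satisfying \<open>P\<close>.\<close>

lemma op_delta:
  assumes T: "finite T" "T \<subseteq> Y" "depends_on T P" and g: "g \<in> carrier G"
    and free: "\<And>A. finite A \<Longrightarrow> A \<subseteq> Y \<Longrightarrow> s A \<otimes> g = h \<Longrightarrow> A = {}"
  shows "op P (ell2_delta g) h = of_bool (g = h) * complex_of_real (cylinder_prob T P)"
proof -
  have "prj T B (ell2_delta g) h = of_bool (g = h) / 2 ^ card T" for B
  proof -
    have "(-1) ^ card (A \<inter> B) * L (s A) (ell2_delta g) h = (if A = {} then of_bool (g = h) else 0 :: complex)"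
      if A: "A \<in> Pow T" for A
    proof -
      have "finite A" "A \<subseteq> Y" using A T finite_subset by auto
      then show ?thesis using free[of A] g
        by (auto simp: left_regular_delta s_closed ell2_delta_def s_empty)
    qed
    then have "(\<Sum>A\<in>Pow T. (-1) ^ card (A \<inter> B) * L (s A) (ell2_delta g) h) =
        (\<Sum>A\<in>Pow T. if A = {} then of_bool (g = h) else 0 :: complex)"
      by (rule sum.cong[OF refl])
    then show ?thesis
      using T(1) by (simp add: prj_apply)
  qed
  then show ?thesis
    using T by (simp add: op_eq_op_on op_on_def sum_fun_apply cylinder_prob_def)
qed

lemma ell2_norm_op_delta:
  assumes T: "finite T" "T \<subseteq> Y" "depends_on T P" and g: "g \<in> carrier G"
  shows "ell2_norm G (op P (ell2_delta g)) = sqrt (cylinder_prob T P)"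
proof -
  have loc: "finitary P" using T by (auto simp: finitary_def)
  let ?d = "ell2_delta g :: 'g \<Rightarrow> complex"
  have free: "A = {}" if "finite A" "A \<subseteq> Y" "s A \<otimes> g = g" for A
    using that g s_eq_one[of A] s_closed[of A] by simp
  have d: "?d \<in> ell2 G" "op P ?d \<in> ell2 G" using g by (simp_all add: ell2_delta ell2_op loc)
  have "complex_of_real ((ell2_norm G (op P ?d))\<^sup>2) = ell2_inner G (op P ?d) (op P ?d)"
    by (simp only: ell2_inner_self[OF d(2)])
  also have "\<dots> = ell2_inner G (op P (op P ?d)) ?d"
    using loc d by (simp add: op_selfadjoint)
  also have "\<dots> = complex_of_real (cylinder_prob T P)"
    using T loc g op_delta[OF T g free] by (simp add: op_op ell2_inner_delta)
  finally have "(ell2_norm G (op P ?d))\<^sup>2 = cylinder_prob T P"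
    using of_real_eq_iff by blast
  then show ?thesis by (metis real_sqrt_unique ell2_norm_nonneg)
qed

text \<open>Self-adjointness moves the event onto the delta function, whose image has norm the
  square root of the probability. This later makes the contribution of unlikely events vanish in the
  limit.\<close>

lemma op_at_one_le:
  assumes T: "finite T" "T \<subseteq> Y" "depends_on T P" and f: "f \<in> ell2 G"
  shows "cmod (op P f \<one>) \<le> ell2_norm G f * sqrt (cylinder_prob T P)"
proof -
  have loc: "finitary P" using T by (auto simp: finitary_def)
  have d: "ell2_delta \<one> \<in> ell2 G" by (simp add: ell2_delta)
  have "op P f \<one> = ell2_inner G f (op P (ell2_delta \<one>))"
    using op_selfadjoint[OF loc f d] by (simp add: ell2_inner_delta)
  then show ?thesis
    using ell2_Cauchy_Schwarz[OF f ell2_op[OF loc d]] ell2_norm_op_delta[OF T one_closed] by simp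
qed

text \<open>Both numbers are the value at \<open>\<one>\<close> of the same function
  \<open>op P (ell2_delta \<one>)\<close>.\<close>

lemma cylinder_prob_indep:
  assumes "finite T" "T \<subseteq> Y" "depends_on T P" "finite T'" "T' \<subseteq> Y" "depends_on T' P"
  shows "cylinder_prob T P = cylinder_prob T' P"
proof -
  have "complex_of_real (cylinder_prob T P) = complex_of_real (cylinder_prob T' P)"
    using op_delta[OF assms(1-3) one_closed, of \<one>] op_delta[OF assms(4-6) one_closed, of \<one>]
      s_eq_one s_closed by simp
  then show ?thesis by (simp only: of_real_eq_iff)
qed

end

section \<open>The kernel operator\<close>

locale walk_lamps = lamps G s Y + walk \<alpha> \<alpha>i \<beta> \<beta>i base
  for G :: "('g, 'm) monoid_scheme" (structure) and s :: "'x set \<Rightarrow> 'g" and Y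
    and \<alpha> \<alpha>i \<beta> \<beta>i :: "'x \<Rightarrow> 'x" and base :: 'x +
  fixes a b :: 'g
  assumes impl_a: "implements a \<alpha> \<alpha>i" and impl_b: "implements b \<beta> \<beta>i" and base_Y: "base \<in> Y"
begin

lemma walk_lamps_swap: "walk_lamps G s Y \<beta> \<beta>i \<alpha> \<alpha>i base b a"
  by (intro walk_lamps.intro lamps_axioms walk_swap walk_lamps_axioms.intro impl_a impl_b base_Y)

definition arm_elt :: "int \<Rightarrow> 'g" where
  "arm_elt z = (if 0 \<le> z then a [^] nat z else b [^] nat (-z))"

lemma arm_elt_swap: "walk_lamps.arm_elt G b a z = arm_elt (- z)"
  by (cases "z = 0") (simp_all add: walk_lamps.arm_elt_def[OF walk_lamps_swap] arm_elt_def)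

lemma a_closed: "a \<in> carrier G" and b_closed: "b \<in> carrier G"
  using implementsD(1)[OF impl_a] implementsD(1)[OF impl_b] by auto

lemma arm_elt_closed: "arm_elt z \<in> carrier G"
  by (simp add: arm_elt_def a_closed b_closed)

lemma implements_arm_elt: "implements (arm_elt z) (pos z) (neg z)"
proof (cases "0 \<le> z")
  case True
  show ?thesis
    unfolding arm_elt_def pos_def neg_def if_P[OF True] by (rule implements_pow[OF impl_a])
next
  case False
  show ?thesis
    unfolding arm_elt_def pos_def neg_def if_not_P[OF False] by (rule implements_pow[OF impl_b])
qed

lemmas implements_arm_elt_inv = implements_inv[OF implements_arm_elt]

lemma arm_elt_shift:
  assumes "1 \<le> z"
  shows "a \<otimes> inv (arm_elt z) = inv (arm_elt (z - 1))"
proof -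
  have "nat z = Suc (nat (z - 1))" using assms by simp
  then have "arm_elt z = arm_elt (z - 1) \<otimes> a"
    using assms by (simp add: arm_elt_def)
  then show ?thesis
    using a_closed arm_elt_closed[of "z - 1"] by (simp add: inv_mult_group flip: m_assoc)
qed

lemma in_Y: "\<alpha> x \<in> Y" "\<alpha>i x \<in> Y" "\<beta> x \<in> Y" "\<beta>i x \<in> Y" "neg z x \<in> Y"
  "(\<alpha> ^^ n) x \<in> Y" "(\<beta> ^^ n) x \<in> Y" if "x \<in> Y"
  by (rule implementsD(4)[OF impl_a that] implementsD(5)[OF impl_a that]
    implementsD(4)[OF impl_b that] implementsD(5)[OF impl_b that] implementsD(5)[OF implements_arm_elt that]
    implementsD(4)[OF implements_pow[OF impl_a] that] implementsD(4)[OF implements_pow[OF impl_b] that])+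

lemma finitary_corner: "finitary corner"
  unfolding corner_def[abs_def] by (intro finitary_intros in_Y base_Y)

lemma finitary_on_arm: "finitary on_arm"
  unfolding on_arm_def[abs_def] by (intro finitary_intros in_Y base_Y)

lemma finitary_on_arm': "finitary on_arm'"
  unfolding on_arm'_def[abs_def] by (intro finitary_intros in_Y base_Y)

lemma finitary_good: "finitary good"
  unfolding good_def[abs_def] by (intro finitary_disj finitary_corner finitary_on_arm finitary_on_arm')

lemma finitary_edge: "p base \<in> Y \<Longrightarrow> finitary (edge p)"
  unfolding edge_def[abs_def] by (intro finitary_intros base_Y)

lemma finitary_shape: "finitary (shape m n)"
  unfolding shape_def[abs_def]
  by (intro finitary_conj finitary_not finitary_ball finitary_mem finitary_corner in_Y base_Y finite_atLeastAtMost
      finitary_vimage[OF finitary_on_arm implements_pow[OF impl_a]] finitary_vimage[OF finitary_on_arm' implements_pow[OF impl_b]])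

lemma finitary_shape_at: "finitary (\<lambda>\<omega>. shape m n (neg z -` \<omega>))"
  by (rule finitary_vimage[OF finitary_shape implements_arm_elt_inv])

lemma finitary_explored: "finitary (explored r)"
proof (induction r)
  case 0
  show ?case unfolding explored.simps(1)[abs_def] by (rule finitary_good)
next
  case (Suc r)
  have v: "finitary (\<lambda>\<omega>. explored r (p -` \<omega>))" if "p \<in> {\<alpha>, \<alpha>i, \<beta>, \<beta>i}" for p
    using that finitary_vimage[OF Suc impl_a] finitary_vimage[OF Suc impl_b]
      finitary_vimage[OF Suc implements_inv[OF impl_a]] finitary_vimage[OF Suc implements_inv[OF impl_b]]
    by blast
  have pY: "p base \<in> Y" if "p \<in> {\<alpha>, \<alpha>i, \<beta>, \<beta>i}" for p using that in_Y base_Y by blast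
  have "finitary (\<lambda>\<omega>. \<forall>p\<in>{\<alpha>, \<alpha>i, \<beta>, \<beta>i}. base \<in> \<omega> \<and> p base \<in> \<omega> \<longrightarrow> explored r (p -` \<omega>))"
    by (rule finitary_ball) (simp, intro finitary_imp finitary_conj finitary_mem base_Y pY v)
  from finitary_conj[OF Suc this] show ?case unfolding explored.simps(2)[abs_def] .
qed

lemma finitary_far: "finitary (far M)"
  unfolding far_def[abs_def]
proof (rule finitary_bex[OF finite_atLeastAtMost_int])
  fix z
  have "finitary (\<lambda>\<omega>. \<forall>k\<in>{..M}. neg z ((p ^^ k) base) \<in> \<omega>)" if "p = \<alpha> \<or> p = \<beta>" for p
  proof (rule finitary_ball[OF finite_atMost], rule finitary_mem, rule in_Y(5))
    show "(p ^^ k) base \<in> Y" for k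
      using that in_Y(6,7)[OF base_Y, of k] by blast
  qed
  then show "finitary (\<lambda>\<omega>. (\<forall>k\<in>{..M}. neg z ((\<alpha> ^^ k) base) \<in> \<omega>) \<or>
      (\<forall>k\<in>{..M}. neg z ((\<beta> ^^ k) base) \<in> \<omega>))"
    by (intro finitary_disj) simp_all
qed

text \<open>Each condition involves finitely many bits and at most one translation by a generator,
  so a single group ring element can enforce all three.\<close>

definition kern :: "('g \<Rightarrow> complex) set" where
  "kern = {f \<in> ell2 G. op (\<lambda>\<omega>. \<not> good \<omega>) f = 0 \<and>
     op (edge \<alpha>) f = op (edge \<alpha>) (L a f) \<and> op (edge \<beta>) f = op (edge \<beta>) (L b f)}"

lemma kern_swap: "walk_lamps.kern G s Y \<beta> \<beta>i \<alpha> \<alpha>i base b a = kern"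
  unfolding walk_lamps.kern_def[OF walk_lamps_swap] kern_def swap_simps
  by (rule Collect_cong, rule iffI; elim conjE; intro conjI; assumption)

lemma kernD:
  assumes "f \<in> kern"
  shows "f \<in> ell2 G" "op (\<lambda>\<omega>. \<not> good \<omega>) f = 0"
    "op (edge \<alpha>) f = op (edge \<alpha>) (L a f)" "op (edge \<beta>) f = op (edge \<beta>) (L b f)"
  using assms by (auto simp: kern_def)

text \<open>A graph Laplacian: its quadratic form is \<open>\<parallel>op (edge p) (f - L g f)\<parallel>\<^sup>2\<close>.\<close>

definition laplace :: "'g \<Rightarrow> ('x \<Rightarrow> 'x) \<Rightarrow> ('g \<Rightarrow> complex) \<Rightarrow> 'g \<Rightarrow> complex" where
  "laplace g p f = op (edge p) (f - L g f) - L (inv g) (op (edge p) (f - L g f))"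

definition kern_op :: "('g \<Rightarrow> complex) \<Rightarrow> 'g \<Rightarrow> complex" where
  "kern_op f = op (\<lambda>\<omega>. \<not> good \<omega>) f + laplace a \<alpha> f + laplace b \<beta> f"

lemma op_energy:
  assumes "finitary P" "f \<in> ell2 G"
  shows "ell2_inner G (op P f) f = complex_of_real ((ell2_norm G (op P f))\<^sup>2)"
proof -
  have "ell2_inner G (op P f) f = ell2_inner G (op P (op P f)) f"
    using assms by (simp add: op_op)
  also have "\<dots> = ell2_inner G (op P f) (op P f)"
    by (rule op_selfadjoint[OF assms(1) ell2_op[OF assms] assms(2)])
  finally show ?thesis by (simp add: ell2_inner_self ell2_op assms)
qed

lemma laplace_energy:
  assumes P: "finitary (edge p)" and g: "g \<in> carrier G" and f: "f \<in> ell2 G"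
  shows "ell2_inner G (laplace g p f) f = complex_of_real ((ell2_norm G (op (edge p) (f - L g f)))\<^sup>2)"
proof -
  let ?d = "f - L g f" and ?e = "op (edge p) (f - L g f)"
  have d: "?d \<in> ell2 G" "?e \<in> ell2 G" "L g f \<in> ell2 G" "L (inv g) ?e \<in> ell2 G"
    using assms by (auto intro!: ell2_diff ell2_op ell2_left_regular)
  have "ell2_inner G (laplace g p f) f = ell2_inner G ?e f - ell2_inner G ?e (L g f)"
    unfolding laplace_def using d f g by (simp add: ell2_inner_diff_left ell2_inner_left_regular)
  also have "\<dots> = cnj (ell2_inner G f ?e - ell2_inner G (L g f) ?e)"
    by (simp add: ell2_inner_cnj[of G f] ell2_inner_cnj[of G "L g f"])
  also have "\<dots> = ell2_inner G ?e ?d"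
    using d f by (subst ell2_inner_diff_left[symmetric]) (auto simp: ell2_inner_cnj[of G ?d])
  finally show ?thesis using op_energy[OF P d(1)] by simp
qed

text \<open>The three summands of \<open>kern_op\<close> are positive: the inner product of
  \<open>kern_op f\<close> with \<open>f\<close> is a sum of three squared norms, which vanishes
  only if each of them does.\<close>

lemma kern_op_eq_0_iff:
  assumes f: "f \<in> ell2 G"
  shows "kern_op f = 0 \<longleftrightarrow> f \<in> kern"
proof
  have loc: "finitary (\<lambda>\<omega>. \<not> good \<omega>)" "finitary (edge \<alpha>)" "finitary (edge \<beta>)"
    by (intro finitary_not finitary_good finitary_edge in_Y base_Y)+
  have lap: "laplace a \<alpha> f \<in> ell2 G" "laplace b \<beta> f \<in> ell2 G" "op (\<lambda>\<omega>. \<not> good \<omega>) f \<in> ell2 G"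
    unfolding laplace_def using f loc a_closed b_closed
    by (auto intro!: ell2_diff ell2_op ell2_left_regular)
  {
    assume "kern_op f = 0"
    then have "ell2_inner G (kern_op f) f = 0" by (simp add: ell2_inner_zero_left)
    moreover have "ell2_inner G (kern_op f) f = ell2_inner G (op (\<lambda>\<omega>. \<not> good \<omega>) f) f +
        ell2_inner G (laplace a \<alpha> f) f + ell2_inner G (laplace b \<beta> f) f"
      unfolding kern_op_def using f lap by (simp add: ell2_inner_add_left ell2_add)
    ultimately have "complex_of_real ((ell2_norm G (op (\<lambda>\<omega>. \<not> good \<omega>) f))\<^sup>2 +
        (ell2_norm G (op (edge \<alpha>) (f - L a f)))\<^sup>2 + (ell2_norm G (op (edge \<beta>) (f - L b f)))\<^sup>2) = 0"
      using f loc a_closed b_closed by (simp add: op_energy laplace_energy)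
    then have "(ell2_norm G (op (\<lambda>\<omega>. \<not> good \<omega>) f))\<^sup>2 + (ell2_norm G (op (edge \<alpha>) (f - L a f)))\<^sup>2 +
        (ell2_norm G (op (edge \<beta>) (f - L b f)))\<^sup>2 = 0"
      by (simp only: of_real_eq_0_iff)
    then have "ell2_norm G (op (\<lambda>\<omega>. \<not> good \<omega>) f) = 0" "ell2_norm G (op (edge \<alpha>) (f - L a f)) = 0"
      "ell2_norm G (op (edge \<beta>) (f - L b f)) = 0"
      by (smt (verit) zero_le_power2 power2_eq_iff zero_power2)+
    moreover have "op (edge \<alpha>) (f - L a f) \<in> ell2 G" "op (edge \<beta>) (f - L b f) \<in> ell2 G"
      using f loc a_closed b_closed by (auto intro!: ell2_diff ell2_op ell2_left_regular)
    ultimately have "op (\<lambda>\<omega>. \<not> good \<omega>) f = 0" "op (edge \<alpha>) (f - L a f) = 0" "op (edge \<beta>) (f - L b f) = 0"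
      using lap by (blast intro: ell2_norm_eq_0)+
    then show "f \<in> kern" using f by (simp add: kern_def op_diff)
  }
  assume "f \<in> kern"
  then have k: "op (\<lambda>\<omega>. \<not> good \<omega>) f = 0" "op (edge \<alpha>) (f - L a f) = 0" "op (edge \<beta>) (f - L b f) = 0"
    by (simp_all add: kern_def op_diff)
  have "L g 0 = 0" for g by (rule ext) (simp add: left_regular_def)
  then show "kern_op f = 0"
    unfolding kern_op_def laplace_def k by simp
qed

lemma ring_op_kern_op: "ring_op kern_op"
proof -
  have loc: "finitary (\<lambda>\<omega>. \<not> good \<omega>)" "finitary (edge \<alpha>)" "finitary (edge \<beta>)"
    by (intro finitary_not finitary_good finitary_edge in_Y base_Y)+
  have L1: "L \<one> f = f" if "\<forall>x. x \<notin> carrier G \<longrightarrow> f x = 0" for f :: "'g \<Rightarrow> complex"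
    using that by (intro left_regular_one) simp
  have L1op: "L \<one> (op P f) = op P f" for P f
    by (rule left_regular_one) (rule op_outside)
  have minus: "ring_op (\<lambda>f. T f - S f)" if "ring_op T" "ring_op S"
    for T S :: "('g \<Rightarrow> complex) \<Rightarrow> 'g \<Rightarrow> complex"
  proof -
    have "T f + scale_fun (of_rat (-1)) (S f) = T f - S f" for f by (rule ext) (simp add: of_rat_minus)
    then show ?thesis using ring_op_add[OF that(1) ring_op_scale[OF that(2), of "-1"]] by simp
  qed
  have lap: "ring_op (laplace g p)" if "finitary (edge p)" "g \<in> carrier G" for g p
  proof -
    \<comment> \<open>The factors \<open>L \<one>\<close> bring each of the four summands into the
      form treated by \<open>ring_op_op\<close>.\<close>
    have "ring_op (\<lambda>f. (L \<one> (op (edge p) (L \<one> f)) - L \<one> (op (edge p) (L g f))) -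
        (L (inv g) (op (edge p) (L \<one> f)) - L (inv g) (op (edge p) (L g f))))"
      using that by (intro minus ring_op_op) auto
    then show ?thesis
      by (rule ring_op_cong) (simp add: laplace_def op_diff left_regular_diff L1 L1op)
  qed
  have "ring_op (\<lambda>f. L \<one> (op (\<lambda>\<omega>. \<not> good \<omega>) (L \<one> f)))"
    using loc by (intro ring_op_op) auto
  then have "ring_op (op (\<lambda>\<omega>. \<not> good \<omega>))"
    by (rule ring_op_cong) (simp add: L1 L1op)
  then show ?thesis
    unfolding kern_op_def[abs_def] using lap loc a_closed b_closed by (intro ring_op_add) auto
qed

lemma kern_eq_ell2_kernel:
  obtains Q where "Q \<in> rat_group_ring G" "ell2_kernel G Q = kern"
proof -
  obtain Q where Q: "Q \<in> rat_group_ring G"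
    "\<And>f. (\<forall>x. x \<notin> carrier G \<longrightarrow> f x = 0) \<Longrightarrow> left_regular_ring G Q f = kern_op f"
    using ring_op_kern_op unfolding ring_op_def by blast
  have "f \<in> ell2_kernel G Q \<longleftrightarrow> f \<in> kern" for f
  proof (cases "f \<in> ell2 G")
    case True
    then have "\<forall>x. x \<notin> carrier G \<longrightarrow> f x = 0" by (simp add: ell2_outside)
    then show ?thesis
      using True Q(2)[of f] kern_op_eq_0_iff[OF True] by (simp add: ell2_kernel_def zero_fun_def)
  qed (auto simp: ell2_kernel_def kern_def)
  then have "ell2_kernel G Q = kern" by blast
  with Q(1) show ?thesis by (rule that)
qed

lemma kern_diff: "f \<in> kern \<Longrightarrow> h \<in> kern \<Longrightarrow> f - h \<in> kern"
  by (simp add: kern_def ell2_diff op_diff left_regular_diff)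

lemma kern_add: "f \<in> kern \<Longrightarrow> h \<in> kern \<Longrightarrow> f + h \<in> kern"
  by (simp add: kern_def ell2_add op_add left_regular_add)

lemma kern_scale: "f \<in> kern \<Longrightarrow> scale_fun c f \<in> kern"
proof -
  have "scale_fun c 0 = (0 :: 'g \<Rightarrow> complex)" by (rule ext) simp
  then show "f \<in> kern \<Longrightarrow> scale_fun c f \<in> kern"
    by (simp add: kern_def ell2_scale op_scale left_regular_scale)
qed

lemma kern_zero: "0 \<in> kern"
proof -
  have "L g 0 = 0" for g by (rule ext) (simp add: left_regular_def)
  then show ?thesis by (simp add: kern_def ell2_zero)
qed

lemma kern_sum: "(\<And>i. i \<in> I \<Longrightarrow> F i \<in> kern) \<Longrightarrow> (\<Sum>i\<in>I. F i) \<in> kern"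
  by (induction I rule: infinite_finite_induct) (auto intro: kern_add kern_zero)

lemma kern_closed:
  assumes "\<And>n. q n \<in> kern" "\<And>x. (\<lambda>n. q n x) \<longlonglongrightarrow> p x" "p \<in> ell2 G"
  shows "p \<in> kern"
proof -
  have "op P p = 0" if "\<And>n. op P (q n) = 0" for P
  proof
    fix x
    have "(\<lambda>n. op P (q n) x) \<longlonglongrightarrow> op P p x" by (rule tendsto_op[OF assms(2)])
    then show "op P p x = 0 x" using that LIMSEQ_unique[OF _ tendsto_const] by simp
  qed
  moreover have "op P p = op P (L g p)" if "\<And>n. op P (q n) = op P (L g (q n))" for P g
  proof
    fix x
    have "(\<lambda>n. op P (q n) x) \<longlonglongrightarrow> op P p x" by (rule tendsto_op[OF assms(2)])
    moreover have "(\<lambda>n. op P (q n) x) \<longlonglongrightarrow> op P (L g p) x"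
      unfolding that by (rule tendsto_op[OF tendsto_L[OF assms(2)]])
    ultimately show "op P p x = op P (L g p) x" by (rule LIMSEQ_unique)
  qed
  ultimately show ?thesis using assms kernD[OF assms(1)] by (simp add: kern_def)
qed

end

section \<open>The projection onto the kernel\<close>

context walk_lamps
begin

lemma finitary_edge_\<alpha>: "finitary (edge \<alpha>)"
  by (rule finitary_edge) (rule in_Y(1)[OF base_Y])

text \<open>Composed with \<open>L (arm_elt t)\<close>, these operators are matrix units indexed by
  the vertices \<open>z\<close> and \<open>t\<close> of the L-shape: they move the component at
  vertex \<open>t\<close> to vertex \<open>z\<close>.\<close>

definition arm_term :: "nat \<Rightarrow> nat \<Rightarrow> int \<Rightarrow> ('g \<Rightarrow> complex) \<Rightarrow> 'g \<Rightarrow> complex" where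
  "arm_term m n z h = L (inv (arm_elt z)) (op (shape m n) h)"

definition arm_sum :: "nat \<Rightarrow> nat \<Rightarrow> ('g \<Rightarrow> complex) \<Rightarrow> 'g \<Rightarrow> complex" where
  "arm_sum m n h = (\<Sum>z\<in>{- int n..int m}. arm_term m n z h)"

lemma arm_term_alt:
  "arm_term m n z h = op (\<lambda>\<omega>. shape m n (neg z -` \<omega>)) (L (inv (arm_elt z)) h)"
  unfolding arm_term_def by (rule L_op[OF finitary_shape implements_arm_elt_inv])

lemma arm_term_swap:
  "walk_lamps.arm_term G s Y \<beta> \<beta>i \<alpha> \<alpha>i base b a n m z h = arm_term m n (- z) h"
  unfolding walk_lamps.arm_term_def[OF walk_lamps_swap] arm_term_def arm_elt_swap swap_simps ..

lemma arm_sum_swap: "walk_lamps.arm_sum G s Y \<beta> \<beta>i \<alpha> \<alpha>i base b a n m h = arm_sum m n h"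
  unfolding walk_lamps.arm_sum_def[OF walk_lamps_swap] arm_sum_def arm_term_swap
  by (rule sum.reindex_bij_witness[where i = uminus and j = uminus]) auto

lemma ell2_arm_term: "h \<in> ell2 G \<Longrightarrow> arm_term m n z h \<in> ell2 G"
  unfolding arm_term_def by (intro ell2_left_regular ell2_op finitary_shape inv_closed arm_elt_closed)

text \<open>By \<open>shape_next\<close> the edge towards \<open>\<alpha> base\<close> lies in the
  cluster exactly when the base is a vertex with \<open>0 \<le> z < m\<close>.\<close>

lemma edge_arm_term:
  assumes z: "- int n \<le> z" "z \<le> int m"
  shows "op (edge \<alpha>) (arm_term m n z h) = (if 0 \<le> z \<and> z < int m then arm_term m n z h else 0)"
proof -
  have "op (edge \<alpha>) (arm_term m n z h) =
      op (\<lambda>\<omega>. edge \<alpha> \<omega> \<and> shape m n (neg z -` \<omega>)) (L (inv (arm_elt z)) h)"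
    unfolding arm_term_alt by (rule op_op[OF finitary_edge_\<alpha> finitary_shape_at])
  moreover have "edge \<alpha> \<omega> \<and> shape m n (neg z -` \<omega>) \<longleftrightarrow>
      (if 0 \<le> z \<and> z < int m then shape m n (neg z -` \<omega>) else False)" for \<omega>
    using shape_next[of m n z \<omega>] shape_good[of m n z \<omega>] z
    by (auto simp: edge_def good_def corner_def on_arm_def on_arm'_def)
  ultimately show ?thesis
    by (simp add: arm_term_alt op_False)
qed

lemma edge_L_arm_term:
  assumes z: "- int n \<le> z" "z \<le> int m"
  shows "op (edge \<alpha>) (L a (arm_term m n z h)) = (if 1 \<le> z then arm_term m n (z - 1) h else 0)"
proof (cases "1 \<le> z")
  case True
  have "L a (arm_term m n z h) = arm_term m n (z - 1) h"
    using True a_closed arm_elt_closed[of z]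
    by (simp add: arm_term_def left_regular_left_regular arm_elt_shift)
  then show ?thesis using True z edge_arm_term[of n "z - 1" m h] by simp
next
  case False
  have loc: "finitary (\<lambda>\<omega>. shape m n (neg z -` \<alpha> -` \<omega>))"
    by (rule finitary_vimage[OF finitary_shape_at impl_a])
  have "L a (arm_term m n z h) = op (\<lambda>\<omega>. shape m n (neg z -` \<alpha> -` \<omega>)) (L a (L (inv (arm_elt z)) h))"
    unfolding arm_term_alt by (rule L_op[OF finitary_shape_at impl_a])
  then have "op (edge \<alpha>) (L a (arm_term m n z h)) =
      op (\<lambda>\<omega>. edge \<alpha> \<omega> \<and> shape m n (neg z -` \<alpha> -` \<omega>)) (L a (L (inv (arm_elt z)) h))"
    using op_op[OF finitary_edge_\<alpha> loc] by simp
  moreover have "\<not> (edge \<alpha> \<omega> \<and> shape m n (neg z -` \<alpha> -` \<omega>))" for \<omega>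
    using shape_prev[of m n z "\<alpha> -` \<omega>"] False z by (auto simp: edge_def \<alpha>_inv)
  then have "(\<lambda>\<omega>. edge \<alpha> \<omega> \<and> shape m n (neg z -` \<alpha> -` \<omega>)) = (\<lambda>_. False)"
    by (intro ext) (simp only: not_False_eq_True)
  ultimately show ?thesis using False by (simp only: op_False if_False)
qed

text \<open>On the left the edge event keeps the vertices from 0 to m - 1. On the right
  \<open>L a\<close> moves vertex \<open>z\<close> to \<open>z - 1\<close>, and the vertices from 1
  to m survive.\<close>

lemma edge_arm_sum: "op (edge \<alpha>) (arm_sum m n h) = op (edge \<alpha>) (L a (arm_sum m n h))"
proof
  fix x
  let ?I = "{- int n..int m}"
  have "op (edge \<alpha>) (arm_sum m n h) x = (\<Sum>z\<in>?I. op (edge \<alpha>) (arm_term m n z h) x)"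
    unfolding arm_sum_def op_sum sum_fun_apply ..
  also have "\<dots> = (\<Sum>z\<in>?I. if 0 \<le> z \<and> z < int m then arm_term m n z h x else 0)"
    by (intro sum.cong refl, subst edge_arm_term) auto
  also have "\<dots> = (\<Sum>z\<in>{0..<int m}. arm_term m n z h x)"
    by (rule sum.mono_neutral_cong_right) auto
  also have "\<dots> = (\<Sum>z\<in>{1..int m}. arm_term m n (z - 1) h x)"
    by (rule sum.reindex_bij_witness[where i = "\<lambda>z. z - 1" and j = "\<lambda>z. z + 1"]) auto
  also have "\<dots> = (\<Sum>z\<in>?I. if 1 \<le> z then arm_term m n (z - 1) h x else 0)"
    by (rule sum.mono_neutral_cong_left) auto
  also have "\<dots> = (\<Sum>z\<in>?I. op (edge \<alpha>) (L a (arm_term m n z h)) x)"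
    by (intro sum.cong refl, subst edge_L_arm_term) auto
  also have "\<dots> = op (edge \<alpha>) (L a (arm_sum m n h)) x"
    unfolding arm_sum_def left_regular_sum op_sum sum_fun_apply ..
  finally show "op (edge \<alpha>) (arm_sum m n h) x = op (edge \<alpha>) (L a (arm_sum m n h)) x" .
qed

lemma good_arm_term:
  assumes z: "- int n \<le> z" "z \<le> int m"
  shows "op (\<lambda>\<omega>. \<not> good \<omega>) (arm_term m n z h) = 0"
proof -
  have "op (\<lambda>\<omega>. \<not> good \<omega>) (arm_term m n z h) =
      op (\<lambda>\<omega>. \<not> good \<omega> \<and> shape m n (neg z -` \<omega>)) (L (inv (arm_elt z)) h)"
    unfolding arm_term_alt by (rule op_op[OF finitary_not[OF finitary_good] finitary_shape_at])
  moreover have "(\<lambda>\<omega>. \<not> good \<omega> \<and> shape m n (neg z -` \<omega>)) = (\<lambda>_. False)"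
    using shape_good z by (intro ext) blast
  ultimately show ?thesis by (simp only: op_False)
qed

lemma arm_sum_in_kern:
  assumes "h \<in> ell2 G"
  shows "arm_sum m n h \<in> kern"
proof -
  have "arm_sum m n h \<in> ell2 G"
    unfolding arm_sum_def by (intro ell2_sum ell2_arm_term assms)
  moreover have "op (\<lambda>\<omega>. \<not> good \<omega>) (arm_sum m n h) = 0"
  proof -
    have "(\<Sum>z\<in>{- int n..int m}. op (\<lambda>\<omega>. \<not> good \<omega>) (arm_term m n z h)) = 0"
      by (rule sum.neutral) (use good_arm_term in auto)
    then show ?thesis unfolding arm_sum_def op_sum .
  qed
  moreover have "op (edge \<beta>) (arm_sum m n h) = op (edge \<beta>) (L b (arm_sum m n h))"
    using walk_lamps.edge_arm_sum[OF walk_lamps_swap, of n m h] unfolding arm_sum_swap .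
  ultimately show ?thesis using edge_arm_sum unfolding kern_def by blast
qed

text \<open>The shape implies that every edge of its arm is lit. The edge relation of
  \<open>f\<close>, translated to the i-th edge, can therefore be inserted under
  \<open>op (shape m n)\<close> and advances \<open>f\<close> by one vertex.\<close>

lemma kern_transport_arm:
  assumes f: "f \<in> kern" and "i \<le> m"
  shows "op (shape m n) (L (a [^] i) f) = op (shape m n) f"
  using assms(2)
proof (induction i)
  case 0
  then show ?case using left_regular_one[of f] ell2_outside[OF kernD(1)[OF f]] by simp
next
  case (Suc i)
  let ?e = "\<lambda>\<omega>. edge \<alpha> ((\<alpha> ^^ i) -` \<omega>)"
  note loc_e = finitary_edge_\<alpha>
  note impl = implements_pow[OF impl_a, of i]
  have loc: "finitary ?e" by (rule finitary_vimage[OF loc_e impl])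
  have sub: "?e \<omega>" if "shape m n \<omega>" for \<omega>
    using shape_mem_arm[OF that, of i] shape_mem_arm[OF that, of "Suc i"] Suc.prems
    by (simp add: edge_def funpow_swap1)
  have ai: "a [^] i \<in> carrier G" using a_closed by simp
  have "op ?e (L (a [^] i) f) = L (a [^] i) (op (edge \<alpha>) f)"
    by (rule L_op[OF loc_e impl, symmetric])
  also have "\<dots> = L (a [^] i) (op (edge \<alpha>) (L a f))"
    using kernD(3)[OF f] by simp
  also have "\<dots> = op ?e (L (a [^] Suc i) f)"
    unfolding L_op[OF loc_e impl] using a_closed ai by (simp add: left_regular_left_regular)
  finally have "op (shape m n) (op ?e (L (a [^] i) f)) = op (shape m n) (op ?e (L (a [^] Suc i) f))"
    by simp
  moreover have "op (shape m n) (op ?e h) = op (shape m n) h" for h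
    by (rule op_mono[OF finitary_shape loc]) (rule sub)
  ultimately have "op (shape m n) (L (a [^] i) f) = op (shape m n) (L (a [^] Suc i) f)"
    by (simp only:)
  then show ?case using Suc.IH Suc.prems by (simp only: Suc_leD)
qed

lemma kern_transport:
  assumes f: "f \<in> kern" and z: "- int n \<le> z" "z \<le> int m"
  shows "op (shape m n) (L (arm_elt z) f) = op (shape m n) f"
proof (cases "0 \<le> z")
  case True
  then show ?thesis
    unfolding arm_elt_def if_P[OF True] using z by (intro kern_transport_arm[OF f]) simp
next
  case False
  have "f \<in> walk_lamps.kern G s Y \<beta> \<beta>i \<alpha> \<alpha>i base b a" using f by (simp only: kern_swap)
  from walk_lamps.kern_transport_arm[OF walk_lamps_swap this, of "nat (- z)" n m]
  show ?thesis unfolding arm_elt_def if_not_P[OF False] swap_simps using False z by simp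
qed

lemma ell2_inner_arm_term:
  assumes f: "f \<in> ell2 G"
  shows "ell2_inner G f (arm_term m n z (L (arm_elt t) (ell2_delta \<one>))) =
    L (inv (arm_elt t)) (op (shape m n) (L (arm_elt z) f)) \<one>"
proof -
  note c = arm_elt_closed[of z] arm_elt_closed[of t] inv_closed[OF arm_elt_closed[of z]] inv_closed[OF arm_elt_closed[of t]]
  let ?d = "ell2_delta \<one> :: 'g \<Rightarrow> complex"
  have d: "?d \<in> ell2 G" by (simp add: ell2_delta)
  have "ell2_inner G (L (inv (arm_elt t)) (op (shape m n) (L (arm_elt z) f))) ?d =
      ell2_inner G (op (shape m n) (L (arm_elt z) f)) (L (arm_elt t) ?d)"
    using ell2_inner_left_regular[OF c(4)] c by simp
  also have "\<dots> = ell2_inner G (L (arm_elt z) f) (op (shape m n) (L (arm_elt t) ?d))"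
    by (intro op_selfadjoint finitary_shape ell2_left_regular c f d)
  also have "\<dots> = ell2_inner G f (arm_term m n z (L (arm_elt t) ?d))"
    unfolding arm_term_def by (rule ell2_inner_left_regular[OF c(1)])
  finally show ?thesis by (simp add: ell2_inner_delta)
qed

lemma ell2_inner_diff_right:
  assumes "f \<in> ell2 G" "h \<in> ell2 G" "h' \<in> ell2 G"
  shows "ell2_inner G f (h - h') = ell2_inner G f h - ell2_inner G f h'"
proof -
  have "ell2_inner G f (h - h') = cnj (ell2_inner G (h - h') f)"
    by (rule ell2_inner_cnj)
  also have "\<dots> = cnj (ell2_inner G h f) - cnj (ell2_inner G h' f)"
    unfolding ell2_inner_diff_left[OF assms(2,3,1)] by (rule complex_cnj_diff)
  finally show ?thesis
    unfolding ell2_inner_cnj[of G f h] ell2_inner_cnj[of G f h'] .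
qed

text \<open>The projection of \<open>\<delta>\<^sub>1\<close> onto the functions that are supported on the L-shapes with arms \<open>m\<close>
  and \<open>n\<close> and constant on each of them.\<close>

definition kern_proj :: "nat \<Rightarrow> nat \<Rightarrow> 'g \<Rightarrow> complex" where
  "kern_proj m n = scale_fun (1 / of_nat (m + n + 1))
     (\<Sum>t\<in>{- int n..int m}. arm_sum m n (L (arm_elt t) (ell2_delta \<one>)))"

lemma ell2_arm_delta: "L (arm_elt t) (ell2_delta \<one>) \<in> ell2 G"
  by (intro ell2_left_regular arm_elt_closed ell2_delta one_closed)

lemma kern_proj_in_kern: "kern_proj m n \<in> kern"
  unfolding kern_proj_def by (intro kern_scale kern_sum arm_sum_in_kern ell2_arm_delta)

lemma card_arm_range: "card {- int n..int m} = m + n + 1"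
  by simp

lemma ell2_inner_right_sum:
  assumes "\<And>i. i \<in> I \<Longrightarrow> F i \<in> ell2 G" "f \<in> ell2 G"
  shows "ell2_inner G f (\<Sum>i\<in>I. F i) = (\<Sum>i\<in>I. ell2_inner G f (F i))"
proof -
  have "ell2_inner G f (\<Sum>i\<in>I. F i) = cnj (ell2_inner G (\<Sum>i\<in>I. F i) f)"
    by (rule ell2_inner_cnj)
  also have "\<dots> = (\<Sum>i\<in>I. cnj (ell2_inner G (F i) f))"
    by (subst ell2_inner_sum_left) (use assms in auto)
  also have "\<dots> = (\<Sum>i\<in>I. ell2_inner G f (F i))"
    by (intro sum.cong refl ell2_inner_cnj[symmetric])
  finally show ?thesis .
qed

text \<open>Since \<open>f\<close> is constant along L-shapes, the inner product with the matrix
  unit at \<open>z\<close> and \<open>t\<close> does not depend on \<open>z\<close>. The sum over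
  \<open>z\<close> then cancels the factor \<open>1 / (m + n + 1)\<close>.\<close>

lemma ell2_inner_kern_proj:
  assumes f: "f \<in> kern"
  shows "ell2_inner G f (kern_proj m n) =
    (\<Sum>z\<in>{- int n..int m}. op (\<lambda>\<omega>. shape m n (neg z -` \<omega>)) f \<one>)"
proof -
  let ?I = "{- int n..int m}"
  let ?X = "\<lambda>t. op (\<lambda>\<omega>. shape m n (neg t -` \<omega>)) f \<one>"
  note fl = kernD(1)[OF f]
  have X: "L (inv (arm_elt t)) (op (shape m n) (L (arm_elt z) f)) \<one> = ?X t"
    if "z \<in> ?I" "t \<in> ?I" for z t
  proof -
    have "op (shape m n) (L (arm_elt z) f) = op (shape m n) (L (arm_elt t) f)"
      using kern_transport[OF f] that by simp
    then have "L (inv (arm_elt t)) (op (shape m n) (L (arm_elt z) f)) =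
        arm_term m n t (L (arm_elt t) f)" by (simp only: arm_term_def)
    also have "\<dots> = op (\<lambda>\<omega>. shape m n (neg t -` \<omega>)) f"
      unfolding arm_term_alt using arm_elt_closed[of t] left_regular_one[of f] ell2_outside[OF fl]
      by (simp add: left_regular_left_regular)
    finally show ?thesis by simp
  qed
  have sc: "ell2_inner G f (scale_fun c h) = cnj c * ell2_inner G f h" for c h
    unfolding ell2_inner_cnj[of G f "scale_fun c h"] ell2_inner_scale_left ell2_inner_cnj[of G f h] by simp
  have s1: "ell2_inner G f (arm_sum m n h) = (\<Sum>z\<in>?I. ell2_inner G f (arm_term m n z h))"
    if "h \<in> ell2 G" for h
    unfolding arm_sum_def by (intro ell2_inner_right_sum ell2_arm_term fl that)
  have "ell2_inner G f (\<Sum>t\<in>?I. arm_sum m n (L (arm_elt t) (ell2_delta \<one>))) =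
      (\<Sum>t\<in>?I. ell2_inner G f (arm_sum m n (L (arm_elt t) (ell2_delta \<one>))))"
    by (intro ell2_inner_right_sum kernD(1)[OF arm_sum_in_kern] ell2_arm_delta fl)
  also have "\<dots> = (\<Sum>t\<in>?I. \<Sum>z\<in>?I. ell2_inner G f (arm_term m n z (L (arm_elt t) (ell2_delta \<one>))))"
    by (intro sum.cong refl s1 ell2_arm_delta)
  finally have "ell2_inner G f (kern_proj m n) = 1 / of_nat (m + n + 1) *
      (\<Sum>t\<in>?I. \<Sum>z\<in>?I. ell2_inner G f (arm_term m n z (L (arm_elt t) (ell2_delta \<one>))))"
    unfolding kern_proj_def sc by (simp del: of_nat_add of_nat_Suc)
  also have "(\<Sum>t\<in>?I. \<Sum>z\<in>?I. ell2_inner G f (arm_term m n z (L (arm_elt t) (ell2_delta \<one>)))) =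
      (\<Sum>t\<in>?I. \<Sum>z\<in>?I. ?X t)"
    by (intro sum.cong refl) (simp only: ell2_inner_arm_term[OF fl] X)
  also have "\<dots> = of_nat (m + n + 1) * (\<Sum>t\<in>?I. ?X t)"
    unfolding sum_constant card_arm_range sum_distrib_left ..
  finally show ?thesis by (simp del: of_nat_add of_nat_Suc)
qed

text \<open>Along an edge with both ends lit, \<open>f\<close> agrees with its translate, so an
  event that is null for \<open>f\<close> is also null when it is observed from the other
  end.\<close>

lemma op_edge_pull:
  assumes impl: "implements g p q" and loc: "finitary P" and P: "op P f = 0"
    and e: "op (edge p) f = op (edge p) (L g f)"
  shows "op (\<lambda>\<omega>. base \<in> \<omega> \<and> p base \<in> \<omega> \<and> P (p -` \<omega>)) f = 0"
proof -
  have le: "finitary (edge p)" by (rule finitary_edge) (rule implementsD(4)[OF impl base_Y])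
  note lv = finitary_vimage[OF loc impl]
  have "op (\<lambda>\<omega>. base \<in> \<omega> \<and> p base \<in> \<omega> \<and> P (p -` \<omega>)) f = op (\<lambda>\<omega>. P (p -` \<omega>) \<and> edge p \<omega>) f"
    by (intro arg_cong[where f = "\<lambda>P. op P f"] ext) (auto simp: edge_def)
  also have "\<dots> = op (\<lambda>\<omega>. P (p -` \<omega>)) (op (edge p) (L g f))"
    unfolding e[symmetric] by (rule op_op[OF lv le, symmetric])
  also have "\<dots> = op (edge p) (op (\<lambda>\<omega>. P (p -` \<omega>)) (L g f))"
    unfolding op_op[OF lv le] op_op[OF le lv] by (simp only: conj_commute)
  also have "op (\<lambda>\<omega>. P (p -` \<omega>)) (L g f) = L g (op P f)"
    by (rule L_op[OF loc impl, symmetric])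
  also have "L g (op P f) = 0"
    unfolding P by (rule ext) (simp add: left_regular_def)
  finally show ?thesis unfolding op_zero .
qed

lemma edge_eq_inv:
  assumes impl: "implements g p q" and f: "f \<in> ell2 G" and e: "op (edge p) f = op (edge p) (L g f)"
  shows "op (edge q) f = op (edge q) (L (inv g) f)"
proof -
  have le: "finitary (edge p)" by (rule finitary_edge) (rule implementsD(4)[OF impl base_Y])
  have eq: "(\<lambda>\<omega>. edge p (q -` \<omega>)) = edge q"
    by (intro ext) (auto simp: edge_def implementsD(3)[OF impl])
  have "L (inv g) (op (edge p) h) = op (edge q) (L (inv g) h)" for h
    using L_op[OF le implements_inv[OF impl], of h] unfolding eq .
  then have "op (edge q) (L (inv g) f) = op (edge q) (L (inv g) (L g f))"
    using e by metis
  also have "L (inv g) (L g f) = f"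
    using implementsD(1)[OF impl] left_regular_one[of f] ell2_outside[OF f]
    by (simp add: left_regular_left_regular)
  finally show ?thesis by simp
qed

text \<open>The local test spreads through the cluster: exploration to depth \<open>r + 1\<close>
  fails only if it already fails at depth \<open>r\<close> or fails at depth \<open>r\<close> as
  seen from one of four lit neighbours. \<open>op_edge_pull\<close> makes the latter events
  null.\<close>

lemma kern_explored:
  assumes f: "f \<in> kern"
  shows "op (\<lambda>\<omega>. \<not> explored r \<omega>) f = 0"
proof (induction r)
  case 0
  show ?case using kernD(2)[OF f] unfolding explored.simps(1) .
next
  case (Suc r)
  let ?N = "\<lambda>\<omega>. \<not> explored r \<omega>"
  let ?B = "\<lambda>p \<omega>. base \<in> \<omega> \<and> p base \<in> \<omega> \<and> \<not> explored r (p -` \<omega>)"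
  note loc = finitary_not[OF finitary_explored, of r]
  note ia = impl_a implements_inv[OF impl_a] and ib = impl_b implements_inv[OF impl_b]
  note ea = kernD(3)[OF f] edge_eq_inv[OF impl_a kernD(1,3)[OF f]]
    and eb = kernD(4)[OF f] edge_eq_inv[OF impl_b kernD(1,4)[OF f]]
  have lB: "finitary (?B p)" if "implements g p q" for g p q
    by (intro finitary_conj finitary_mem base_Y implementsD(4)[OF that] finitary_vimage[OF loc that])
  have z: "op (?B \<alpha>) f = 0" "op (?B \<alpha>i) f = 0" "op (?B \<beta>) f = 0" "op (?B \<beta>i) f = 0"
    subgoal by (rule op_edge_pull[OF ia(1) loc Suc ea(1)])
    subgoal by (rule op_edge_pull[OF ia(2) loc Suc ea(2)])
    subgoal by (rule op_edge_pull[OF ib(1) loc Suc eb(1)])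
    subgoal by (rule op_edge_pull[OF ib(2) loc Suc eb(2)])
    done
  have "op (\<lambda>\<omega>. ?N \<omega> \<or> ?B \<alpha> \<omega> \<or> ?B \<alpha>i \<omega> \<or> ?B \<beta> \<omega> \<or> ?B \<beta>i \<omega>) f = 0"
    by (intro op_null_disj finitary_disj loc lB[OF ia(1)] lB[OF ia(2)] lB[OF ib(1)] lB[OF ib(2)] Suc z)
  moreover have "(\<lambda>\<omega>. ?N \<omega> \<or> ?B \<alpha> \<omega> \<or> ?B \<alpha>i \<omega> \<or> ?B \<beta> \<omega> \<or> ?B \<beta>i \<omega>) = (\<lambda>\<omega>. \<not> explored (Suc r) \<omega>)"
    by (intro ext, unfold explored.simps(2) ball_simps) blast
  ultimately show ?case by simp
qed

definition covered :: "nat \<Rightarrow> 'x set \<Rightarrow> bool" where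
  "covered M \<omega> \<longleftrightarrow> (\<exists>(m, n, z)\<in>(SIGMA m:{..<M}. SIGMA n:{..<M}. {- int n..int m}). shape m n (neg z -` \<omega>))"

text \<open>The part of a kernel function left over once the L-shapes with both arms shorter than
  \<open>M\<close> are split off. By \<open>cover\<close>, an explored configuration that is not
  covered must be far.\<close>

definition escape :: "nat \<Rightarrow> 'x set \<Rightarrow> bool" where
  "escape M \<omega> \<longleftrightarrow> far M \<omega> \<and> \<not> covered M \<omega> \<and> explored (2 * M) \<omega>"

lemma finitary_covered: "finitary (covered M)"
proof -
  have "covered M = (\<lambda>\<omega>. \<exists>j\<in>(SIGMA m:{..<M}. SIGMA n:{..<M}. {- int n..int m}).
      shape (fst j) (fst (snd j)) (neg (snd (snd j)) -` \<omega>))"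
    by (rule ext) (simp add: covered_def case_prod_beta)
  then show ?thesis
    by (simp only:) (intro finitary_bex finitary_shape_at finite_SigmaI finite_lessThan finite_atLeastAtMost_int)
qed

lemma finitary_escape: "finitary (escape M)"
  unfolding escape_def[abs_def] by (intro finitary_conj finitary_not finitary_far finitary_covered finitary_explored)

text \<open>The covered part is a sum over disjoint events, grouped into inner products by
  \<open>ell2_inner_kern_proj\<close>. In the uncovered part, \<open>kern_explored\<close> removes
  everything but the escape event.\<close>

lemma kern_at_one:
  assumes f: "f \<in> kern"
  shows "f \<one> = (\<Sum>m<M. \<Sum>n<M. ell2_inner G f (kern_proj m n)) +
    op (escape M) f \<one>"
proof -
  note fl = kernD(1)[OF f]
  let ?J = "SIGMA m:{..<M}. SIGMA n:{..<M}. {- int n..int m}"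
  let ?P = "\<lambda>(m, n, z) \<omega>. shape m n (neg z -` \<omega>)"
  have loc: "finitary (?P j)" for j
  proof (cases j)
    case (fields m n z)
    show ?thesis unfolding fields prod.case by (rule finitary_shape_at)
  qed
  have finJ: "finite ?J" by (intro finite_SigmaI finite_lessThan finite_atLeastAtMost_int)
  have cov: "covered M = (\<lambda>\<omega>. \<exists>j\<in>?J. ?P j \<omega>)"
    by (rule ext) (simp add: covered_def case_prod_beta)
  note lc = finitary_covered[of M] and lr = finitary_escape[of M]
  have 1: "op (covered M) f = (\<Sum>j\<in>?J. op (?P j) f)"
    unfolding cov
  proof (rule op_disjoint_family)
    show "i = j" if "i \<in> ?J" "j \<in> ?J" "?P i \<omega>" "?P j \<omega>" for i j \<omega>
      using that shape_unique[of "fst i" "fst (snd i)" "snd (snd i)" \<omega> "fst j" "fst (snd j)" "snd (snd j)"]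
      by (auto simp: prod_eq_iff)
  qed (rule finJ loc)+
  have 2: "op (\<lambda>\<omega>. \<not> covered M \<omega>) f =
      op (escape M) f"
  proof -
    have ln: "finitary (\<lambda>\<omega>. \<not> covered M \<omega> \<and> \<not> explored (2 * M) \<omega>)"
      by (intro finitary_conj finitary_not lc finitary_explored)
    have "(\<lambda>\<omega>. \<not> covered M \<omega>) = (\<lambda>\<omega>. escape M \<omega> \<or>
        (\<not> covered M \<omega> \<and> \<not> explored (2 * M) \<omega>))"
    proof
      fix \<omega>
      have "covered M \<omega>" if e: "explored (2 * M) \<omega>" "\<not> far M \<omega>"
      proof -
        obtain m n z where "m < M" "n < M" "- int n \<le> z" "z \<le> int m" "shape m n (neg z -` \<omega>)"
          using cover[OF e] .
        then show ?thesis
          unfolding covered_def by (intro bexI[of _ "(m, n, z)"]) auto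
      qed
      then show "(\<not> covered M \<omega>) = (escape M \<omega> \<or>
        (\<not> covered M \<omega> \<and> \<not> explored (2 * M) \<omega>))" unfolding escape_def by blast
    qed
    then have "op (\<lambda>\<omega>. \<not> covered M \<omega>) f = op (\<lambda>\<omega>. escape M \<omega> \<or>
        (\<not> covered M \<omega> \<and> \<not> explored (2 * M) \<omega>)) f" by (rule arg_cong)
    also have "\<dots> = op (escape M) f +
        op (\<lambda>\<omega>. \<not> covered M \<omega> \<and> \<not> explored (2 * M) \<omega>) f"
      by (rule op_disjoint[OF lr ln]) (simp add: escape_def)
    also have "op (\<lambda>\<omega>. \<not> covered M \<omega> \<and> \<not> explored (2 * M) \<omega>) f = 0"
      by (rule op_null_mono[OF ln finitary_not[OF finitary_explored] kern_explored[OF f]]) blast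
    finally show ?thesis by (simp only: add_0_right)
  qed
  have "f = op (covered M) f + op (\<lambda>\<omega>. \<not> covered M \<omega>) f"
    using op_add_op_not[OF lc, of f] ell2_outside[OF fl] by simp
  from fun_cong[OF this, of \<one>] have "f \<one> = (\<Sum>j\<in>?J. op (?P j) f \<one>) +
      op (escape M) f \<one>"
    unfolding 1 2 plus_fun_apply sum_fun_apply .
  also have "(\<Sum>j\<in>?J. op (?P j) f \<one>) = (\<Sum>m<M. \<Sum>n<M. ell2_inner G f (kern_proj m n))"
    unfolding ell2_inner_kern_proj[OF f]
    by (simp add: sum.Sigma case_prod_beta)
  finally show ?thesis .
qed

end

section \<open>The trace of the projection as a double series\<close>

locale free_walk_lamps = walk_lamps G s Y \<alpha> \<alpha>i \<beta> \<beta>i base a b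
  for G :: "('g, 'm) monoid_scheme" (structure) and s :: "'x set \<Rightarrow> 'g" and Y
    and \<alpha> \<alpha>i \<beta> \<beta>i :: "'x \<Rightarrow> 'x" and base :: 'x and a b :: 'g +
  assumes inj_\<alpha>: "inj (\<lambda>k. (\<alpha> ^^ k) base)" and inj_\<beta>: "inj (\<lambda>k. (\<beta> ^^ k) base)"
    and ones_zeros: "\<And>m n. ones m n \<inter> zeros m n = {}"
    and arms_free: "\<And>A t z. finite A \<Longrightarrow> A \<subseteq> Y \<Longrightarrow> s A \<otimes> arm_elt t = arm_elt z \<Longrightarrow> A = {} \<and> t = z"
begin

abbreviation tested :: "nat \<Rightarrow> nat \<Rightarrow> 'x set" where
  "tested m n \<equiv> ones m n \<union> zeros m n"

lemma tested_Y: "finite (tested m n)" "tested m n \<subseteq> Y"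
proof -
  show "finite (tested m n)" unfolding ones_def zeros_def by simp
  have "ones m n \<subseteq> Y" unfolding ones_def by (intro Un_least image_subsetI in_Y base_Y)
  moreover have "zeros m n \<subseteq> Y"
    unfolding zeros_def by (intro Un_least image_subsetI insert_subsetI empty_subsetI in_Y base_Y)
  ultimately show "tested m n \<subseteq> Y" by blast
qed

lemma depends_on_shape: "depends_on (tested m n) (shape m n)"
  unfolding depends_on_def shape_iff_pattern by blast

lemma prob_shape: "cylinder_prob (tested m n) (shape m n) = (1/2) ^ card (tested m n)"
  unfolding shape_iff_pattern[abs_def]
  by (rule cylinder_prob_pattern[OF tested_Y(1) ones_zeros order_refl])

lemma card_tested: "m < card (tested m n)" "n < card (tested m n)"
proof -
  have "card ((\<lambda>i. (\<alpha> ^^ i) base) ` {..m}) \<le> card (tested m n)"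
    by (rule card_mono[OF tested_Y(1)]) (auto simp: ones_def)
  then show "m < card (tested m n)"
    by (simp add: card_image[OF inj_on_subset[OF inj_\<alpha>]])
  have "card ((\<lambda>i. (\<beta> ^^ i) base) ` {..n}) \<le> card (tested m n)"
    by (rule card_mono[OF tested_Y(1)]) (auto simp: ones_def)
  then show "n < card (tested m n)"
    by (simp add: card_image[OF inj_on_subset[OF inj_\<beta>]])
qed

text \<open>By \<open>arms_free\<close> the off-diagonal matrix units have trace zero, and each of
  the m + n + 1 diagonal ones has the probability of the shape as its trace. The normalisation
  leaves exactly one copy of it.\<close>

lemma kern_proj_at_one: "kern_proj m n \<one> = (1/2) ^ card (tested m n)"
proof -
  let ?I = "{- int n..int m}"
  have t: "arm_term m n z (L (arm_elt t) (ell2_delta \<one>)) \<one> = (if t = z then (1/2) ^ card (tested m n) else 0)"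
    for t z
  proof -
    note c = arm_elt_closed[of z] arm_elt_closed[of t]
    have "arm_term m n z (L (arm_elt t) (ell2_delta \<one>)) \<one> = op (shape m n) (ell2_delta (arm_elt t)) (arm_elt z)"
      unfolding arm_term_def using c by (simp add: left_regular_delta) (simp add: left_regular_def)
    also have "\<dots> = of_bool (arm_elt t = arm_elt z) * complex_of_real (cylinder_prob (tested m n) (shape m n))"
      by (rule op_delta[OF tested_Y depends_on_shape c(2)]) (use arms_free in blast)
    also have "arm_elt t = arm_elt z \<longleftrightarrow> t = z"
      using arms_free[of "{}" t z] c by (auto simp: s_empty)
    finally show ?thesis by (simp add: prob_shape)
  qed
  have "kern_proj m n \<one> = 1 / of_nat (m + n + 1) * (\<Sum>t\<in>?I. \<Sum>z\<in>?I. if t = z then (1/2) ^ card (tested m n) else 0)"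
    unfolding kern_proj_def arm_sum_def scale_fun_apply sum_fun_apply t ..
  also have "(\<Sum>t\<in>?I. \<Sum>z\<in>?I. if t = z then (1/2) ^ card (tested m n) else 0) =
      (of_nat (m + n + 1) * (1/2) ^ card (tested m n) :: complex)"
    using sum_constant[of "(1/2) ^ card (tested m n) :: complex" ?I] unfolding card_arm_range
    by (subst sum.delta', simp) (simp del: of_nat_add of_nat_Suc)
  finally show ?thesis by (simp del: of_nat_add of_nat_Suc)
qed

text \<open>Triangle inequality over (m + n + 1)^2 matrix units, each of norm the square root of the
  shape's probability; a crude bound with exponential decay in the longer arm.\<close>

lemma norm_kern_proj: "ell2_norm G (kern_proj m n) \<le> real (m + n + 1) * sqrt ((1/2) ^ max m n)"
proof -
  let ?I = "{- int n..int m}"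
  let ?B = "sqrt ((1/2) ^ max m n)"
  have "ell2_norm G (arm_term m n z (L (arm_elt t) (ell2_delta \<one>))) \<le> ?B" for z t
  proof -
    note c = arm_elt_closed[of z] arm_elt_closed[of t]
    have d: "ell2_delta (arm_elt t) \<in> ell2 G" by (rule ell2_delta[OF c(2)])
    have "ell2_norm G (arm_term m n z (L (arm_elt t) (ell2_delta \<one>))) =
        ell2_norm G (op (shape m n) (ell2_delta (arm_elt t)))"
      unfolding arm_term_def using c
      by (simp add: left_regular_delta ell2_norm_left_regular ell2_op finitary_shape d)
    also have "\<dots> = sqrt ((1/2) ^ card (tested m n))"
      unfolding ell2_norm_op_delta[OF tested_Y depends_on_shape c(2)] prob_shape ..
    also have "\<dots> \<le> ?B"
      using card_tested[of m n] card_tested[of n m]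
      by (intro real_sqrt_le_mono power_decreasing) auto
    finally show ?thesis .
  qed
  note tb = this
  have as: "ell2_norm G (arm_sum m n (L (arm_elt t) (ell2_delta \<one>))) \<le> real (m + n + 1) * ?B" for t
  proof -
    have "ell2_norm G (arm_sum m n (L (arm_elt t) (ell2_delta \<one>))) \<le>
        (\<Sum>z\<in>?I. ell2_norm G (arm_term m n z (L (arm_elt t) (ell2_delta \<one>))))"
      unfolding arm_sum_def by (rule ell2_norm_sum) (rule ell2_arm_term[OF ell2_arm_delta])
    also have "\<dots> \<le> (\<Sum>z\<in>?I. ?B)" by (rule sum_mono) (rule tb)
    finally show ?thesis unfolding sum_constant card_arm_range .
  qed
  have "ell2_norm G (kern_proj m n) \<le> cmod (1 / of_nat (m + n + 1)) *
      ell2_norm G (\<Sum>t\<in>?I. arm_sum m n (L (arm_elt t) (ell2_delta \<one>)))"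
    unfolding kern_proj_def
    by (rule ell2_norm_scale) (intro ell2_sum kernD(1)[OF arm_sum_in_kern] ell2_arm_delta)
  also have "\<dots> \<le> cmod (1 / of_nat (m + n + 1)) * (\<Sum>t\<in>?I. real (m + n + 1) * ?B)"
  proof (intro mult_left_mono norm_ge_zero)
    have "ell2_norm G (\<Sum>t\<in>?I. arm_sum m n (L (arm_elt t) (ell2_delta \<one>))) \<le>
        (\<Sum>t\<in>?I. ell2_norm G (arm_sum m n (L (arm_elt t) (ell2_delta \<one>))))"
      by (intro ell2_norm_sum kernD(1)[OF arm_sum_in_kern] ell2_arm_delta)
    also have "\<dots> \<le> (\<Sum>t\<in>?I. real (m + n + 1) * ?B)" by (rule sum_mono) (rule as)
    finally show "ell2_norm G (\<Sum>t\<in>?I. arm_sum m n (L (arm_elt t) (ell2_delta \<one>))) \<le>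
        (\<Sum>t\<in>?I. real (m + n + 1) * ?B)" .
  qed
  also have "\<dots> = real (m + n + 1) * ?B"
    unfolding sum_constant card_arm_range by (simp add: norm_divide del: of_nat_add of_nat_Suc)
  finally show ?thesis .
qed

definition partial_proj :: "nat \<Rightarrow> 'g \<Rightarrow> complex" where
  "partial_proj M = (\<Sum>m<M. \<Sum>n<M. kern_proj m n)"

lemma partial_proj_in_kern: "partial_proj M \<in> kern"
  unfolding partial_proj_def by (intro kern_sum kern_proj_in_kern)

text \<open>A square of indices grows by one column and one row, the new diagonal index being
  counted with the row; this gives 2M + 1 new terms.\<close>

lemma partial_proj_Suc:
  "partial_proj (Suc M) - partial_proj M = (\<Sum>m<M. kern_proj m M) + (\<Sum>n<Suc M. kern_proj M n)"
  by (rule ext) (simp add: partial_proj_def sum_fun_apply sum.distrib)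

lemma norm_partial_proj_Suc:
  "ell2_norm G (partial_proj (Suc M) - partial_proj M) \<le> (2 * real M + 1)\<^sup>2 * sqrt ((1/2) ^ M)"
proof -
  have K: "kern_proj m n \<in> ell2 G" for m n by (rule kernD(1)[OF kern_proj_in_kern])
  let ?c = "(2 * real M + 1) * sqrt ((1/2) ^ M)"
  have c: "ell2_norm G (kern_proj m n) \<le> ?c" if "max m n = M" for m n
  proof -
    have "ell2_norm G (kern_proj m n) \<le> real (m + n + 1) * sqrt ((1/2) ^ max m n)" by (rule norm_kern_proj)
    also have "\<dots> \<le> ?c" unfolding that by (intro mult_right_mono) (use that in auto)
    finally show ?thesis .
  qed
  have "ell2_norm G (partial_proj (Suc M) - partial_proj M) \<le>
      ell2_norm G (\<Sum>m<M. kern_proj m M) + ell2_norm G (\<Sum>n<Suc M. kern_proj M n)"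
    unfolding partial_proj_Suc by (intro ell2_norm_triangle ell2_sum K)
  also have "\<dots> \<le> (\<Sum>m<M. ell2_norm G (kern_proj m M)) + (\<Sum>n<Suc M. ell2_norm G (kern_proj M n))"
    by (intro add_mono ell2_norm_sum K)
  also have "\<dots> \<le> (\<Sum>m<M. ?c) + (\<Sum>n<Suc M. ?c)"
    by (intro add_mono sum_mono c) auto
  also have "\<dots> = (2 * real M + 1)\<^sup>2 * sqrt ((1/2) ^ M)"
    by (simp add: power2_eq_square algebra_simps)
  finally show ?thesis .
qed

lemma partial_proj_Cauchy:
  assumes "e > 0"
  shows "\<exists>N. \<forall>m\<ge>N. \<forall>n\<ge>N. ell2_norm G (partial_proj m - partial_proj n) < e"
proof -
  let ?B = "\<lambda>M. (2 * real M + 1)\<^sup>2 * sqrt ((1/2) ^ M)"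
  have "summable ?B"
  proof (rule summable_comparison_test_ev)
    have "eventually (\<lambda>M. (2 * real M + 1)\<^sup>2 * (1/2) powr (real M / 2) \<le> 1 / real M ^ 2) at_top"
      by real_asymp
    then show "\<forall>\<^sub>F M in sequentially. norm (?B M) \<le> inverse (real M ^ 2)"
    proof (rule eventually_mono)
      fix M assume "(2 * real M + 1)\<^sup>2 * (1/2) powr (real M / 2) \<le> 1 / real M ^ 2"
      moreover have "sqrt ((1/2) ^ M) = (1/2) powr (real M / 2)"
      proof -
        have e: "(1/2 :: real) ^ M = (1/2) powr real M"
          by (rule powr_realpow[symmetric]) simp
        have "sqrt ((1/2) ^ M) = ((1/2) ^ M) powr (1/2)"
          by (rule powr_half_sqrt[symmetric]) simp
        also have "\<dots> = ((1/2) powr real M) powr (1/2)" unfolding e ..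
        also have "((1/2 :: real) powr real M) powr (1/2) = (1/2) powr (real M * (1/2))"
          by (rule powr_powr)
        finally show ?thesis by (simp only: times_divide_eq_right mult_1_right)
      qed
      moreover have "norm (?B M) = ?B M"
        unfolding real_norm_def by (rule abs_of_nonneg) (intro mult_nonneg_nonneg zero_le_power2 real_sqrt_ge_zero zero_le_power, simp)
      ultimately show "norm (?B M) \<le> inverse (real M ^ 2)"
        by (simp only: inverse_eq_divide)
    qed
    show "summable (\<lambda>M. inverse (real M ^ 2))" by (rule inverse_power_summable) simp
  qed
  then have "Cauchy (\<lambda>M. \<Sum>k<M. ?B k)"
    by (simp add: summable_iff_convergent convergent_Cauchy)
  then obtain N where N: "\<And>m n. m \<ge> N \<Longrightarrow> n \<ge> N \<Longrightarrow> \<bar>(\<Sum>k<m. ?B k) - (\<Sum>k<n. ?B k)\<bar> < e"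
    using assms unfolding Cauchy_def dist_real_def by blast
  have K: "partial_proj m \<in> ell2 G" for m by (rule kernD(1)[OF partial_proj_in_kern])
  have le: "ell2_norm G (partial_proj (n + d) - partial_proj n) \<le> (\<Sum>k<n + d. ?B k) - (\<Sum>k<n. ?B k)" for n d
  proof (induction d)
    case 0
    show ?case unfolding add_0_right diff_self ell2_zero(2) by (rule order_refl)
  next
    case (Suc d)
    have eq: "partial_proj (n + Suc d) - partial_proj n =
        (partial_proj (Suc (n + d)) - partial_proj (n + d)) + (partial_proj (n + d) - partial_proj n)"
      by (rule ext) simp
    have "ell2_norm G (partial_proj (n + Suc d) - partial_proj n) \<le>
        ell2_norm G (partial_proj (Suc (n + d)) - partial_proj (n + d)) +
        ell2_norm G (partial_proj (n + d) - partial_proj n)"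
      unfolding eq by (rule ell2_norm_triangle[OF ell2_diff[OF K K] ell2_diff[OF K K]])
    also have "\<dots> \<le> ?B (n + d) + ((\<Sum>k<n + d. ?B k) - (\<Sum>k<n. ?B k))"
      by (intro add_mono norm_partial_proj_Suc Suc)
    moreover have "(\<Sum>k<n + Suc d. ?B k) = (\<Sum>k<n + d. ?B k) + ?B (n + d)"
      unfolding add_Suc_right by (rule sum.lessThan_Suc)
    ultimately show ?case by linarith
  qed
  have sym: "ell2_norm G (f - h) = ell2_norm G (h - f)" for f h
    unfolding ell2_norm_def by (simp add: norm_minus_commute)
  have "ell2_norm G (partial_proj m - partial_proj n) < e" if "m \<ge> N" "n \<ge> N" for m n
  proof (cases "n \<le> m")
    case True
    then have "n + (m - n) = m" by simp
    from le[of n "m - n", unfolded this] show ?thesis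
      using N[OF that] by linarith
  next
    case False
    then have "m + (n - m) = n" by simp
    from le[of m "n - m", unfolded this] show ?thesis
      unfolding sym[of "partial_proj m"] using N[OF that] by linarith
  qed
  then show ?thesis by blast
qed

text \<open>Union bound: 2M + 1 positions and two directions, each run having probability 2^-(M+1)
  because its M + 1 points are distinct.\<close>

lemma prob_far:
  assumes "finite T" "T \<subseteq> Y" "depends_on T (far M)"
  shows "cylinder_prob T (far M) \<le> (2 * real M + 1) * (1/2) ^ M"
proof -
  let ?A = "\<lambda>p z. (\<lambda>k. neg z ((p ^^ k) base)) ` {..M}"
  \<comment> \<open>The given \<open>T\<close> need not contain the points of every individual run,
    so it is enlarged; \<open>cylinder_prob_indep\<close> compensates.\<close>
  define T' where "T' = T \<union> (\<Union>z\<in>{- int M..int M}. ?A \<alpha> z \<union> ?A \<beta> z)"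
  have T': "finite T'" unfolding T'_def using assms(1) by simp
  have TY: "T' \<subseteq> Y"
    unfolding T'_def by (intro Un_least UN_least image_subsetI in_Y base_Y assms(2))
  have T'd: "depends_on T' (far M)"
    by (rule depends_on_mono[OF assms(3)]) (simp add: T'_def)
  have half: "cylinder_prob T' (\<lambda>\<omega>. \<forall>k\<in>{..M}. neg z ((p ^^ k) base) \<in> \<omega>) = (1/2) ^ Suc M"
    if z: "z \<in> {- int M..int M}" and p: "p = \<alpha> \<or> p = \<beta>" for z p
  proof -
    have "inj (neg z)" by (metis injI pos_neg(1))
    moreover have "inj (\<lambda>k. (p ^^ k) base)" using p inj_\<alpha> inj_\<beta> by blast
    ultimately have "inj (\<lambda>k. neg z ((p ^^ k) base))" by (metis (no_types, lifting) injD injI)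
    then have c: "card (?A p z) = Suc M" by (simp add: card_image[OF inj_on_subset])
    have sub: "?A p z \<union> {} \<subseteq> T'" using z p unfolding T'_def by blast
    have "(\<lambda>\<omega>. \<forall>k\<in>{..M}. neg z ((p ^^ k) base) \<in> \<omega>) = (\<lambda>\<omega>. ?A p z \<subseteq> \<omega> \<and> {} \<inter> \<omega> = {})"
      by (simp add: image_subset_iff)
    then show ?thesis using cylinder_prob_pattern[OF T' _ sub] c by simp
  qed
  have "cylinder_prob T (far M) = cylinder_prob T' (far M)"
    by (rule cylinder_prob_indep[OF assms T' TY T'd])
  also have "\<dots> \<le> (\<Sum>z\<in>{- int M..int M}. cylinder_prob T' (\<lambda>\<omega>.
      (\<forall>k\<in>{..M}. neg z ((\<alpha> ^^ k) base) \<in> \<omega>) \<or> (\<forall>k\<in>{..M}. neg z ((\<beta> ^^ k) base) \<in> \<omega>)))"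
    unfolding far_def[abs_def] by (rule cylinder_prob_bex[OF T']) simp
  also have "\<dots> \<le> (\<Sum>z\<in>{- int M..int M}. (1/2) ^ Suc M + (1/2) ^ Suc M)"
    by (intro sum_mono order_trans[OF cylinder_prob_disj[OF T']]) (simp only: half simp_thms)
  also have "\<dots> = (2 * real M + 1) * (1/2) ^ M" by simp
  finally show ?thesis .
qed

text \<open>The limit \<open>p\<close> of the partial sums lies in the kernel. The difference of the
  delta function and the M-th partial sum pairs with \<open>k\<close> in the kernel to give the
  escape term, which is at most the norm of \<open>k\<close> times the root of an exponentially
  small probability. Hence \<open>p\<close> is the projection, and its value at
  \<open>\<one>\<close> is the sum of the series.\<close>

lemma vn_dim_kern:
  obtains d where "vn_dim G kern = complex_of_real d"
    "(\<lambda>M. \<Sum>m<M. \<Sum>n<M. (1/2) ^ card (tested m n)) \<longlonglongrightarrow> d"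
proof -
  let ?d = "ell2_delta \<one> :: 'g \<Rightarrow> complex"
  have d: "?d \<in> ell2 G" by (simp add: ell2_delta)
  have K: "partial_proj m \<in> ell2 G" for m by (rule kernD(1)[OF partial_proj_in_kern])
  obtain p where p: "p \<in> ell2 G" "(\<lambda>n. ell2_norm G (p - partial_proj n)) \<longlonglongrightarrow> 0"
    "\<And>x. (\<lambda>n. partial_proj n x) \<longlonglongrightarrow> p x"
  proof (rule ell2_complete[OF K partial_proj_Cauchy])
    fix p assume "p \<in> ell2 G" "(\<lambda>n. ell2_norm G (p - partial_proj n)) \<longlonglongrightarrow> 0"
      "\<And>x. (\<lambda>n. partial_proj n x) \<longlonglongrightarrow> p x"
    then show thesis by (rule that)
  qed
  have pk: "p \<in> kern" by (rule kern_closed[OF partial_proj_in_kern p(3,1)])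
  have orth: "ell2_inner G (?d - p) k = 0" if k: "k \<in> kern" for k
  proof -
    note kl = kernD(1)[OF k]
    have eq: "ell2_inner G k (?d - partial_proj M) = op (escape M) k \<one>" for M
    proof -
      have KP: "kern_proj m n \<in> ell2 G" for m n by (rule kernD(1)[OF kern_proj_in_kern])
      have "ell2_inner G k (\<Sum>m<M. \<Sum>n<M. kern_proj m n) = (\<Sum>m<M. ell2_inner G k (\<Sum>n<M. kern_proj m n))"
        by (rule ell2_inner_right_sum[OF ell2_sum[OF KP] kl])
      also have "\<dots> = (\<Sum>m<M. \<Sum>n<M. ell2_inner G k (kern_proj m n))"
        by (intro sum.cong refl ell2_inner_right_sum KP kl)
      finally have "ell2_inner G k (partial_proj M) = (\<Sum>m<M. \<Sum>n<M. ell2_inner G k (kern_proj m n))"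
        unfolding partial_proj_def .
      then show ?thesis
        unfolding ell2_inner_diff_right[OF kl d K] ell2_inner_delta[OF one_closed]
        using kern_at_one[OF k, of M] by simp
    qed
    have bound: "cmod (op (escape M) k \<one>) \<le> ell2_norm G k * sqrt ((2 * real M + 1) * (1/2) ^ M)" for M
    proof -
      have lf: "finitary (far M)" by (rule finitary_far)
      from finitaryE2[OF lf finitary_escape] obtain T
        where T: "finite T" "T \<subseteq> Y" "depends_on T (far M)" "depends_on T (escape M)" .
      have "cmod (op (escape M) k \<one>) \<le> ell2_norm G k * sqrt (cylinder_prob T (escape M))"
        by (rule op_at_one_le[OF T(1,2,4) kl])
      also have "\<dots> \<le> ell2_norm G k * sqrt (cylinder_prob T (far M))"
        by (intro mult_left_mono real_sqrt_le_mono cylinder_prob_mono T(1) ell2_norm_nonneg) (simp add: escape_def)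
      also have "\<dots> \<le> ell2_norm G k * sqrt ((2 * real M + 1) * (1/2) ^ M)"
        by (intro mult_left_mono real_sqrt_le_mono prob_far T(1-3) ell2_norm_nonneg)
      finally show ?thesis .
    qed
    have lim0: "(\<lambda>M. ell2_inner G k (?d - partial_proj M)) \<longlonglongrightarrow> 0"
      unfolding eq
    proof (rule Lim_null_comparison[OF always_eventually[OF allI[OF bound]]])
      have "(\<lambda>M. (2 * real M + 1) * (1/2) ^ M) \<longlonglongrightarrow> 0" by real_asymp
      from tendsto_mult[OF tendsto_const tendsto_real_sqrt[OF this], of "ell2_norm G k"]
      show "(\<lambda>M. ell2_norm G k * sqrt ((2 * real M + 1) * (1/2) ^ M)) \<longlonglongrightarrow> 0" by simp
    qed
    have lim1: "(\<lambda>M. ell2_inner G k (p - partial_proj M)) \<longlonglongrightarrow> 0"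
    proof (rule Lim_null_comparison[OF always_eventually])
      show "\<forall>M. norm (ell2_inner G k (p - partial_proj M)) \<le> ell2_norm G k * ell2_norm G (p - partial_proj M)"
        by (intro allI ell2_Cauchy_Schwarz kl ell2_diff p(1) K)
      show "(\<lambda>M. ell2_norm G k * ell2_norm G (p - partial_proj M)) \<longlonglongrightarrow> 0"
        using tendsto_mult[OF tendsto_const p(2), of "ell2_norm G k"] by simp
    qed
    have "ell2_inner G k (?d - partial_proj M) - ell2_inner G k (p - partial_proj M) = ell2_inner G k (?d - p)" for M
      unfolding ell2_inner_diff_right[OF kl d K] ell2_inner_diff_right[OF kl p(1) K]
        ell2_inner_diff_right[OF kl d p(1)] by simp
    with tendsto_diff[OF lim0 lim1] have "ell2_inner G k (?d - p) = 0"
      by (simp only: LIMSEQ_const_iff diff_zero)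
    then show ?thesis unfolding ell2_inner_cnj[of G "?d - p"] by simp
  qed
  have "ell2_proj G kern ?d = p"
    by (rule ell2_proj_eqI[OF _ kern_diff d pk orth]) (auto simp: kern_def)
  then have vn: "vn_dim G kern = p \<one>"
    by (simp add: vn_dim_def vn_trace_def ell2_inner_delta)
  have "partial_proj M \<one> = complex_of_real (\<Sum>m<M. \<Sum>n<M. (1/2) ^ card (tested m n))" for M
    unfolding partial_proj_def sum_fun_apply kern_proj_at_one by simp
  then have lim: "(\<lambda>M. complex_of_real (\<Sum>m<M. \<Sum>n<M. (1/2) ^ card (tested m n))) \<longlonglongrightarrow> p \<one>"
    using p(3)[of \<one>] by simp
  from tendsto_Re[OF this] have re: "(\<lambda>M. \<Sum>m<M. \<Sum>n<M. (1/2) ^ card (tested m n)) \<longlonglongrightarrow> Re (p \<one>)"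
    by simp
  from tendsto_of_real[OF this] have peq: "p \<one> = complex_of_real (Re (p \<one>))"
    using LIMSEQ_unique[OF lim] by blast
  show ?thesis by (rule that[OF trans[OF vn peq] re])
qed

end

section \<open>The lamp group of an action\<close>

lemma odd_card_sym_diff:
  assumes "finite A" "finite B"
  shows "odd (card (sym_diff A B)) \<longleftrightarrow> odd (card A) \<noteq> odd (card B)"
proof -
  have "card A = card (A - B) + card (A \<inter> B)" "card B = card (B - A) + card (A \<inter> B)"
    using assms by (metis card_Diff_subset_Int card_mono finite_Int inf_le1 le_add_diff_inverse2 inf_commute)+
  moreover have "card (sym_diff A B) = card (A - B) + card (B - A)"
    using assms by (intro card_Un_disjoint) auto
  ultimately show ?thesis by auto
qed

locale lamp_action = F: group F for F :: "('f, 'c) monoid_scheme" (structure) +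
  fixes act :: "'f \<Rightarrow> 'x \<Rightarrow> 'x" and base :: 'x
  assumes act_one: "act \<one> x = x"
    and act_mult: "g \<in> carrier F \<Longrightarrow> h \<in> carrier F \<Longrightarrow> act (g \<otimes> h) x = act g (act h x)"
begin

abbreviation A :: "('f \<Rightarrow> int) monoid" where
  "A \<equiv> Z2_sum F"

definition lit :: "('f \<Rightarrow> int) \<Rightarrow> 'f set" where
  "lit u = {g \<in> carrier F. u g \<noteq> 0}"

definition parity :: "('f \<Rightarrow> int) \<Rightarrow> 'x set" where
  "parity u = {x. odd (card {g \<in> lit u. act g base = x})}"

text \<open>The map \<open>parity\<close> is a homomorphism onto the finite subsets of the orbit
  under symmetric difference. Its kernel \<open>fibre {}\<close> is V, and its fibres are the
  cosets, which turns the quotient into a group of lamp configurations.\<close>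

definition fibre :: "'x set \<Rightarrow> ('f \<Rightarrow> int) set" where
  "fibre C = {u \<in> carrier A. parity u = C}"

definition orbit :: "'x set" where
  "orbit = (\<lambda>g. act g base) ` carrier F"

abbreviation \<Gamma> :: "(('f \<Rightarrow> int) set \<times> 'f) monoid" where
  "\<Gamma> \<equiv> Z2_sum_quotient_semidirect F (fibre {})"

lemma act_inv: "g \<in> carrier F \<Longrightarrow> act g (act (inv g) x) = x" "g \<in> carrier F \<Longrightarrow> act (inv g) (act g x) = x"
  by (simp_all add: act_one flip: act_mult)

lemma carrier_A: "u \<in> carrier A \<longleftrightarrow> u \<in> extensional (carrier F) \<and> (\<forall>g\<in>carrier F. u g = 0 \<or> u g = 1) \<and> finite (lit u)"
  by (auto simp: carrier_sum_group PiE_iff lit_def carrier_integer_mod_group)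

lemma group_A: "group A"
  by simp

lemma lit_mult:
  assumes "u \<in> carrier A" "w \<in> carrier A"
  shows "lit (u \<otimes>\<^bsub>A\<^esub> w) = sym_diff (lit u) (lit w)"
proof -
  have "(u g + w g) mod 2 \<noteq> 0 \<longleftrightarrow> (u g \<noteq> 0) \<noteq> (w g \<noteq> 0)" if "g \<in> carrier F" for g
    using assms that unfolding carrier_A by force
  then show ?thesis by (auto simp: lit_def)
qed

lemma parity_mult:
  assumes "u \<in> carrier A" "w \<in> carrier A"
  shows "parity (u \<otimes>\<^bsub>A\<^esub> w) = sym_diff (parity u) (parity w)"
proof -
  have "odd (card {g \<in> lit (u \<otimes>\<^bsub>A\<^esub> w). act g base = x}) \<longleftrightarrow>
      odd (card {g \<in> lit u. act g base = x}) \<noteq> odd (card {g \<in> lit w. act g base = x})" for x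
  proof -
    have "{g \<in> lit (u \<otimes>\<^bsub>A\<^esub> w). act g base = x} =
        sym_diff {g \<in> lit u. act g base = x} {g \<in> lit w. act g base = x}"
      unfolding lit_mult[OF assms] by blast
    then show ?thesis
      using assms by (simp add: carrier_A odd_card_sym_diff del: mult_sum_group)
  qed
  then show ?thesis unfolding parity_def by blast
qed

lemma parity_one: "parity \<one>\<^bsub>A\<^esub> = {}"
  by (simp add: parity_def lit_def)

lemma parity_finite: "u \<in> carrier A \<Longrightarrow> finite (parity u) \<and> parity u \<subseteq> orbit"
proof -
  assume u: "u \<in> carrier A"
  have "parity u \<subseteq> (\<lambda>g. act g base) ` lit u"
  proof
    fix x assume "x \<in> parity u"
    then have "card {g \<in> lit u. act g base = x} \<noteq> 0" by (auto simp: parity_def intro: ccontr)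
    then have "{g \<in> lit u. act g base = x} \<noteq> {}" by (metis card.empty)
    then show "x \<in> (\<lambda>g. act g base) ` lit u" by blast
  qed
  moreover have "finite (lit u)" "lit u \<subseteq> carrier F" using u by (auto simp: carrier_A lit_def)
  ultimately show ?thesis unfolding orbit_def by (meson finite_imageI finite_subset image_mono order_trans)
qed

lemma parity_surj:
  assumes "finite C" "C \<subseteq> orbit"
  shows "\<exists>u\<in>carrier A. parity u = C"
  using assms
proof (induction C)
  case empty
  have "\<one>\<^bsub>A\<^esub> \<in> carrier A" by (rule monoid.one_closed[OF group.is_monoid[OF group_A]])
  then show ?case using parity_one by blast
next
  case (insert x C)
  then obtain u where u: "u \<in> carrier A" "parity u = C" by blast
  obtain g where g: "g \<in> carrier F" "act g base = x" using insert.prems by (auto simp: orbit_def)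
  define w where "w = (\<lambda>h\<in>carrier F. if h = g then 1 else 0 :: int)"
  have lit: "lit w = {g}" using g by (auto simp: lit_def w_def)
  have w: "w \<in> carrier A" unfolding carrier_A lit by (auto simp: w_def)
  have "{h \<in> {g}. act h base = y} = (if y = x then {g} else {})" for y using g by auto
  then have "odd (card {h \<in> {g}. act h base = y}) \<longleftrightarrow> y = x" for y
    by (cases "y = x") simp_all
  then have px: "parity w = {x}" unfolding parity_def lit by blast
  have "parity (u \<otimes>\<^bsub>A\<^esub> w) = insert x C"
    unfolding parity_mult[OF u(1) w] u(2) px using insert.hyps by blast
  then show ?case
    using monoid.m_closed[OF group.is_monoid[OF group_A] u(1) w] by blast
qed

lemma parity_inv: "u \<in> carrier A \<Longrightarrow> parity (inv\<^bsub>A\<^esub> u) = parity u"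
proof -
  assume u: "u \<in> carrier A"
  interpret A: group A by (rule group_A)
  have "sym_diff (parity u) (parity (inv\<^bsub>A\<^esub> u)) = {}"
    using parity_mult[OF u A.inv_closed[OF u]] parity_one A.r_inv[OF u] by metis
  then show ?thesis by blast
qed

lemma subgroup_fibre: "subgroup (fibre {}) A"
proof -
  interpret A: group A by (rule group_A)
  show ?thesis
  proof (rule A.subgroupI)
    show "fibre {} \<subseteq> carrier A" by (auto simp: fibre_def)
    show "fibre {} \<noteq> {}" using parity_one A.one_closed unfolding fibre_def by blast
    show "inv\<^bsub>A\<^esub> u \<in> fibre {}" if "u \<in> fibre {}" for u
      using that parity_inv A.inv_closed unfolding fibre_def by simp
    show "u \<otimes>\<^bsub>A\<^esub> w \<in> fibre {}" if "u \<in> fibre {}" "w \<in> fibre {}" for u w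
      using that parity_mult A.m_closed unfolding fibre_def by simp
  qed
qed

lemma normal_fibre: "fibre {} \<lhd> A"
proof -
  interpret A: comm_group A
    by (rule group.group_comm_groupI) (auto simp: add.commute fun_eq_iff)
  show ?thesis using subgroup_fibre A.subgroup_imp_normal by blast
qed

lemma parity_translate:
  assumes g: "g \<in> carrier F"
  shows "parity (translate F g u) = act g ` parity u"
proof -
  have "card {h \<in> lit (translate F g u). act h base = x} = card {h \<in> lit u. act h base = act (inv g) x}" for x
  proof (rule bij_betw_same_card)
    show "bij_betw (\<lambda>h. inv g \<otimes> h) {h \<in> lit (translate F g u). act h base = x}
        {h \<in> lit u. act h base = act (inv g) x}"
    proof (rule bij_betw_byWitness[where f' = "\<lambda>h. g \<otimes> h"])
      show "(\<lambda>h. inv g \<otimes> h) ` {h \<in> lit (translate F g u). act h base = x} \<subseteq> {h \<in> lit u. act h base = act (inv g) x}"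
        using g by (auto simp: lit_def translate_def act_mult)
      show "(\<lambda>h. g \<otimes> h) ` {h \<in> lit u. act h base = act (inv g) x} \<subseteq> {h \<in> lit (translate F g u). act h base = x}"
        using g by (auto simp: lit_def translate_def act_mult act_inv F.m_assoc[symmetric])
    qed (use g in \<open>auto simp: lit_def F.m_assoc[symmetric]\<close>)
  qed
  then have "x \<in> parity (translate F g u) \<longleftrightarrow> act (inv g) x \<in> parity u" for x
    by (simp add: parity_def)
  moreover have "act (inv g) x \<in> parity u \<longleftrightarrow> x \<in> act g ` parity u" for x
    using act_inv[OF g] by (metis imageE imageI)
  ultimately show ?thesis by blast
qed

lemma translation_invariant_fibre: "translation_invariant F (fibre {})"
  unfolding translation_invariant_def fibre_def
  using translate_closed[OF F.is_group] by (auto simp: parity_translate)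

lemma group_\<Gamma>: "group \<Gamma>"
  by (rule group_Z2_sum_quotient_semidirect[OF F.is_group subgroup_fibre translation_invariant_fibre])

lemma translate_fibre:
  assumes g: "g \<in> carrier F"
  shows "translate F g ` fibre C = fibre (act g ` C)"
proof
  show "translate F g ` fibre C \<subseteq> fibre (act g ` C)"
    using g translate_closed[OF F.is_group g] by (auto simp: fibre_def parity_translate)
  show "fibre (act g ` C) \<subseteq> translate F g ` fibre C"
  proof
    fix u assume u: "u \<in> fibre (act g ` C)"
    then have uA: "u \<in> carrier A" by (simp add: fibre_def)
    have "act (inv g) ` act g ` C = C" using g by (simp add: image_image act_inv)
    then have "translate F (inv g) u \<in> fibre C"
      using u g translate_closed[OF F.is_group F.inv_closed[OF g] uA]
      by (simp add: fibre_def parity_translate)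
    moreover have "u = translate F g (translate F (inv g) u)"
      using translate_translate[OF F.is_group g F.inv_closed[OF g], of u] translate_one[OF F.is_group uA] g by simp
    ultimately show "u \<in> translate F g ` fibre C" by blast
  qed
qed

lemma rcoset_fibre:
  assumes u: "u \<in> carrier A"
  shows "fibre {} #>\<^bsub>A\<^esub> u = fibre (parity u)"
proof -
  interpret A: group A by (rule group_A)
  show ?thesis
  proof
    show "fibre {} #>\<^bsub>A\<^esub> u \<subseteq> fibre (parity u)"
    proof
      fix w assume "w \<in> fibre {} #>\<^bsub>A\<^esub> u"
      then obtain v where v: "v \<in> carrier A" "parity v = {}" "w = v \<otimes>\<^bsub>A\<^esub> u"
        unfolding r_coset_def fibre_def by blast
      then show "w \<in> fibre (parity u)"
        using parity_mult[OF v(1) u] A.m_closed[OF v(1) u] by (simp add: fibre_def)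
    qed
    show "fibre (parity u) \<subseteq> fibre {} #>\<^bsub>A\<^esub> u"
    proof
      fix w assume "w \<in> fibre (parity u)"
      then have w: "w \<in> carrier A" "parity w = parity u" by (auto simp: fibre_def)
      let ?v = "w \<otimes>\<^bsub>A\<^esub> inv\<^bsub>A\<^esub> u"
      have "?v \<in> fibre {}"
        using parity_mult[OF w(1) A.inv_closed[OF u]] parity_inv[OF u] w A.m_closed[OF w(1) A.inv_closed[OF u]]
        by (simp add: fibre_def)
      moreover have "w = ?v \<otimes>\<^bsub>A\<^esub> u"
        unfolding A.m_assoc[OF w(1) A.inv_closed[OF u] u] A.l_inv[OF u] A.r_one[OF w(1)] ..
      ultimately show "w \<in> fibre {} #>\<^bsub>A\<^esub> u" unfolding r_coset_def by blast
    qed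
  qed
qed

lemma fibre_mult:
  assumes "finite C" "C \<subseteq> orbit" "finite D" "D \<subseteq> orbit"
  shows "fibre C <#>\<^bsub>A\<^esub> fibre D = fibre (sym_diff C D)"
proof -
  interpret A: group A by (rule group_A)
  obtain u w where u: "u \<in> carrier A" "parity u = C" and w: "w \<in> carrier A" "parity w = D"
    using parity_surj assms by metis
  have "(fibre {} #>\<^bsub>A\<^esub> u) <#>\<^bsub>A\<^esub> (fibre {} #>\<^bsub>A\<^esub> w) = fibre {} #>\<^bsub>A\<^esub> (u \<otimes>\<^bsub>A\<^esub> w)"
    by (rule normal.rcos_sum[OF normal_fibre u(1) w(1)])
  then show ?thesis
    unfolding rcoset_fibre[OF u(1)] rcoset_fibre[OF w(1)] rcoset_fibre[OF A.m_closed[OF u(1) w(1)]]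
      parity_mult[OF u(1) w(1)] u(2) w(2) .
qed

lemma carrier_quotient: "carrier (A Mod fibre {}) = fibre ` {C. finite C \<and> C \<subseteq> orbit}"
proof -
  have "carrier (A Mod fibre {}) = (\<lambda>u. fibre (parity u)) ` carrier A"
    unfolding carrier_FactGroup by (rule image_cong[OF refl]) (rule rcoset_fibre)
  also have "\<dots> = fibre ` parity ` carrier A" by (simp only: image_image)
  also have "parity ` carrier A = {C. finite C \<and> C \<subseteq> orbit}"
  proof (intro equalityI subsetI)
    fix C assume "C \<in> {C. finite C \<and> C \<subseteq> orbit}"
    then obtain u where "u \<in> carrier A" "parity u = C" using parity_surj[of C] by blast
    then show "C \<in> parity ` carrier A" by blast
  qed (use parity_finite in blast)
  finally show ?thesis .
qed

lemma fibre_inj: "finite C \<Longrightarrow> C \<subseteq> orbit \<Longrightarrow> fibre C = fibre D \<Longrightarrow> C = D"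
  using parity_surj[of C] unfolding fibre_def by blast

lemma carrier_\<Gamma>: "carrier \<Gamma> = (fibre ` {C. finite C \<and> C \<subseteq> orbit}) \<times> carrier F"
  by (simp add: Z2_sum_quotient_semidirect_def semidirect_def carrier_quotient)

lemma one_\<Gamma>: "\<one>\<^bsub>\<Gamma>\<^esub> = (fibre {}, \<one>)"
  by (simp add: Z2_sum_quotient_semidirect_def semidirect_def)

lemma act_orbit: "g \<in> carrier F \<Longrightarrow> C \<subseteq> orbit \<Longrightarrow> act g ` C \<subseteq> orbit"
  unfolding orbit_def by (auto simp flip: act_mult)

lemma mult_\<Gamma>:
  assumes "finite C" "C \<subseteq> orbit" "finite D" "D \<subseteq> orbit" "g \<in> carrier F" "h \<in> carrier F"
  shows "(fibre C, g) \<otimes>\<^bsub>\<Gamma>\<^esub> (fibre D, h) = (fibre (sym_diff (act (inv h) ` C) D), g \<otimes> h)"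
proof -
  have "act (inv h) ` C \<subseteq> orbit" by (rule act_orbit) (use assms in auto)
  then show ?thesis
    using assms by (simp add: Z2_sum_quotient_semidirect_def semidirect_def translate_fibre fibre_mult)
qed

definition lamp :: "'x set \<Rightarrow> ('f \<Rightarrow> int) set \<times> 'f" where
  "lamp C = (fibre C, \<one>)"

definition shift :: "'f \<Rightarrow> ('f \<Rightarrow> int) set \<times> 'f" where
  "shift g = (fibre {}, g)"

lemma shift_mult: "g \<in> carrier F \<Longrightarrow> h \<in> carrier F \<Longrightarrow> shift g \<otimes>\<^bsub>\<Gamma>\<^esub> shift h = shift (g \<otimes> h)"
  by (simp add: shift_def mult_\<Gamma>)

text \<open>With this convention for the semidirect product, a pair factors as shift times lamp. In
  the opposite order the lamps are moved by the inverse group element.\<close>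

lemma shift_lamp: "finite C \<Longrightarrow> C \<subseteq> orbit \<Longrightarrow> g \<in> carrier F \<Longrightarrow> shift g \<otimes>\<^bsub>\<Gamma>\<^esub> lamp C = (fibre C, g)"
  by (simp add: shift_def lamp_def mult_\<Gamma> act_one)

lemma lamp_shift:
  "finite C \<Longrightarrow> C \<subseteq> orbit \<Longrightarrow> g \<in> carrier F \<Longrightarrow> lamp C \<otimes>\<^bsub>\<Gamma>\<^esub> shift g = (fibre (act (inv g) ` C), g)"
  by (simp add: shift_def lamp_def mult_\<Gamma>)

lemma act_base_orbit: "g \<in> carrier F \<Longrightarrow> act g base \<in> orbit"
  by (auto simp: orbit_def)

lemma base_orbit: "base \<in> orbit"
  using act_base_orbit[OF F.one_closed] by (simp add: act_one)

lemma lamps_\<Gamma>: "lamps \<Gamma> lamp orbit"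
proof (intro lamps.intro lamps_axioms.intro group_\<Gamma>)
  show "lamp C \<in> carrier \<Gamma>" if "finite C" "C \<subseteq> orbit" for C
    using that by (simp add: lamp_def carrier_\<Gamma>)
  show "lamp {} = \<one>\<^bsub>\<Gamma>\<^esub>" by (simp add: lamp_def one_\<Gamma>)
  show "lamp C \<otimes>\<^bsub>\<Gamma>\<^esub> lamp D = lamp (sym_diff C D)"
    if "finite C" "C \<subseteq> orbit" "finite D" "D \<subseteq> orbit" for C D
    using that by (simp add: lamp_def mult_\<Gamma> act_one)
  show "C = {}" if "finite C" "C \<subseteq> orbit" "lamp C = \<one>\<^bsub>\<Gamma>\<^esub>" for C
    using that fibre_inj by (auto simp: lamp_def one_\<Gamma>)
qed

lemma implements_shift:
  assumes g: "g \<in> carrier F"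
  shows "lamps.implements \<Gamma> lamp orbit (shift g) (act g) (act (inv g))"
proof (rule lamps.implementsI[OF lamps_\<Gamma>])
  show "shift g \<in> carrier \<Gamma>" using g by (auto simp: shift_def carrier_\<Gamma>)
  show "act g x \<in> orbit" if "x \<in> orbit" for x using act_orbit[OF g, of "{x}"] that by simp
  show "act (inv g) x \<in> orbit" if "x \<in> orbit" for x
    using act_orbit[OF F.inv_closed[OF g], of "{x}"] that by simp
  show "shift g \<otimes>\<^bsub>\<Gamma>\<^esub> lamp C = lamp (act g ` C) \<otimes>\<^bsub>\<Gamma>\<^esub> shift g"
    if C: "finite C" "C \<subseteq> orbit" for C
  proof -
    have "act (inv g) ` act g ` C = C" using g by (simp add: image_image act_inv)
    then show ?thesis
      using shift_lamp[OF C g] lamp_shift[OF finite_imageI[OF C(1)] act_orbit[OF g C(2)] g] by simp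
  qed
qed (use g act_inv in auto)

text \<open>One lamp at the base point suffices: conjugation by shifts carries it to every point of
  the orbit.\<close>

lemma finitely_generated_\<Gamma>:
  assumes S: "finite S" "S \<subseteq> carrier F" "generate F S = carrier F"
  shows "finitely_generated \<Gamma>"
proof -
  interpret \<Gamma>: lamps \<Gamma> lamp orbit by (rule lamps_\<Gamma>)
  let ?S = "insert (lamp {base}) (shift ` S)"
  have SG: "?S \<subseteq> carrier \<Gamma>"
    using S(2) base_orbit by (auto simp: lamp_def shift_def carrier_\<Gamma>)
  interpret H: subgroup "generate \<Gamma> ?S" \<Gamma> by (rule \<Gamma>.generate_is_subgroup[OF SG])
  have shift_inv: "inv\<^bsub>\<Gamma>\<^esub> (shift g) = shift (inv g)" if g: "g \<in> carrier F" for g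
  proof (rule \<Gamma>.inv_equality)
    show "shift (inv g) \<otimes>\<^bsub>\<Gamma>\<^esub> shift g = \<one>\<^bsub>\<Gamma>\<^esub>"
      using g by (simp add: shift_mult) (simp add: shift_def one_\<Gamma>)
  qed (use g in \<open>auto simp: shift_def carrier_\<Gamma>\<close>)
  have shift: "shift g \<in> generate \<Gamma> ?S" if "g \<in> generate F S" for g
    using that
  proof (induction g rule: generate.induct)
    case one
    have "shift \<one> = \<one>\<^bsub>\<Gamma>\<^esub>" by (simp add: shift_def one_\<Gamma>)
    then show ?case using H.one_closed by simp
  next
    case (incl h)
    then show ?case by (intro generate.incl) simp
  next
    case (inv h)
    then have "inv\<^bsub>\<Gamma>\<^esub> (shift h) \<in> generate \<Gamma> ?S" by (intro generate.inv) simp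
    then show ?case using shift_inv inv S(2) by auto
  next
    case (eng h1 h2)
    have "h1 \<in> carrier F" "h2 \<in> carrier F"
      using eng.hyps F.generate_in_carrier[OF S(2)] by auto
    then show ?case using H.m_closed[OF eng.IH] shift_mult by simp
  qed
  have lamp1: "lamp {x} \<in> generate \<Gamma> ?S" if x: "x \<in> orbit" for x
  proof -
    obtain g where g: "g \<in> carrier F" "x = act g base" using x by (auto simp: orbit_def)
    have c: "shift g \<in> carrier \<Gamma>" "lamp {x} \<in> carrier \<Gamma>"
      using g(1) x by (auto simp: shift_def lamp_def carrier_\<Gamma>)
    have e: "shift g \<otimes>\<^bsub>\<Gamma>\<^esub> lamp {base} = lamp {x} \<otimes>\<^bsub>\<Gamma>\<^esub> shift g"
      using \<Gamma>.implementsD(6)[OF implements_shift[OF g(1)], of "{base}"] g base_orbit by simp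
    have "lamp {x} = (shift g \<otimes>\<^bsub>\<Gamma>\<^esub> lamp {base}) \<otimes>\<^bsub>\<Gamma>\<^esub> inv\<^bsub>\<Gamma>\<^esub> (shift g)"
      unfolding e using c by (simp add: \<Gamma>.m_assoc)
    moreover have "shift g \<in> generate \<Gamma> ?S" using shift g S(3) by simp
    moreover have "lamp {base} \<in> generate \<Gamma> ?S" by (rule generate.incl) simp
    ultimately show ?thesis by (simp add: H.m_closed H.m_inv_closed)
  qed
  have lamp: "lamp C \<in> generate \<Gamma> ?S" if "finite C" "C \<subseteq> orbit" for C
    using that
  proof (induction C)
    case empty
    then show ?case using \<Gamma>.s_empty H.one_closed by simp
  next
    case (insert x C)
    have "lamp {x} \<otimes>\<^bsub>\<Gamma>\<^esub> lamp C = lamp (sym_diff {x} C)"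
      by (rule \<Gamma>.s_mult) (use insert in auto)
    also have "sym_diff {x} C = insert x C" using insert.hyps by auto
    finally have e: "lamp (insert x C) = lamp {x} \<otimes>\<^bsub>\<Gamma>\<^esub> lamp C" by (rule sym)
    show ?case
      unfolding e by (rule H.m_closed[OF lamp1 insert.IH]) (use insert.prems in auto)
  qed
  have "carrier \<Gamma> \<subseteq> generate \<Gamma> ?S"
  proof
    fix y assume "y \<in> carrier \<Gamma>"
    then obtain C g where y: "y = (fibre C, g)" "finite C" "C \<subseteq> orbit" "g \<in> carrier F"
      by (cases y) (auto simp: carrier_\<Gamma>)
    have "shift g \<otimes>\<^bsub>\<Gamma>\<^esub> lamp C \<in> generate \<Gamma> ?S"
      by (rule H.m_closed[OF shift lamp]) (use y S(3) in auto)
    then show "y \<in> generate \<Gamma> ?S" unfolding y(1) shift_lamp[OF y(2-4)] .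
  qed
  then have "generate \<Gamma> ?S = carrier \<Gamma>"
    using H.subset by blast
  then show ?thesis
    unfolding finitely_generated_def using S(1) SG by (intro exI[of _ ?S]) simp
qed

end

section \<open>Words acting through two permutations\<close>

context walk
begin

definition letter_act :: "bool \<times> bool \<Rightarrow> 'x \<Rightarrow> 'x" where
  "letter_act l = (if fst l then if snd l then \<beta> else \<beta>i else if snd l then \<alpha> else \<alpha>i)"

definition word_act :: "(bool \<times> bool) list \<Rightarrow> 'x \<Rightarrow> 'x" where
  "word_act w x = foldr letter_act w x"

lemma word_act_simps: "word_act [] x = x" "word_act (l # w) x = letter_act l (word_act w x)"
  by (simp_all add: word_act_def)

lemma letter_act_inv: "letter_act l (letter_act (letter_inv l) x) = x"
  by (simp add: letter_act_def letter_inv_def \<alpha>_inv \<beta>_inv)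

lemma word_act_push: "word_act (push l w) x = letter_act l (word_act w x)"
  by (auto simp: push_def word_act_simps letter_act_inv split: list.splits)

lemma word_act_mult: "word_act (foldr push v w) x = word_act v (word_act w x)"
  by (induction v) (simp_all add: word_act_push word_act_simps)

text \<open>Free reduction only removes mutually inverse letters, so an arbitrary pair of
  permutations defines an action. The actions constructed below exploit this freedom.\<close>

lemma lamp_action_F2: "lamp_action F2 word_act"
proof (intro lamp_action.intro lamp_action_axioms.intro group_free_group)
  show "word_act \<one>\<^bsub>F2\<^esub> x = x" for x by (simp add: free_group_def word_act_simps)
  show "word_act (g \<otimes>\<^bsub>F2\<^esub> h) x = word_act g (word_act h x)" for g h x
    by (simp add: free_group_def word_act_mult)
qed

end

section \<open>Powers and generators in the group of reduced words\<close>

lemma mult_F2: "v \<otimes>\<^bsub>F2\<^esub> w = foldr push v w" and one_F2: "\<one>\<^bsub>F2\<^esub> = []"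
  and carrier_F2: "w \<in> carrier F2 \<longleftrightarrow> Defs.reduced w"
  by (simp_all add: free_group_def)

lemma letter_F2: "[l] \<in> carrier F2"
  by (simp add: carrier_F2 Defs.reduced_def)

lemma inv_letter_F2: "inv\<^bsub>F2\<^esub> [l] = [letter_inv l]"
  by (rule group.inv_equality[OF group_free_group])
     (simp_all add: letter_F2 mult_F2 one_F2 push_def)

lemma push_replicate: "push l (replicate n l) = replicate (Suc n) l"
  by (cases n) (auto simp: push_def letter_inv_def prod_eq_iff)

lemma foldr_push_replicate: "foldr push (replicate n l) [l] = replicate (Suc n) l"
proof (induction n)
  case (Suc n)
  have "foldr push (replicate (Suc n) l) [l] = push l (foldr push (replicate n l) [l])"
    by (simp only: replicate_Suc foldr.simps o_apply)
  then show ?case unfolding Suc.IH push_replicate .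
qed simp

lemma reduced_replicate: "Defs.reduced (replicate n l)"
  by (induction n) (auto simp: Defs.reduced_def successively_Cons letter_inv_def prod_eq_iff)

lemma generate_F2: "generate F2 {[(False, True)], [(True, True)]} = carrier F2"
proof -
  interpret F2: group F2 by (rule group_free_group)
  let ?S = "{[(False, True)], [(True, True)]} :: (bool \<times> bool) list set"
  have S: "?S \<subseteq> carrier F2" by (simp add: letter_F2)
  interpret H: subgroup "generate F2 ?S" F2 by (rule F2.generate_is_subgroup[OF S])
  have letter: "[l] \<in> generate F2 ?S" for l
  proof (cases "snd l")
    case True
    then have "[l] \<in> ?S" by (cases l) auto
    then show ?thesis by (rule generate.incl)
  next
    case False
    then have "[letter_inv l] \<in> ?S" by (cases l) (auto simp: letter_inv_def)
    then have "inv\<^bsub>F2\<^esub> [letter_inv l] \<in> generate F2 ?S" by (rule generate.inv)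
    then show ?thesis by (simp add: inv_letter_F2)
  qed
  have "w \<in> generate F2 ?S" if "Defs.reduced w" for w
    using that
  proof (induction w)
    case Nil
    then show ?case using H.one_closed by (simp add: one_F2)
  next
    case (Cons l w)
    have "Defs.reduced w" using Cons.prems by (cases w) (auto simp: Defs.reduced_def)
    then have "[l] \<otimes>\<^bsub>F2\<^esub> w \<in> generate F2 ?S" using Cons.IH H.m_closed[OF letter] by blast
    moreover have "[l] \<otimes>\<^bsub>F2\<^esub> w = l # w"
      using Cons.prems by (cases w) (auto simp: mult_F2 push_def Defs.reduced_def)
    ultimately show ?case by simp
  qed
  then show ?thesis using H.subset carrier_F2 by blast
qed

text \<open>Hides V and Q behind the real value of the dimension, so that the final counting
  argument concerns real numbers only.\<close>

definition attained :: "real \<Rightarrow> bool" where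
  "attained d \<longleftrightarrow> (\<exists>V Q. subgroup V (Z2_sum F2) \<and> translation_invariant F2 V \<and>
     finitely_generated (Z2_sum_quotient_semidirect F2 V) \<and>
     Q \<in> rat_group_ring (Z2_sum_quotient_semidirect F2 V) \<and>
     vn_dim (Z2_sum_quotient_semidirect F2 V) (ell2_kernel (Z2_sum_quotient_semidirect F2 V) Q) =
       complex_of_real d)"

section \<open>The dimension formula for actions of the free group\<close>

context walk
begin

interpretation F2: lamp_action F2 word_act base by (rule lamp_action_F2)

lemma shift_letter_pow:
  "F2.shift [l] [^]\<^bsub>F2.\<Gamma>\<^esub> n = F2.shift (replicate n l)"
proof (induction n)
  case 0
  show ?case by (simp add: F2.shift_def F2.one_\<Gamma> one_F2 monoid.nat_pow_0[OF group.is_monoid[OF F2.group_\<Gamma>]])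
next
  case (Suc n)
  have "F2.shift [l] [^]\<^bsub>F2.\<Gamma>\<^esub> Suc n = F2.shift (replicate n l) \<otimes>\<^bsub>F2.\<Gamma>\<^esub> F2.shift [l]"
    unfolding Suc[symmetric] by (rule monoid.nat_pow_Suc[OF group.is_monoid[OF F2.group_\<Gamma>]])
  also have "\<dots> = F2.shift (replicate (Suc n) l)"
    unfolding foldr_push_replicate[symmetric] mult_F2[symmetric]
    by (rule F2.shift_mult[OF _ letter_F2]) (simp only: carrier_F2 reduced_replicate)
  finally show ?case .
qed

lemma walk_lamps_F2:
  "walk_lamps F2.\<Gamma> F2.lamp F2.orbit \<alpha> \<alpha>i \<beta> \<beta>i base (F2.shift [(False, True)]) (F2.shift [(True, True)])"
proof (intro walk_lamps.intro walk_lamps_axioms.intro F2.lamps_\<Gamma> walk_axioms F2.base_orbit)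
  have act: "word_act [l] = letter_act l" for l
    by (rule ext) (simp add: word_act_simps)
  show "lamps.implements F2.\<Gamma> F2.lamp F2.orbit (F2.shift [(False, True)]) \<alpha> \<alpha>i"
    using F2.implements_shift[OF letter_F2, of "(False, True)"]
    by (simp add: inv_letter_F2 act letter_inv_def letter_act_def)
  show "lamps.implements F2.\<Gamma> F2.lamp F2.orbit (F2.shift [(True, True)]) \<beta> \<beta>i"
    using F2.implements_shift[OF letter_F2, of "(True, True)"]
    by (simp add: inv_letter_F2 act letter_inv_def letter_act_def)
qed

text \<open>The second component compares the words themselves, and powers of different generators
  agree only when both are trivial. Once the words agree, the first component forces the lamps to be
  off.\<close>

lemma arms_free_F2:
  fixes t z :: int
  defines "arm \<equiv> walk_lamps.arm_elt F2.\<Gamma> (F2.shift [(False, True)]) (F2.shift [(True, True)])"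
  assumes C: "finite C" "C \<subseteq> F2.orbit" and eq: "F2.lamp C \<otimes>\<^bsub>F2.\<Gamma>\<^esub> arm t = arm z"
  shows "C = {} \<and> t = z"
proof -
  define word where "word z = (if 0 \<le> z then replicate (nat z) (False, True) else replicate (nat (-z)) (True, True))"
    for z :: int
  have arm: "arm z = F2.shift (word z)" for z
    unfolding arm_def walk_lamps.arm_elt_def[OF walk_lamps_F2] word_def
    by (cases "0 \<le> z") (simp_all only: if_True if_False shift_letter_pow)
  have word: "word z \<in> carrier F2" for z
    by (simp add: word_def carrier_F2 reduced_replicate)
  have eq2: "(F2.fibre (word_act (inv\<^bsub>F2\<^esub> (word t)) ` C), word t) = (F2.fibre {}, word z)"
    using eq unfolding arm F2.lamp_shift[OF C word] unfolding F2.shift_def .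
  have f: "F2.fibre {} = F2.fibre (word_act (inv\<^bsub>F2\<^esub> (word t)) ` C)"
    using arg_cong[OF eq2, of fst] unfolding fst_conv by (rule sym)
  have w: "word t = word z"
    using arg_cong[OF eq2, of snd] unfolding snd_conv .
  have "{} = word_act (inv\<^bsub>F2\<^esub> (word t)) ` C"
    by (rule F2.fibre_inj[OF finite.emptyI empty_subsetI f])
  then have "C = {}" by simp
  moreover have "t = z"
  proof (cases "0 \<le> t \<longleftrightarrow> 0 \<le> z")
    case True
    have "length (word t) = length (word z)" using w by simp
    then show ?thesis using True by (auto simp: word_def split: if_splits)
  next
    case False
    have "(True, True) \<in> set (word z) \<longleftrightarrow> z < 0" for z
      by (simp add: word_def)
    then show ?thesis using False arg_cong[OF w, of set] by (metis not_le)
  qed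
  ultimately show ?thesis ..
qed

lemma F2_vn_dim:
  assumes inj: "inj (\<lambda>k. (\<alpha> ^^ k) base)" "inj (\<lambda>k. (\<beta> ^^ k) base)"
    and disj: "\<And>m n. ones m n \<inter> zeros m n = {}"
  obtains d where "attained d"
    "(\<lambda>M. \<Sum>m<M. \<Sum>n<M. (1/2) ^ card (ones m n \<union> zeros m n)) \<longlonglongrightarrow> d"
proof -
  have free: "free_walk_lamps F2.\<Gamma> F2.lamp F2.orbit \<alpha> \<alpha>i \<beta> \<beta>i base (F2.shift [(False, True)]) (F2.shift [(True, True)])"
    by (intro free_walk_lamps.intro free_walk_lamps_axioms.intro walk_lamps_F2 assms arms_free_F2)
  let ?K = "walk_lamps.kern F2.\<Gamma> F2.lamp F2.orbit \<alpha> \<alpha>i \<beta> \<beta>i base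
    (F2.shift [(False, True)]) (F2.shift [(True, True)])"
  obtain d where d: "vn_dim F2.\<Gamma> ?K = complex_of_real d"
    "(\<lambda>M. \<Sum>m<M. \<Sum>n<M. (1/2) ^ card (ones m n \<union> zeros m n)) \<longlonglongrightarrow> d"
    using free_walk_lamps.vn_dim_kern[OF free] .
  obtain Q where Q: "Q \<in> rat_group_ring F2.\<Gamma>" "ell2_kernel F2.\<Gamma> Q = ?K"
    using walk_lamps.kern_eq_ell2_kernel[OF walk_lamps_F2] .
  have fg: "finitely_generated F2.\<Gamma>"
    by (rule F2.finitely_generated_\<Gamma>[OF _ _ generate_F2]) (simp_all add: letter_F2)
  have vd: "vn_dim F2.\<Gamma> (ell2_kernel F2.\<Gamma> Q) = complex_of_real d"
    by (simp only: Q(2) d(1))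
  have "attained d"
    unfolding attained_def
    by (rule exI[of _ "F2.fibre {}"], rule exI[of _ Q])
       (intro conjI F2.subgroup_fibre F2.translation_invariant_fibre fg Q(1) vd)
  then show ?thesis using d(2) by (rule that)
qed

end

section \<open>A family of actions of the free group\<close>

abbreviation origin :: "bool \<times> int \<times> int" where
  "origin \<equiv> (False, 0, 0)"

context
  fixes I :: "nat set"
begin

text \<open>The coordinates of \<open>x\<^sub>0\<close>, \<open>a x\<^sub>0\<close>,
  \<open>a\<^sup>-\<^sup>1 x\<^sub>0\<close>, \<open>b x\<^sub>0\<close> and
  \<open>b\<^sup>-\<^sup>1 x\<^sub>0\<close>. In every one of these actions they lie on a horizontal
  and on a vertical line; on them \<open>glue\<close> exchanges the two coordinates.\<close>

definition plus_shaped :: "int \<Rightarrow> int \<Rightarrow> bool" where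
  "plus_shaped i t \<longleftrightarrow> (i = 0 \<and> \<bar>t\<bar> \<le> 1) \<or> (t = 0 \<and> \<bar>i\<bar> \<le> 1)"

text \<open>The optional coincidences. The number n in \<open>I\<close> is placed at i = n + 1
  because i = 0 would be one of the plus-shaped points.\<close>

definition linked :: "int \<Rightarrow> int \<Rightarrow> bool" where
  "linked i t \<longleftrightarrow> t = 1 \<and> 1 \<le> i \<and> nat (i - 1) \<in> I"

text \<open>The orbit consists of horizontal lines \<open>a\<^sup>i x\<^sub>0\<close>, \<open>a\<^sup>i b x\<^sub>0\<close>, \<open>a\<^sup>i b\<^sup>-\<^sup>1 x\<^sub>0\<close> and vertical lines
  \<open>b\<^sup>i x\<^sub>0\<close>, \<open>b\<^sup>i a x\<^sub>0\<close>, \<open>b\<^sup>i a\<^sup>-\<^sup>1 x\<^sub>0\<close>. The point with coordinate \<open>i\<close> on the horizontal line of height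
  \<open>t\<close> is \<open>(False, i, t)\<close>, and \<open>glue\<close> sends it to the corresponding point of a vertical line.\<close>

fun glue :: "bool \<times> int \<times> int \<Rightarrow> bool \<times> int \<times> int" where
  "glue (k, i, t) =
     (if plus_shaped i t then (if k then (k, i, t) else (k, t, i))
      else if linked i t then (k, i, t) else (\<not> k, i, t))"

fun slide :: "int \<Rightarrow> bool \<times> int \<times> int \<Rightarrow> bool \<times> int \<times> int" where
  "slide d (k, i, t) = (if k then (k, i, t) else (k, i + d, t))"

text \<open>The generator \<open>b\<close> acts as the conjugate of \<open>a\<close> by an
  involution. It is thus a permutation for every \<open>I\<close>, and each statement about the
  second arm is the image under \<open>glue\<close> of one about the first.\<close>

definition glued_slide :: "int \<Rightarrow> bool \<times> int \<times> int \<Rightarrow> bool \<times> int \<times> int" where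
  "glued_slide d x = glue (slide d (glue x))"

lemma plus_shaped_swap: "plus_shaped i t \<Longrightarrow> plus_shaped t i"
  by (auto simp: plus_shaped_def)

lemma glue_glue [simp]: "glue (glue x) = x"
  by (cases x) (auto dest: plus_shaped_swap)

lemma inj_glue: "inj glue"
  by (metis glue_glue injI)

lemma slide_slide [simp]: "slide d (slide e x) = slide (e + d) x"
  by (cases x) auto

lemma slide_0 [simp]: "slide 0 x = x"
  by (cases x) auto

lemma slide_pow: "(slide d ^^ n) x = slide (of_nat n * d) x"
  by (induction n) (simp_all add: algebra_simps)

lemma glued_slide_pow: "(glued_slide d ^^ n) x = glue (slide (of_nat n * d) (glue x))"
  by (induction n) (simp_all add: glued_slide_def algebra_simps)

lemma walk_glued: "walk (slide 1) (slide (-1)) (glued_slide 1) (glued_slide (-1))"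
  by unfold_locales (simp_all add: glued_slide_def)


definition arm_ones :: "nat \<Rightarrow> (bool \<times> int \<times> int) set" where
  "arm_ones m = (\<lambda>i. (False, int i, 0)) ` {..m}"

definition arm_zeros :: "nat \<Rightarrow> (bool \<times> int \<times> int) set" where
  "arm_zeros m = {(False, -1, 0), (False, int m + 1, 0)} \<union>
     (\<lambda>i. (False, int i, 1)) ` {1..m} \<union> (\<lambda>i. (False, int i, -1)) ` {1..m}"

interpretation W: walk "slide 1" "slide (-1)" "glued_slide 1" "glued_slide (-1)" origin
  by (rule walk_glued)

lemma glue_plus: "glue origin = origin" "glue (False, 1, 0) = (False, 0, 1)" "glue (False, -1, 0) = (False, 0, -1)"
  "glue (False, 0, 1) = (False, 1, 0)" "glue (False, 0, -1) = (False, -1, 0)"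
  by (simp_all add: plus_shaped_def)

lemma pow_origin: "(slide 1 ^^ k) origin = (False, int k, 0)" "(glued_slide 1 ^^ k) origin = glue (False, int k, 0)"
  by (simp_all add: slide_pow glued_slide_pow glue_plus del: glue.simps)

lemma ones_eq: "W.ones m n = arm_ones m \<union> glue ` arm_ones n"
  unfolding W.ones_def arm_ones_def pow_origin image_image ..

lemma zeros_eq: "W.zeros m n = arm_zeros m \<union> glue ` arm_zeros n"
proof -
  have 1: "(slide 1 ^^ i) (glued_slide 1 origin) = (False, int i, 1)"
    "(slide 1 ^^ i) (glued_slide (-1) origin) = (False, int i, -1)"
    "(glued_slide 1 ^^ i) (slide 1 origin) = glue (False, int i, 1)"
    "(glued_slide 1 ^^ i) (slide (-1) origin) = glue (False, int i, -1)" for i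
    by (simp_all add: slide_pow glued_slide_pow glued_slide_def glue_plus del: glue.simps)
  have 2: "glued_slide (-1) origin = glue (False, -1, 0)" "slide (-1) origin = (False, -1, 0)"
    by (simp_all add: glued_slide_def glue_plus del: glue.simps)
  have 3: "int (Suc k) = int k + 1" for k by simp
  have "arm_zeros m \<union> glue ` arm_zeros n =
      {(False, -1, 0), glue (False, -1, 0), (False, int m + 1, 0), glue (False, int n + 1, 0)} \<union>
      (\<lambda>i. (False, int i, 1)) ` {1..m} \<union> (\<lambda>i. (False, int i, -1)) ` {1..m} \<union>
      (\<lambda>j. glue (False, int j, 1)) ` {1..n} \<union> (\<lambda>j. glue (False, int j, -1)) ` {1..n}"
    unfolding arm_zeros_def image_Un image_insert image_image image_empty by blast
  then show ?thesis
    unfolding W.zeros_def 1 pow_origin unfolding 2 3 by (rule sym)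
qed

text \<open>From the second step on, the vertical arm has first component \<open>True\<close>. Its
  first point \<open>(False, 0, 1)\<close> is avoided because the side points tested along the
  horizontal arm begin at i = 1.\<close>

lemma glue_arm_ones: "glue (False, int i, 0) \<notin> arm_zeros n"
proof -
  consider "i = 0" | "i = 1" | "2 \<le> i" by linarith
  then show ?thesis
    by cases (auto simp: arm_zeros_def plus_shaped_def linked_def)
qed

lemma ones_Int_zeros: "W.ones m n \<inter> W.zeros m n = {}"
proof -
  have a: "arm_ones k \<inter> arm_zeros k = {}" for k
    by (auto simp: arm_ones_def arm_zeros_def)
  have b: "glue ` arm_ones k \<inter> arm_zeros l = {}" for k l
    unfolding arm_ones_def image_image using glue_arm_ones by blast
  have "glue ` (glue ` arm_ones k \<inter> arm_zeros l) = arm_ones k \<inter> glue ` arm_zeros l" for k l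
    by (simp only: image_Int[OF inj_glue] image_image glue_glue image_ident)
  then have c: "arm_ones k \<inter> glue ` arm_zeros l = {}" for k l
    unfolding b image_empty by (rule sym)
  have d: "glue ` arm_ones k \<inter> glue ` arm_zeros k = {}" for k
    unfolding image_Int[OF inj_glue, symmetric] a by (rule image_empty)
  show ?thesis unfolding ones_eq zeros_eq Int_Un_distrib Int_Un_distrib2 a b c d by simp
qed

definition arm_nbhd :: "nat \<Rightarrow> (bool \<times> int \<times> int) set" where
  "arm_nbhd m = arm_ones m \<union> arm_zeros m"

definition num_tested :: "nat \<Rightarrow> nat \<Rightarrow> nat" where
  "num_tested m n = card (arm_nbhd m \<union> glue ` arm_nbhd n)"

lemma finite_arm_nbhd: "finite (arm_nbhd m)"
  by (simp add: arm_nbhd_def arm_ones_def arm_zeros_def)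

lemma fst_arm_nbhd: "x \<in> arm_nbhd m \<Longrightarrow> \<not> fst x"
  by (auto simp: arm_nbhd_def arm_ones_def arm_zeros_def)

text \<open>Inclusion and exclusion. \<open>arm_nbhd\<close> does not depend on \<open>I\<close>, so
  the dependence of the count on \<open>I\<close> sits entirely in the intersection.\<close>

lemma num_tested_eq:
  "num_tested m n + card (arm_nbhd m \<inter> glue ` arm_nbhd n) = card (arm_nbhd m) + card (arm_nbhd n)"
  using card_Un_Int[of "arm_nbhd m" "glue ` arm_nbhd n"] finite_arm_nbhd card_image[OF inj_on_subset[OF inj_glue]]
  by (simp add: num_tested_def)

lemma realize_dimension:
  obtains d where "attained d"
    "(\<lambda>M. \<Sum>m<M. \<Sum>n<M. (1/2) ^ num_tested m n) \<longlonglongrightarrow> d"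
proof -
  have inj: "inj (\<lambda>k. (slide 1 ^^ k) origin)" "inj (\<lambda>k. (glued_slide 1 ^^ k) origin)"
    unfolding pow_origin by (auto intro!: injI dest: injD[OF inj_glue] simp del: glue.simps)
  have eq: "card (W.ones m n \<union> W.zeros m n) = num_tested m n" for m n
    unfolding num_tested_def arm_nbhd_def ones_eq zeros_eq image_Un
    by (rule arg_cong[where f = card]) blast
  show ?thesis
    using W.F2_vn_dim[OF inj ones_Int_zeros] that unfolding eq by blast
qed

end

section \<open>How the dimension depends on the set of coincidences\<close>

lemma glue_mono:
  assumes "I \<subseteq> J"
  shows "arm_nbhd m \<inter> glue I ` arm_nbhd n \<subseteq> arm_nbhd m \<inter> glue J ` arm_nbhd n"
proof
  fix x assume x: "x \<in> arm_nbhd m \<inter> glue I ` arm_nbhd n"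
  then obtain y where y: "y \<in> arm_nbhd n" "x = glue I y" by blast
  obtain i t where yi: "y = (False, i, t)" using fst_arm_nbhd[OF y(1)] by (cases y) auto
  have "\<not> fst x" by (rule fst_arm_nbhd[of x m]) (use x in blast)
  \<comment> \<open>Only these two kinds of points keep first component \<open>False\<close> under
    \<open>glue\<close>, and both kinds persist, with the same image, when \<open>I\<close>
    grows.\<close>
  then have "plus_shaped i t \<or> linked I i t" unfolding y(2) yi by (simp split: if_splits)
  then have "glue J y = glue I y" unfolding yi using assms by (auto simp: linked_def)
  then have "x = glue J y" unfolding y(2) by (rule sym)
  then have "x \<in> glue J ` arm_nbhd n" using y(1) by (rule image_eqI)
  then show "x \<in> arm_nbhd m \<inter> glue J ` arm_nbhd n" using x by (intro IntI IntD1[OF x])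
qed

lemma num_tested_antimono:
  assumes "I \<subseteq> J"
  shows "num_tested J m n \<le> num_tested I m n"
proof -
  have "card (arm_nbhd m \<inter> glue I ` arm_nbhd n) \<le> card (arm_nbhd m \<inter> glue J ` arm_nbhd n)"
    by (rule card_mono[OF _ glue_mono[OF assms]]) (simp add: finite_arm_nbhd)
  then show ?thesis using num_tested_eq[of I m n] num_tested_eq[of J m n] by linarith
qed

lemma num_tested_strict:
  assumes "I \<subseteq> J" "n \<in> J" "n \<notin> I"
  shows "num_tested J (Suc n) (Suc n) < num_tested I (Suc n) (Suc n)"
proof -
  \<comment> \<open>The point \<open>a\<^sup>i b x\<^sub>0\<close> with i = n + 1, beside the tip of
    the horizontal arm of length n + 1. It equals \<open>b\<^sup>i a x\<^sub>0\<close> for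
    \<open>J\<close> but not for \<open>I\<close>.\<close>
  let ?x = "(False, int (Suc n), 1) :: bool \<times> int \<times> int"
  let ?B = "arm_nbhd (Suc n)"
  have x: "?x \<in> ?B" unfolding arm_nbhd_def arm_zeros_def by (rule UnI2) (auto intro!: image_eqI[of _ _ "Suc n"])
  have np: "\<not> plus_shaped (int (Suc n)) 1" by (simp add: plus_shaped_def)
  have "glue J ?x = ?x" using assms np by (simp add: linked_def)
  then have inJ: "?x \<in> glue J ` ?B" using x by (metis imageI)
  have "?x \<notin> glue I ` ?B"
  proof
    assume "?x \<in> glue I ` ?B"
    then obtain y where y: "y \<in> ?B" "?x = glue I y" by blast
    then have "y = glue I ?x" by (simp del: glue.simps)
    also have "\<dots> = (True, int (Suc n), 1)" using assms np by (simp add: linked_def)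
    finally show False using fst_arm_nbhd[OF y(1)] by simp
  qed
  then have nm: "?x \<notin> ?B \<inter> glue I ` ?B" by (simp only: Int_iff simp_thms)
  have "?x \<in> ?B \<inter> glue J ` ?B" using x inJ by (rule IntI)
  with nm have "?B \<inter> glue I ` ?B \<noteq> ?B \<inter> glue J ` ?B" by metis
  then have "?B \<inter> glue I ` ?B \<subset> ?B \<inter> glue J ` ?B"
    using glue_mono[OF assms(1)] by (rule psubsetI[rotated])
  then have "card (?B \<inter> glue I ` ?B) < card (?B \<inter> glue J ` ?B)"
    by (intro psubset_card_mono) (simp add: finite_arm_nbhd)
  then show ?thesis using num_tested_eq[of I "Suc n" "Suc n"] num_tested_eq[of J "Suc n" "Suc n"] by linarith
qed

text \<open>The terms are comparable throughout, and a single strict inequality, at the index pair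
  \<open>(Suc k, Suc k)\<close>, leaves a fixed gap \<open>c\<close> in all large partial sums and
  hence in the limits.\<close>

lemma dimension_strict_mono:
  assumes "I \<subset> J"
    and I: "(\<lambda>M. \<Sum>m<M. \<Sum>n<M. (1/2) ^ num_tested I m n) \<longlonglongrightarrow> (d::real)"
    and J: "(\<lambda>M. \<Sum>m<M. \<Sum>n<M. (1/2) ^ num_tested J m n) \<longlonglongrightarrow> (e::real)"
  shows "d < e"
proof -
  obtain k where k: "k \<in> J" "k \<notin> I" using assms(1) by blast
  let ?t = "\<lambda>I m n. (1/2 :: real) ^ num_tested I m n"
  define c where "c = ?t J (Suc k) (Suc k) - ?t I (Suc k) (Suc k)"
  have c: "c > 0"
    unfolding c_def using num_tested_strict[OF _ k] assms(1) by (simp add: psubset_imp_subset power_strict_decreasing)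
  have le: "?t I m n \<le> ?t J m n" for m n
    using num_tested_antimono[of I J m n] assms(1) by (intro power_decreasing) auto
  have "(\<Sum>m<M. \<Sum>n<M. ?t I m n) + c \<le> (\<Sum>m<M. \<Sum>n<M. ?t J m n)" if M: "M \<ge> Suc (Suc k)" for M
  proof -
    have "c \<le> (\<Sum>n<M. ?t J (Suc k) n - ?t I (Suc k) n)"
      unfolding c_def by (rule member_le_sum) (use M le in auto)
    also have "\<dots> \<le> (\<Sum>m<M. \<Sum>n<M. ?t J m n - ?t I m n)"
      by (rule member_le_sum[where f = "\<lambda>m. \<Sum>n<M. ?t J m n - ?t I m n"]) (use M le in \<open>auto intro!: sum_nonneg\<close>)
    also have "\<dots> = (\<Sum>m<M. \<Sum>n<M. ?t J m n) - (\<Sum>m<M. \<Sum>n<M. ?t I m n)"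
      by (simp only: sum_subtractf)
    finally show ?thesis by linarith
  qed
  then have "d + c \<le> e"
    by (intro LIMSEQ_le[OF tendsto_add[OF I tendsto_const] J]) blast
  then show ?thesis using c by linarith
qed

lemma countable_algebraic_reals: "countable {x :: real. algebraic x}"
proof -
  \<comment> \<open>Lists of integers are countable and yield all polynomials with integer
    coefficients; each nonzero one has finitely many roots.\<close>
  let ?p = "\<lambda>l. Poly (map real_of_int l)"
  have "{x :: real. algebraic x} \<subseteq> (\<Union>l\<in>{l. ?p l \<noteq> 0}. {x. poly (?p l) x = 0})"
  proof
    fix x :: real assume "x \<in> {x. algebraic x}"
    then obtain p where p: "\<And>i. coeff p i \<in> \<int>" "p \<noteq> 0" "poly p x = 0"
      by (auto simp: algebraic_def)
    have "\<forall>y\<in>set (coeffs p). \<exists>i. y = real_of_int i"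
    proof
      fix y assume "y \<in> set (coeffs p)"
      then have "y \<in> range (coeff p)" unfolding range_coeff by (rule insertI2)
      then have "y \<in> \<int>" using p(1) by blast
      then show "\<exists>i. y = real_of_int i" by (auto elim: Ints_cases)
    qed
    then obtain l where "coeffs p = map real_of_int l"
      unfolding ex_map_conv[symmetric] by blast
    from arg_cong[OF this, of Poly] have "?p l = p" unfolding Poly_coeffs by (rule sym)
    then show "x \<in> (\<Union>l\<in>{l. ?p l \<noteq> 0}. {x. poly (?p l) x = 0})" using p by blast
  qed
  moreover have "countable (\<Union>l\<in>{l. ?p l \<noteq> 0}. {x. poly (?p l) x = 0})"
    by (intro countable_UN) (auto intro: countable_finite poly_roots_finite)
  ultimately show ?thesis by (rule countable_subset)
qed

theorem corollary1p2:
  shows "\<exists>V. subgroup V (Z2_sum F2) \<and> translation_invariant F2 V \<and>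
    finitely_generated (Z2_sum_quotient_semidirect F2 V) \<and>
    (\<exists>Q \<in> rat_group_ring (Z2_sum_quotient_semidirect F2 V).
       vn_dim (Z2_sum_quotient_semidirect F2 V)
         (ell2_kernel (Z2_sum_quotient_semidirect F2 V) Q) \<notin> \<rat> \<and>
       \<not> algebraic (vn_dim (Z2_sum_quotient_semidirect F2 V)
         (ell2_kernel (Z2_sum_quotient_semidirect F2 V) Q)))"
proof -
  let ?D = "\<lambda>I d. (\<lambda>M. \<Sum>m<M. \<Sum>n<M. (1/2) ^ num_tested I m n) \<longlonglongrightarrow> d"
  have "\<exists>d. attained d \<and> ?D I d" for I
    by (rule realize_dimension[of I]) blast
  then obtain dim where dim: "\<And>I. attained (dim I)" "\<And>I. ?D I (dim I)" by metis
  \<comment> \<open>Strict monotonicity separates only comparable sets, so an uncountable chain of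
    subsets of the naturals is needed; the lower cuts in the rationals form one.\<close>
  define cut where "cut r = {n. real_of_rat (nat_to_rat_surj n) < r}" for r :: real
  have "cut r \<subset> cut s" if rs: "r < s" for r s
  proof -
    obtain q where q: "r < real_of_rat q" "real_of_rat q < s" using of_rat_dense[OF rs] by blast
    obtain n where "q = nat_to_rat_surj n" using surjD[OF surj_nat_to_rat_surj, of q] by blast
    then have "n \<in> cut s" "n \<notin> cut r" using q by (auto simp: cut_def)
    moreover have "cut r \<subseteq> cut s" using rs by (auto simp: cut_def)
    ultimately show ?thesis by blast
  qed
  then have "dim (cut r) < dim (cut s)" if "r < s" for r s
    using dimension_strict_mono[OF _ dim(2) dim(2)] that by blast
  then have "inj (\<lambda>r. dim (cut r))" by (intro linorder_injI) (metis less_irrefl)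
  then have "uncountable (range (\<lambda>r. dim (cut r)))"
    using uncountable_UNIV_real countable_image_inj_on by blast
  then have "\<not> range (\<lambda>r. dim (cut r)) \<subseteq> {x. algebraic x}"
    using countable_subset countable_algebraic_reals by blast
  then obtain r where "\<not> algebraic (dim (cut r))" by blast
  then have nalg: "\<not> algebraic (complex_of_real (dim (cut r)))" by simp
  then have nrat: "complex_of_real (dim (cut r)) \<notin> \<rat>" using rat_imp_algebraic by blast
  from dim(1)[of "cut r"] obtain V Q where "subgroup V (Z2_sum F2)" "translation_invariant F2 V"
      "finitely_generated (Z2_sum_quotient_semidirect F2 V)"
      "Q \<in> rat_group_ring (Z2_sum_quotient_semidirect F2 V)"
      "vn_dim (Z2_sum_quotient_semidirect F2 V) (ell2_kernel (Z2_sum_quotient_semidirect F2 V) Q) =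
        complex_of_real (dim (cut r))"
    unfolding attained_def by blast
  with nalg nrat show ?thesis by metis
qed

end
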